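(* Let $s\in(0,1)$, let $\Omega\subset\mathbb{R}^n$ be a bounded domain with volume $|\Omega|$, and let $\lambda_k(\Omega)$ denote the $k$-th eigenvalue of the mixed local-nonlocal Dirichlet problem $$-a\Delta u(x)+b(-\Delta)^s u(x)=\lambda u(x),\ x\in\Omega,\qquad u(x)=0,\ x\in\mathbb{R}^n\setminus\Omega .$$ By the monotonicity (nondecreasing property) of the map $k\mapsto\lambda_k(\Omega)$, the following hold for $k=1,2,3,\ldots$. (i) If $a>0$ and $b>0$, then $$\lambda_{k}(\Omega)\geq n\max\left\{\frac{4a\pi }{n+2}\left(\frac{\Gamma\left(1+\frac{n}{2}\right)}{|\Omega|}\right)^{\frac{2}{n}}k^{\frac{2}{n}},\ \frac{(4\pi)^{s}b}{n+2s}\left(\frac{\Gamma\left(1+\frac{n}{2}\right)}{|\Omega|}\right)^{\frac{2s}{n}}k^{\frac{2s}{n}}\right\}.$$ (ii) If $a>0$ and $-\frac{a}{C_{E}}<b<0$, where $C_E\ge 1$, depending only on $n$ and $s$, is the constant in the embedding inequality $$\int_{\Omega}\int_{\Omega}\frac{|u(x)-u(y)|^{2}}{|x-y|^{n+2s}}\,dx\,dy\leq C_{E}\|\nabla u\|^{2}_{L^{2}(\Omega)},$$ then $$\lambda_{k}(\Omega)\geq (a+C_{E}b)\,n\max\left\{\frac{4\pi }{n+2}\left(\frac{\Gamma\left(1+\frac{n}{2}\right)}{|\Omega|}\right)^{\frac{2}{n}}k^{\frac{2}{n}},\ \frac{(4\pi)^{s}}{(n+2s)C_{E}}\left(\fr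ac{\Gamma\left(1+\frac{n}{2}\right)}{|\Omega|}\right)^{\frac{2s}{n}}k^{\frac{2s}{n}}\right\}.$$
   Context: The fractional Laplacian is $$(-\Delta)^{s}u(x)=\frac{c_{n,s}}{2}\int_{\mathbb{R}^{n}}\frac{2u(x)-u(x+y)-u(x-y)}{|y|^{n+2s}}\,dy,\qquad c_{n,s}=\left(\int_{\mathbb{R}^{n}}\frac{1-\cos\zeta_{1}}{|\zeta|^{n+2s}}\,d\zeta\right)^{-1}.$$ Standing assumption: $\Omega$ is a connected bounded open set with $C^1$-smooth boundary. Let $\mathbb{X}(\Omega)=\{u\in H^1(\mathbb{R}^n): u\equiv 0 \text{ a.e. on } \mathbb{R}^n\setminus\Omega\}$, identified with $H^1_0(\Omega)$ via extension by zero. A number $\lambda(\Omega)$ is a (variational) eigenvalue of the problem if there is a nonzero weak solution $u\in\mathbb{X}(\Omega)$, $u:\mathbb{R}^n\to\mathbb{R}$ (then called an eigenfunction), that is, $$a\int_{\Omega}\langle\nabla u,\nabla\varphi\rangle\,dx+b\int_{\Omega}\int_{\Omega}\frac{(u(x)-u(y))(\varphi(x)-\varphi(y))}{|x-y|^{n+2s}}\,dx\,dy=\lambda(\Omega)\int_{\Omega}u(x)\varphi(x)\,dx\quad\text{for every }\varphi\in\mathbb{X}(\Omega).$$ The eigenvalues are listed in nondecreasing order, repeated according to multiplicity, with corresponding eigenfunctions $u_1,u_2,\ldots$ orthonormal in $L^2(\Omega)$. The embedding inequality defining $C_E$ is stated for $s\in(0,1)$, for $\Omega$ an open set in $\mathbb{R}^n$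 of class $C^{0,1}$ with bounded boundary, and for measurable $u:\Omega\to\mathbb{R}$, with $C_E\ge1$ depending only on $n$ and $s$. It expresses the continuous embedding $H^1_0(\Omega)\subset H^s_0(\Omega)$.
   Formalization: In the weak form and in the inequality defining C_E, the double integral over Ω×Ω is replaced by c_{n,s}/2 times the one over R^n×R^n (the form of (−Δ)^s), and C_E is any constant ≥1 valid on H^1_0(Ω) for the given Ω, not one depending only on n and s. *)

theory Defs
  imports "HOL-Analysis.Analysis"
begin

section \<open>Sobolev functions on the whole space\<close>

definition C1_test_function :: "(real^'n \<Rightarrow> real) \<Rightarrow> (real^'n \<Rightarrow> real^'n) \<Rightarrow> bool" where
  "C1_test_function \<phi> D\<phi> \<longleftrightarrow>
     (\<forall>x. GDERIV \<phi> x :> D\<phi> x) \<and> continuous_on UNIV D\<phi> \<and> bounded {x. \<phi> x \<noteq> 0}"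

text \<open>
  Elements of \<open>H\<^sup>1\<close> are classes modulo null sets. Every such class has a Borel
  representative, so we work with Borel functions and Lebesgue-Borel measure.
  Weak derivatives are tested against compactly supported \<open>C\<^sup>1\<close> functions, as in Brezis.
\<close>

definition is_weak_gradient :: "(real^'n \<Rightarrow> real) \<Rightarrow> (real^'n \<Rightarrow> real^'n) \<Rightarrow> bool" where
  "is_weak_gradient u G \<longleftrightarrow>
     (\<forall>\<phi> D\<phi>. C1_test_function \<phi> D\<phi> \<longrightarrow>
        (LINT x|lborel. u x *\<^sub>R D\<phi> x) = - (LINT x|lborel. \<phi> x *\<^sub>R G x))"

definition L2_weak_gradient :: "(real^'n \<Rightarrow> real) \<Rightarrow> (real^'n \<Rightarrow> real^'n) \<Rightarrow> bool" where
  "L2_weak_gradient u G \<longleftrightarrow>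
     G \<in> borel_measurable lborel \<and> integrable lborel (\<lambda>x. (norm (G x))\<^sup>2) \<and>
     is_weak_gradient u G"

definition H1 :: "(real^'n \<Rightarrow> real) set" where
  "H1 = {u. u \<in> borel_measurable lborel \<and> integrable lborel (\<lambda>x. (u x)\<^sup>2) \<and>
            (\<exists>G. L2_weak_gradient u G)}"

text \<open>Determined up to a null set for \<open>u \<in> H1\<close>; it is only used under integrals.\<close>

definition weak_grad :: "(real^'n \<Rightarrow> real) \<Rightarrow> real^'n \<Rightarrow> real^'n" where
  "weak_grad u = (SOME G. L2_weak_gradient u G)"

definition X_space :: "(real^'n) set \<Rightarrow> (real^'n \<Rightarrow> real) set" where
  "X_space \<Omega> = {u \<in> H1. AE x in lborel. x \<notin> \<Omega> \<longrightarrow> u x = 0}"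

section \<open>Bounded domains with continuously differentiable boundary\<close>

text \<open>
  Near every boundary point \<open>\<Omega>\<close> is the region above the graph of a \<open>C\<^sup>1\<close> function in
  some rotated coordinate system, whose last axis is the unit vector \<open>e\<close>. The argument
  \<open>x - (x \<bullet> e) *\<^sub>R e\<close> is the projection of \<open>x\<close> to the hyperplane orthogonal to \<open>e\<close>.
\<close>

definition C1_boundary :: "(real^'n) set \<Rightarrow> bool" where
  "C1_boundary \<Omega> \<longleftrightarrow>
     (\<forall>p\<in>frontier \<Omega>. \<exists>r>0. \<exists>e \<gamma> D\<gamma>.
        norm e = 1 \<and> (\<forall>x. GDERIV \<gamma> x :> D\<gamma> x) \<and> continuous_on UNIV D\<gamma> \<and>
        \<Omega> \<inter> ball p r = {x \<in> ball p r. \<gamma> (x - (x \<bullet> e) *\<^sub>R e) < x \<bullet> e})"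

definition bounded_C1_domain :: "(real^'n) set \<Rightarrow> bool" where
  "bounded_C1_domain \<Omega> \<longleftrightarrow>
     open \<Omega> \<and> connected \<Omega> \<and> \<Omega> \<noteq> {} \<and> bounded \<Omega> \<and> C1_boundary \<Omega>"

section \<open>The mixed local-nonlocal eigenvalue problem\<close>

text \<open>
  The index type has no distinguished first element; by rotation invariance the value of
  the constant does not depend on the coordinate chosen.
\<close>

definition frac_const :: "('n::finite) itself \<Rightarrow> real \<Rightarrow> real" where
  "frac_const _ s =
     inverse (LINT \<zeta>::real^'n|lborel.
       (1 - cos (\<zeta> $ (SOME i. True))) / norm \<zeta> powr (real CARD('n) + 2 * s))"

text \<open>
  The symmetric bilinear form of the fractional Laplacian
  \<open>(-\<Delta>)\<^sup>s u(x) = c/2 \<integral> (2u(x) - u(x+y) - u(x-y)) / |y|\<^bsup>n+2s\<^esup> dy\<close>,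
  obtained by multiplying with \<open>v\<close> and integrating over the whole space; hence the factor
  \<open>c/2\<close> and the integration over all pairs. Integrating over \<open>\<Omega> \<times> \<Omega>\<close> only would give the
  form of the regional operator instead: functions vanishing outside \<open>\<Omega>\<close> also have
  interaction energy between \<open>\<Omega>\<close> and its complement. For \<open>u, v \<in> H1\<close> and \<open>0 < s < 1\<close> the
  double integral converges absolutely.
\<close>

definition frac_form :: "real \<Rightarrow> (real^'n \<Rightarrow> real) \<Rightarrow> (real^'n \<Rightarrow> real) \<Rightarrow> real" where
  "frac_form s u v =
     frac_const TYPE('n) s / 2 *
     (LINT x|lborel. LINT y|lborel.
        (u x - u y) * (v x - v y) / norm (x - y) powr (real CARD('n) + 2 * s))"

definition weak_solution ::
  "real \<Rightarrow> real \<Rightarrow> real \<Rightarrow> (real^'n) set \<Rightarrow> real \<Rightarrow> (real^'n \<Rightarrow> real) \<Rightarrow> bool" where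
  "weak_solution a b s \<Omega> \<mu> u \<longleftrightarrow>
     u \<in> X_space \<Omega> \<and>
     (\<forall>\<phi>\<in>X_space \<Omega>.
        a * (LINT x:\<Omega>|lborel. weak_grad u x \<bullet> weak_grad \<phi> x) + b * frac_form s u \<phi>
        = \<mu> * (LINT x:\<Omega>|lborel. u x * \<phi> x))"

definition eigenfunction ::
  "real \<Rightarrow> real \<Rightarrow> real \<Rightarrow> (real^'n) set \<Rightarrow> real \<Rightarrow> (real^'n \<Rightarrow> real) \<Rightarrow> bool" where
  "eigenfunction a b s \<Omega> \<mu> u \<longleftrightarrow>
     weak_solution a b s \<Omega> \<mu> u \<and> \<not> (AE x in lborel. u x = 0)"

text \<open>
  An enumeration, with indices \<open>k \<ge> 1\<close> (index 0 is ignored), of all eigenvalues in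
  nondecreasing order and with multiplicity, with \<open>L\<^sup>2\<close>-orthonormal eigenfunctions. The last
  clause says that the listed eigenfunctions for \<open>\<mu>\<close> span the eigenspace of \<open>\<mu>\<close>, so that no
  eigenvalue is omitted and each occurs as often as its multiplicity.
\<close>

definition eigen_listing ::
  "real \<Rightarrow> real \<Rightarrow> real \<Rightarrow> (real^'n) set \<Rightarrow> (nat \<Rightarrow> real) \<Rightarrow> (nat \<Rightarrow> real^'n \<Rightarrow> real) \<Rightarrow> bool" where
  "eigen_listing a b s \<Omega> lam u \<longleftrightarrow>
     (\<forall>k\<ge>1. eigenfunction a b s \<Omega> (lam k) (u k)) \<and>
     (\<forall>j\<ge>1. \<forall>k\<ge>j. lam j \<le> lam k) \<and>
     (\<forall>j\<ge>1. \<forall>k\<ge>1. (LINT x:\<Omega>|lborel. u j x * u k x) = (if j = k then 1 else 0)) \<and>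
     (\<forall>\<mu> w. eigenfunction a b s \<Omega> \<mu> w \<longrightarrow>
        (\<exists>F c. finite F \<and> F \<subseteq> {k. 1 \<le> k \<and> lam k = \<mu>} \<and>
               (AE x in lborel. w x = (\<Sum>k\<in>F. c k * u k x))))"

text \<open>
  The energy is the one of the weak formulation. The constant is attached to \<open>\<Omega>\<close>: the two
  sides scale differently under dilations of \<open>\<Omega>\<close>, so none is valid for all domains at once.
\<close>

definition embedding_const :: "real \<Rightarrow> (real^'n) set \<Rightarrow> real \<Rightarrow> bool" where
  "embedding_const s \<Omega> C \<longleftrightarrow>
     C \<ge> 1 \<and>
     (\<forall>w\<in>X_space \<Omega>. frac_form s w w \<le> C * (LINT x:\<Omega>|lborel. (norm (weak_grad w x))\<^sup>2))"

end

theory Submission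
  imports Defs "HOL-Probability.Probability"
begin

text \<open>
  The argument is that of Li and Yau. Let \<open>P\<^sub>j\<close> be the squared modulus of the Fourier transform
  of the eigenfunction \<open>u\<^sub>j\<close>. Up to the factor \<open>(2\<pi>)\<^sup>n\<close> the gradient energy and the fractional
  energy of \<open>u\<^sub>j\<close> are the moments of \<open>P\<^sub>j\<close> of order \<open>2\<close> and \<open>2s\<close>. Bessel's inequality for the
  restrictions of plane waves to \<open>\<Omega>\<close> bounds \<open>P\<^sub>1 + \<dots> + P\<^sub>k\<close> by \<open>\<bar>\<Omega>\<bar>\<close>, and by Plancherel its
  integral is \<open>(2\<pi>)\<^sup>n k\<close>; under these two constraints the moments are smallest when all mass
  fills a ball at constant height. The sum of the first \<open>k\<close> eigenvalues is at most \<open>k\<close> times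
  the last one.
\<close>

subsection \<open>Gaussian integrals\<close>

text \<open>Only the squared modulus of a Fourier transform ever occurs, so no transform on L2 is
  constructed: everything is reduced to integrals of Gaussians against cosines. Plancherel's theorem
  comes from damping the spectrum by exp(-t |\<xi>|^2) and letting t tend to 0. The fractional
  kernel is a mixture of Gaussians, so the same damped identity yields the fractional energy, and
  the same mixture evaluates \<open>frac_const\<close>, which therefore cancels. That this energy is
  exactly a spectral moment relies on \<open>frac_form\<close> running over all pairs of points of
  the space. The gradient poses another problem: \<open>weak_grad\<close> is some L2 weak gradient
  on the whole space, while the eigenvalue problem integrates over \<Omega>. It has to be shown to
  vanish almost everywhere outside \<Omega>; here the C1 boundary enters, as it makes the frontier a
  null set. For b < 0 the energies compete, and the embedding inequality is used twice: it bounds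
  the negative term by the gradient energy, and it bounds the gradient energy from below by the
  fractional one, which gives the second entry of the maximum.\<close>

lemma
  fixes c \<xi> :: real
  assumes "c > 0"
  shows gaussian_iexp_integrable_real: "integrable lborel (\<lambda>x::real. exp (- c * x\<^sup>2) *\<^sub>R iexp (\<xi> * x))" (is ?A)
    and gaussian_iexp_integral_real:
      "(LINT x|lborel. exp (- c * x\<^sup>2) *\<^sub>R iexp (\<xi> * x)) = of_real (sqrt (pi / c) * exp (- \<xi>\<^sup>2 / (4 * c)))" (is ?B)
proof -
  \<comment> \<open>With this k, (k x)^2 / 2 = c x^2, so the substitution x -> k x leads to the
    standard normal density, whose characteristic function is exp(-t^2 / 2); the frequency becomes
    \<xi> / k.\<close>
  define k where "k = sqrt (2 * c)"
  have k: "k > 0" "k\<^sup>2 = 2 * c" using assms by (auto simp: k_def)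
  have std: "has_bochner_integral lborel (\<lambda>x. std_normal_density x *\<^sub>R iexp (t * x)) (of_real (exp (- t\<^sup>2 / 2)))" for t
  proof -
    interpret real_distribution std_normal_distribution by (rule real_dist_normal_dist)
    have 1: "integrable std_normal_distribution (\<lambda>x. iexp (t * x))"
      by (rule integrable_iexp) auto
    hence 2: "integrable lborel (\<lambda>x. std_normal_density x *\<^sub>R iexp (t * x))"
      by (subst (asm) integrable_density) (auto simp: normal_density_nonneg)
    have "char std_normal_distribution t = (LINT x|lborel. std_normal_density x *\<^sub>R iexp (t * x))"
      unfolding char_def by (subst integral_density) (auto simp: normal_density_nonneg)
    with 2 show ?thesis
      by (simp add: has_bochner_integral_iff char_std_normal_distribution)
  qed
  from std[of "\<xi> / k"]
  have "has_bochner_integral lborel (\<lambda>x. std_normal_density (0 + k * x) *\<^sub>R iexp (\<xi> / k * (0 + k * x)))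
          (of_real (exp (- (\<xi>/k)\<^sup>2 / 2)) /\<^sub>R \<bar>k\<bar>)"
    by (subst (asm) lborel_has_bochner_integral_real_affine_iff[of k _ _ 0]) (use k in auto)
  hence "has_bochner_integral lborel (\<lambda>x. sqrt (2 * pi) *\<^sub>R (std_normal_density (0 + k * x) *\<^sub>R iexp (\<xi> / k * (0 + k * x))))
          (sqrt (2 * pi) *\<^sub>R (of_real (exp (- (\<xi>/k)\<^sup>2 / 2)) /\<^sub>R \<bar>k\<bar>))"
    by (rule has_bochner_integral_scaleR_right)
  moreover have "sqrt (2 * pi) *\<^sub>R (std_normal_density (0 + k * x) *\<^sub>R iexp (\<xi> / k * (0 + k * x)))
      = exp (- c * x\<^sup>2) *\<^sub>R iexp (\<xi> * x)" for x
    using k by (simp add: std_normal_density_def power_mult_distrib scaleR_conv_of_real)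
  moreover have "sqrt (2 * pi) *\<^sub>R (of_real (exp (- (\<xi>/k)\<^sup>2 / 2)) /\<^sub>R \<bar>k\<bar>)
      = (of_real (sqrt (pi / c) * exp (- \<xi>\<^sup>2 / (4 * c))) :: complex)"
  proof -
    have "sqrt (2 * pi) / k = sqrt (pi / c)"
      unfolding k_def by (simp add: real_sqrt_divide[symmetric])
    thus ?thesis using k
      by (simp add: scaleR_conv_of_real field_simps power_divide flip: of_real_mult of_real_divide)
  qed
  ultimately have "has_bochner_integral lborel (\<lambda>x::real. exp (- c * x\<^sup>2) *\<^sub>R iexp (\<xi> * x))
     (of_real (sqrt (pi / c) * exp (- \<xi>\<^sup>2 / (4 * c))))" by simp
  thus ?A ?B by (auto simp: has_bochner_integral_iff)
qed

text \<open>Both |x|^2 and \<xi> \<bullet> x are sums over \<open>Basis\<close>, so the integrand is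
  a product of one-dimensional ones, and \<open>lborel\<close> is the image of the product measure
  on the coordinates.\<close>

lemma
  fixes \<xi> :: "'a::euclidean_space" and c :: real
  assumes "c > 0"
  shows gaussian_iexp_integrable: "integrable lborel (\<lambda>x. exp (- c * (norm x)\<^sup>2) *\<^sub>R iexp (\<xi> \<bullet> x))" (is ?A)
    and gaussian_iexp_integral:
      "(LINT x|lborel. exp (- c * (norm x)\<^sup>2) *\<^sub>R iexp (\<xi> \<bullet> x))
        = of_real ((pi / c) powr (DIM('a) / 2) * exp (- (norm \<xi>)\<^sup>2 / (4 * c)))" (is ?B)
proof -
  interpret product_sigma_finite "\<lambda>_::'a. lborel :: real measure" ..
  let ?e = "\<lambda>f. \<Sum>b\<in>Basis. f b *\<^sub>R (b::'a)"
  let ?g = "\<lambda>b x. exp (- c * x\<^sup>2) *\<^sub>R iexp ((\<xi> \<bullet> b) * x)"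
  have eq: "exp (- c * (norm (?e f))\<^sup>2) *\<^sub>R iexp (\<xi> \<bullet> ?e f) = (\<Prod>b\<in>Basis. ?g b (f b))" for f :: "'a \<Rightarrow> real"
  proof -
    have "(norm (?e f))\<^sup>2 = (\<Sum>b\<in>Basis. (f b)\<^sup>2)"
      unfolding power2_norm_eq_inner by (subst euclidean_inner) (simp add: power2_eq_square)
    moreover have "\<xi> \<bullet> ?e f = (\<Sum>b\<in>Basis. (\<xi> \<bullet> b) * f b)"
      by (simp add: inner_sum_right mult.commute)
    ultimately show ?thesis
      by (simp add: scaleR_conv_of_real prod.distrib exp_sum sum_distrib_left flip: sum_negf)
  qed
  have "integrable (\<Pi>\<^sub>M b\<in>Basis. lborel) (\<lambda>f. \<Prod>b\<in>(Basis::'a set). ?g b (f b))"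
    by (intro product_integrable_prod gaussian_iexp_integrable_real assms) auto
  thus ?A
    by (subst lborel_eq, subst integrable_distr_eq) (measurable, simp only: eq)
  have "(LINT x|lborel. exp (- c * (norm x)\<^sup>2) *\<^sub>R iexp (\<xi> \<bullet> x))
     = integral\<^sup>L (Pi\<^sub>M Basis (\<lambda>_. lborel)) (\<lambda>f. \<Prod>b\<in>(Basis::'a set). ?g b (f b))"
    by (subst lborel_eq, subst integral_distr) (measurable, simp only: eq)
  also have "\<dots> = (\<Prod>b\<in>(Basis::'a set). LINT x|lborel. ?g b x)"
    by (intro product_integral_prod gaussian_iexp_integrable_real assms) auto
  also have "\<dots> = (\<Prod>b\<in>(Basis::'a set). of_real (sqrt (pi / c) * exp (- (\<xi> \<bullet> b)\<^sup>2 / (4 * c))))"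
    by (simp only: gaussian_iexp_integral_real[OF assms])
  also have "\<dots> = of_real (sqrt (pi / c) ^ DIM('a) * exp (\<Sum>b\<in>(Basis::'a set). - (\<xi> \<bullet> b)\<^sup>2 / (4 * c)))"
    by (simp add: prod.distrib exp_sum)
  also have "sqrt (pi / c) ^ DIM('a) = (pi / c) powr (DIM('a) / 2)"
    using assms by (simp add: powr_half_sqrt[symmetric] powr_powr flip: powr_realpow)
  also have "(\<Sum>b\<in>(Basis::'a set). - (\<xi> \<bullet> b)\<^sup>2 / (4 * c)) = - (norm \<xi>)\<^sup>2 / (4 * c)"
    unfolding power2_norm_eq_inner
    by (subst (2) euclidean_inner) (simp add: power2_eq_square sum_negf flip: sum_divide_distrib)
  finally show ?B .
qed

text \<open>In a squared modulus only the cosines of phase differences survive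
  (\<open>power_spectrum_eq_double\<close>), so this real form is the one used later.\<close>

lemma
  fixes \<xi> :: "'a::euclidean_space" and c :: real
  assumes "c > 0"
  shows gaussian_cos_integrable: "integrable lborel (\<lambda>x. exp (- c * (norm x)\<^sup>2) * cos (\<xi> \<bullet> x))" (is ?A)
    and gaussian_cos_integral:
      "(LINT x|lborel. exp (- c * (norm x)\<^sup>2) * cos (\<xi> \<bullet> x))
        = (pi / c) powr (DIM('a) / 2) * exp (- (norm \<xi>)\<^sup>2 / (4 * c))" (is ?B)
proof -
  have *: "exp (- c * (norm x)\<^sup>2) * cos (\<xi> \<bullet> x) = Re (exp (- c * (norm x)\<^sup>2) *\<^sub>R iexp (\<xi> \<bullet> x))" for x
    by (simp add: exp_eq_polar)
  show ?A unfolding * by (rule integrable_Re[OF gaussian_iexp_integrable[OF assms]])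
  show ?B unfolding * by (subst integral_Re[OF gaussian_iexp_integrable[OF assms]])
     (simp only: gaussian_iexp_integral[OF assms] Re_complex_of_real)
qed

lemma
  fixes c :: real
  assumes "c > 0"
  shows gaussian_integrable: "integrable lborel (\<lambda>x::'a::euclidean_space. exp (- c * (norm x)\<^sup>2))" 
    and gaussian_integral:
      "(LINT x|lborel. exp (- c * (norm (x::'a))\<^sup>2)) = (pi / c) powr (DIM('a) / 2)"
  using gaussian_cos_integrable[OF assms, of "0::'a"] gaussian_cos_integral[OF assms, of "0::'a"] by simp_all

subsection \<open>The power spectrum and the heat kernel\<close>

text \<open>The squared modulus of the Fourier transform of a real function, without any factor \<open>2\<pi>\<close>.\<close>

definition power_spectrum :: "('a::euclidean_space \<Rightarrow> real) \<Rightarrow> 'a \<Rightarrow> real" where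
  "power_spectrum u \<xi> = (LINT x|lborel. u x * cos (\<xi> \<bullet> x))\<^sup>2 + (LINT x|lborel. u x * sin (\<xi> \<bullet> x))\<^sup>2"

lemma power_spectrum_nonneg [simp]: "power_spectrum u \<xi> \<ge> 0"
  by (simp add: power_spectrum_def)

lemma borel_measurable_power_spectrum [measurable]:
  assumes [measurable]: "u \<in> borel_measurable borel"
  shows "power_spectrum u \<in> borel_measurable borel"
  unfolding power_spectrum_def[abs_def] by measurable

lemma integrable_mult_bounded:
  fixes u h :: "'a \<Rightarrow> real"
  assumes "integrable M u" "h \<in> borel_measurable M" "\<And>x. \<bar>h x\<bar> \<le> B"
  shows "integrable M (\<lambda>x. u x * h x)"
proof (rule Bochner_Integration.integrable_bound)
  show "integrable M (\<lambda>x. B * u x)" using assms(1) by simp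
  show "(\<lambda>x. u x * h x) \<in> borel_measurable M" using assms(1,2) by measurable
  show "AE x in M. norm (u x * h x) \<le> norm (B * u x)"
    using assms(3) by (auto simp: abs_mult mult.commute[of "\<bar>u _\<bar>"] intro!: mult_right_mono order_trans[OF assms(3) abs_ge_self])
qed

lemma integrable_mult_cos: 
  fixes u :: "'a::euclidean_space \<Rightarrow> real"
  shows "integrable lborel u \<Longrightarrow> integrable lborel (\<lambda>x. u x * cos (\<xi> \<bullet> x))"
  by (rule integrable_mult_bounded[where B=1]) (auto simp: abs_le_iff)

lemma integrable_mult_sin:
  fixes u :: "'a::euclidean_space \<Rightarrow> real"
  shows "integrable lborel u \<Longrightarrow> integrable lborel (\<lambda>x. u x * sin (\<xi> \<bullet> x))"
  by (rule integrable_mult_bounded[where B=1]) (auto simp: abs_le_iff)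

lemma
  fixes f :: "'a::euclidean_space \<Rightarrow> real" and g :: "'b::euclidean_space \<Rightarrow> real"
  assumes "integrable lborel f" "integrable lborel g"
  shows integrable_tensor: "integrable lborel (\<lambda>p. f (fst p) * g (snd p))" (is ?A)
    and integral_tensor: "(LINT p|lborel. f (fst p) * g (snd p)) = integral\<^sup>L lborel f * integral\<^sup>L lborel g" (is ?B)
proof -
  have [measurable]: "f \<in> borel_measurable borel" "g \<in> borel_measurable borel"
    using assms by (auto dest: borel_measurable_integrable)
  have 1: "integrable (lborel \<Otimes>\<^sub>M lborel) (\<lambda>(x, y). f x * g y)"
    by (intro lborel_pair.Fubini_integrable) (use assms in \<open>auto simp: abs_mult\<close>)
  thus ?A by (simp add: lborel_prod case_prod_beta')
  show ?B using lborel_pair.integral_fst[OF 1] by (simp add: lborel_prod case_prod_beta')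
qed

text \<open>The addition theorem for the cosine joins the two squares into one double integral in
  which \<xi> occurs in a single cosine. Integration over \<xi> against a Gaussian then becomes
  explicit for every pair of points separately.\<close>

lemma power_spectrum_eq_double:
  assumes u: "integrable lborel u"
  shows "power_spectrum u \<xi> = (LINT p|lborel. u (fst p) * u (snd p) * cos (\<xi> \<bullet> (fst p - snd p)))"
proof -
  note i = integrable_mult_cos[OF u, of \<xi>] integrable_mult_sin[OF u, of \<xi>]
  have "power_spectrum u \<xi> = (LINT p|lborel. (u (fst p) * cos (\<xi> \<bullet> fst p)) * (u (snd p) * cos (\<xi> \<bullet> snd p)))
      + (LINT p|lborel. (u (fst p) * sin (\<xi> \<bullet> fst p)) * (u (snd p) * sin (\<xi> \<bullet> snd p)))"
    unfolding integral_tensor[OF i(1) i(1)] integral_tensor[OF i(2) i(2)]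
    by (simp add: power_spectrum_def power2_eq_square)
  also have "\<dots> = (LINT p|lborel. (u (fst p) * cos (\<xi> \<bullet> fst p)) * (u (snd p) * cos (\<xi> \<bullet> snd p)) 
      + (u (fst p) * sin (\<xi> \<bullet> fst p)) * (u (snd p) * sin (\<xi> \<bullet> snd p)))"
    by (rule Bochner_Integration.integral_add[symmetric]; rule integrable_tensor; rule i)
  also have "\<dots> = (LINT p|lborel. u (fst p) * u (snd p) * cos (\<xi> \<bullet> (fst p - snd p)))"
    by (intro Bochner_Integration.integral_cong) (auto simp: inner_diff_right cos_diff algebra_simps)
  finally show ?thesis .
qed

definition heat_kernel :: "real \<Rightarrow> 'a::euclidean_space \<Rightarrow> real" where
  "heat_kernel t z = exp (- (norm z)\<^sup>2 / (4 * t)) / (4 * pi * t) powr (DIM('a) / 2)"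

lemma heat_kernel_nonneg [simp]: "heat_kernel t z \<ge> 0"
  by (simp add: heat_kernel_def)

lemma borel_measurable_heat_kernel [measurable]: "heat_kernel t \<in> borel_measurable borel"
  unfolding heat_kernel_def[abs_def] by measurable

lemma heat_kernel_le: "heat_kernel t (z::'a::euclidean_space) \<le> 1 / (4 * pi * t) powr (DIM('a) / 2)" if "t > 0"
  unfolding heat_kernel_def using that by (intro divide_right_mono) (auto simp: divide_nonpos_pos)

lemma
  assumes t: "t > 0"
  shows integrable_heat_kernel: "integrable lborel (heat_kernel t :: 'a::euclidean_space \<Rightarrow> real)"
    and integral_heat_kernel: "integral\<^sup>L lborel (heat_kernel t :: 'a \<Rightarrow> real) = 1"
  using gaussian_integrable[of "1/(4*t)", where 'a='a] gaussian_integral[of "1/(4*t)", where 'a='a] t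
  by (auto simp: heat_kernel_def[abs_def] field_simps)

lemma nn_integral_heat_kernel_shift:
  assumes t: "t > 0"
  shows "(\<integral>\<^sup>+y. heat_kernel t (x - y :: 'a::euclidean_space) \<partial>lborel) = 1"
proof -
  have "(\<integral>\<^sup>+y. heat_kernel t (x - y) \<partial>lborel) = (\<integral>\<^sup>+y. heat_kernel t (y - x) \<partial>lborel)"
    by (simp add: heat_kernel_def norm_minus_commute)
  also have "\<dots> = (\<integral>\<^sup>+y. heat_kernel t (y - x) \<partial>distr lborel borel ((+) x))"
    by (simp add: lborel_distr_plus)
  also have "\<dots> = (\<integral>\<^sup>+y. heat_kernel t (y::'a) \<partial>lborel)"
    by (subst nn_integral_distr) auto
  also have "\<dots> = 1"
    by (subst nn_integral_eq_integral) (auto simp: integral_heat_kernel[OF t] integrable_heat_kernel[OF t])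
  finally show ?thesis .
qed

text \<open>The Gaussian makes the integrand absolutely integrable in the frequency and both points,
  so Fubini applies; without damping, the inner integral of the cosine over \<xi> would not exist.
  Integrating over \<xi> first turns the cosine into a heat kernel in the difference of the
  points.\<close>

lemma
  fixes u :: "'a::euclidean_space \<Rightarrow> real"
  assumes t: "t > 0" and u: "integrable lborel u"
  shows integrable_gaussian_power_spectrum: "integrable lborel (\<lambda>\<xi>. exp (- t * (norm \<xi>)\<^sup>2) * power_spectrum u \<xi>)" (is ?A)
    and integral_gaussian_power_spectrum:
      "(LINT \<xi>|lborel. exp (- t * (norm \<xi>)\<^sup>2) * power_spectrum u \<xi>) =
       (2 * pi) ^ DIM('a) * (LINT p|lborel. u (fst p) * u (snd p) * heat_kernel t (fst p - snd p))" (is ?B)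
proof -
  have [measurable]: "u \<in> borel_measurable borel" using u by (auto dest: borel_measurable_integrable)
  let ?f = "\<lambda>\<xi> p. exp (- t * (norm \<xi>)\<^sup>2) * (u (fst p) * u (snd p) * cos (\<xi> \<bullet> (fst p - snd p)))"
  have "integrable lborel (\<lambda>q. exp (- t * (norm (fst q))\<^sup>2) * (u (fst (snd q)) * u (snd (snd q))) :: real)"
    by (rule integrable_tensor[OF gaussian_integrable[OF t] integrable_tensor[OF u u]])
  hence "integrable lborel (\<lambda>q::'a \<times> 'a \<times> 'a. exp (- t * (norm (fst q))\<^sup>2) * (u (fst (snd q)) * u (snd (snd q)))
     * cos (fst q \<bullet> (fst (snd q) - snd (snd q))))"
    by (rule integrable_mult_bounded[where B=1])
      (auto intro!: borel_measurable_continuous_onI continuous_intros)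
  hence int: "integrable (lborel \<Otimes>\<^sub>M lborel) (\<lambda>(\<xi>, p). ?f \<xi> p)"
    by (simp add: lborel_prod case_prod_beta' mult.assoc)
  have ps: "(LINT p|lborel. ?f \<xi> p) = exp (- t * (norm \<xi>)\<^sup>2) * power_spectrum u \<xi>" for \<xi>
    by (simp add: power_spectrum_eq_double[OF u])
  show ?A using lborel_pair.integrable_fst[OF int] unfolding ps .
  have "(LINT \<xi>|lborel. exp (- t * (norm \<xi>)\<^sup>2) * power_spectrum u \<xi>) = (LINT p|lborel. LINT \<xi>|lborel. ?f \<xi> p)"
    unfolding ps[symmetric] using lborel_pair.Fubini_integral[OF int] by simp
  also have "\<dots> = (LINT p|lborel. u (fst p) * u (snd p) * ((pi / t) powr (DIM('a) / 2) * exp (- (norm (fst p - snd p))\<^sup>2 / (4 * t))))"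
  proof (rule Bochner_Integration.integral_cong[OF refl])
    fix p :: "'a \<times> 'a"
    have "(LINT \<xi>|lborel. ?f \<xi> p) = (LINT \<xi>|lborel. (u (fst p) * u (snd p)) * (exp (- t * (norm \<xi>)\<^sup>2) * cos ((fst p - snd p) \<bullet> \<xi>)))"
      by (simp add: inner_commute mult_ac)
    also have "\<dots> = u (fst p) * u (snd p) * ((pi / t) powr (DIM('a) / 2) * exp (- (norm (fst p - snd p))\<^sup>2 / (4 * t)))"
      by (simp only: integral_mult_right_zero gaussian_cos_integral[OF t])
    finally show "(LINT \<xi>|lborel. ?f \<xi> p) = \<dots>" .
  qed
  also have "\<dots> = (LINT p|lborel. (2 * pi) ^ DIM('a) * (u (fst p) * u (snd p) * heat_kernel t (fst p - snd p)))"
  proof -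
    \<comment> \<open>The base 4 pi^2 is the product of pi / t from the Gaussian integral and 4 pi t
      from the normalisation of \<open>heat_kernel\<close>; t cancels.\<close>
    have "(2 * pi) ^ DIM('a) = (4 * pi\<^sup>2) powr (DIM('a) / 2)"
      using powr_powr[of "2 * pi" 2 "DIM('a) / 2"] by (simp add: powr_realpow power_mult_distrib)
    also have "\<dots> = (pi / t * (4 * pi * t)) powr (DIM('a) / 2)"
      using t by (simp add: power2_eq_square mult_ac)
    also have "\<dots> = (pi / t) powr (DIM('a) / 2) * (4 * pi * t) powr (DIM('a) / 2)"
      using t by (subst powr_mult) auto
    finally have "(pi / t) powr (DIM('a) / 2) = (2 * pi) ^ DIM('a) / (4 * pi * t) powr (DIM('a) / 2)"
      using t by simp
    thus ?thesis by (simp add: heat_kernel_def mult_ac)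
  qed
  finally show ?B by simp
qed

lemma heat_kernel_minus_commute: "heat_kernel t (x - y) = heat_kernel t (y - x)"
  by (simp add: heat_kernel_def norm_minus_commute)

lemma
  fixes f :: "'a::euclidean_space \<Rightarrow> ennreal"
  assumes t: "t > 0" and [measurable]: "f \<in> borel_measurable borel"
  shows nn_integral_heat_fst: "(\<integral>\<^sup>+p. f (fst p) * heat_kernel t (fst p - snd p) \<partial>lborel) = (\<integral>\<^sup>+x. f x \<partial>lborel)" (is ?A)
    and nn_integral_heat_snd: "(\<integral>\<^sup>+p. f (snd p) * heat_kernel t (fst p - snd p) \<partial>lborel) = (\<integral>\<^sup>+x. f x \<partial>lborel)" (is ?B)
proof -
  have [measurable]: "(\<lambda>p::'a\<times>'a. heat_kernel t (fst p - snd p)) \<in> borel_measurable (lborel \<Otimes>\<^sub>M lborel)"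
    by measurable
  have "(\<integral>\<^sup>+p. f (fst p) * heat_kernel t (fst p - snd p) \<partial>(lborel \<Otimes>\<^sub>M lborel)) = (\<integral>\<^sup>+x. \<integral>\<^sup>+y. f x * heat_kernel t (x - y) \<partial>lborel \<partial>lborel)"
    by (subst lborel.nn_integral_fst[symmetric]) auto
  thus ?A by (simp add: nn_integral_cmult nn_integral_heat_kernel_shift t lborel_prod)
  have "(\<integral>\<^sup>+p. f (snd p) * heat_kernel t (fst p - snd p) \<partial>(lborel \<Otimes>\<^sub>M lborel)) = (\<integral>\<^sup>+y. \<integral>\<^sup>+x. f y * heat_kernel t (y - x) \<partial>lborel \<partial>lborel)"
    by (subst lborel_pair.nn_integral_snd[symmetric]) (auto simp: heat_kernel_minus_commute)
  thus ?B by (simp add: nn_integral_cmult nn_integral_heat_kernel_shift t lborel_prod)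
qed

text \<open>An averaged L2 modulus of continuity at length scale sqrt t: for t > 0, the mean under
  the heat kernel in z of the squared L2 distance between u and its translate by z. Values in
  \<open>ennreal\<close> allow estimates for arbitrary Borel functions, before any integrability is
  known.\<close>

definition heat_modulus :: "real \<Rightarrow> ('a::euclidean_space \<Rightarrow> real) \<Rightarrow> ennreal" where
  "heat_modulus t u = (\<integral>\<^sup>+p. ennreal ((u (fst p) - u (snd p))\<^sup>2 * heat_kernel t (fst p - snd p)) \<partial>lborel)"

lemma borel_measurable_fst_borel [measurable]: "fst \<in> borel_measurable (borel :: ('a::second_countable_topology \<times> 'b::second_countable_topology) measure)"
  and borel_measurable_snd_borel [measurable]: "snd \<in> borel_measurable (borel :: ('a::second_countable_topology \<times> 'b::second_countable_topology) measure)"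
  by (intro borel_measurable_continuous_onI continuous_intros)+

text \<open>Expand the square. Each squared term gives the full squared norm because the kernel has
  mass 1 in either variable; the cross term is integrable because u is and the kernel is bounded for
  fixed t. The second claim is the nonnegativity of the integrated square.\<close>

lemma
  assumes t: "t > 0" and u: "integrable lborel u" and u2: "integrable lborel (\<lambda>x. (u x)\<^sup>2)"
  shows heat_modulus_eq: "heat_modulus t u = ennreal (2 * (LINT x|lborel. (u x)\<^sup>2)
     - 2 * (LINT p|lborel. u (fst p) * u (snd p) * heat_kernel t (fst p - snd p)))"
    and heat_modulus_bound: "(LINT p|lborel. u (fst p) * u (snd p) * heat_kernel t (fst p - snd p)) \<le> (LINT x|lborel. (u x)\<^sup>2)"
proof -
  have [measurable]: "u \<in> borel_measurable borel" using u by (auto dest: borel_measurable_integrable)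
  let ?N = "LINT x|lborel. (u x)\<^sup>2"
  let ?k = "\<lambda>p. heat_kernel t (fst p - snd p)"
  have N: "(\<integral>\<^sup>+x. ennreal ((u x)\<^sup>2) \<partial>lborel) = ennreal ?N"
    using u2 by (subst nn_integral_eq_integral) auto
  have 1: "has_bochner_integral lborel (\<lambda>p. (u (fst p))\<^sup>2 * ?k p) ?N"
    by (rule has_bochner_integral_nn_integral)
       (use nn_integral_heat_fst[OF t, of "\<lambda>x. ennreal ((u x)\<^sup>2)"] in \<open>auto simp: N ennreal_mult\<close>)
  have 2: "has_bochner_integral lborel (\<lambda>p. (u (snd p))\<^sup>2 * ?k p) ?N"
    by (rule has_bochner_integral_nn_integral)
       (use nn_integral_heat_snd[OF t, of "\<lambda>x. ennreal ((u x)\<^sup>2)"] in \<open>auto simp: N ennreal_mult\<close>)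
  have "integrable lborel (\<lambda>p. u (fst p) * u (snd p) * ?k p)"
    by (rule integrable_mult_bounded[OF integrable_tensor[OF u u]])
       (auto intro: heat_kernel_le[OF t])
  hence 3: "has_bochner_integral lborel (\<lambda>p. u (fst p) * u (snd p) * ?k p) (LINT p|lborel. u (fst p) * u (snd p) * ?k p)"
    by (simp add: has_bochner_integral_iff)
  have "has_bochner_integral lborel (\<lambda>p. ((u (fst p))\<^sup>2 * ?k p + (u (snd p))\<^sup>2 * ?k p) - 2 * (u (fst p) * u (snd p) * ?k p))
    (?N + ?N - 2 * (LINT p|lborel. u (fst p) * u (snd p) * ?k p))"
    by (intro has_bochner_integral_diff has_bochner_integral_add 1 2 has_bochner_integral_mult_right 3)
  also have "(\<lambda>p. ((u (fst p))\<^sup>2 * ?k p + (u (snd p))\<^sup>2 * ?k p) - 2 * (u (fst p) * u (snd p) * ?k p))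
     = (\<lambda>p. (u (fst p) - u (snd p))\<^sup>2 * ?k p)"
    by (auto simp: fun_eq_iff power2_eq_square algebra_simps)
  finally have 4: "has_bochner_integral lborel (\<lambda>p. (u (fst p) - u (snd p))\<^sup>2 * ?k p) 
      (2 * ?N - 2 * (LINT p|lborel. u (fst p) * u (snd p) * ?k p))" by simp
  thus "heat_modulus t u = ennreal (2 * ?N - 2 * (LINT p|lborel. u (fst p) * u (snd p) * ?k p))"
    unfolding heat_modulus_def
    by (subst nn_integral_eq_integral) (auto simp: has_bochner_integral_iff)
  have "0 \<le> (LINT p|lborel. (u (fst p) - u (snd p))\<^sup>2 * ?k p)"
    by (rule integral_nonneg_AE) auto
  with 4 show "(LINT p|lborel. u (fst p) * u (snd p) * ?k p) \<le> ?N"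
    by (auto simp: has_bochner_integral_iff)
qed

lemma square_diff_le: "((a::real) - b)\<^sup>2 \<le> 2 * a\<^sup>2 + 2 * b\<^sup>2"
  using sum_squares_bound[of a "-b"] by (simp add: power2_eq_square algebra_simps)

lemma heat_modulus_le:
  fixes u :: "'a::euclidean_space \<Rightarrow> real"
  assumes t: "t > 0" and [measurable]: "u \<in> borel_measurable borel"
  shows "heat_modulus t u \<le> 4 * (\<integral>\<^sup>+x. (u x)\<^sup>2 \<partial>lborel)"
proof -
  let ?k = "\<lambda>p::'a\<times>'a. heat_kernel t (fst p - snd p)"
  have "heat_modulus t u \<le> (\<integral>\<^sup>+p. 2 * (ennreal ((u (fst p))\<^sup>2) * ennreal (?k p)) + 2 * (ennreal ((u (snd p))\<^sup>2) * ennreal (?k p)) \<partial>lborel)"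
    unfolding heat_modulus_def
  proof (rule nn_integral_mono)
    fix p :: "'a \<times> 'a"
    have "(u (fst p) - u (snd p))\<^sup>2 * ?k p \<le> (2 * (u (fst p))\<^sup>2 + 2 * (u (snd p))\<^sup>2) * ?k p"
      by (intro mult_right_mono square_diff_le) auto
    also have "\<dots> = 2 * ((u (fst p))\<^sup>2 * ?k p) + 2 * ((u (snd p))\<^sup>2 * ?k p)"
      by (simp add: algebra_simps)
    finally have "ennreal ((u (fst p) - u (snd p))\<^sup>2 * ?k p) \<le> ennreal \<dots>"
      by (rule ennreal_leI)
    thus "ennreal ((u (fst p) - u (snd p))\<^sup>2 * ?k p) \<le> 2 * (ennreal ((u (fst p))\<^sup>2) * ennreal (?k p)) + 2 * (ennreal ((u (snd p))\<^sup>2) * ennreal (?k p))"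
      by (simp add: ennreal_mult)
  qed
  also have "\<dots> = 2 * (\<integral>\<^sup>+x. (u x)\<^sup>2 \<partial>lborel) + 2 * (\<integral>\<^sup>+x. (u x)\<^sup>2 \<partial>lborel)"
    by (simp add: nn_integral_add nn_integral_cmult nn_integral_heat_fst[OF t, where f="\<lambda>x. ennreal ((u x)\<^sup>2)"]
          nn_integral_heat_snd[OF t, where f="\<lambda>x. ennreal ((u x)\<^sup>2)"])
  also have "\<dots> = 4 * (\<integral>\<^sup>+x. (u x)\<^sup>2 \<partial>lborel)"
    by (simp flip: distrib_right)
  finally show ?thesis .
qed

lemma heat_modulus_triangle:
  fixes u :: "'a::euclidean_space \<Rightarrow> real"
  assumes [measurable]: "u \<in> borel_measurable borel" "w \<in> borel_measurable borel"
  shows "heat_modulus t u \<le> 2 * heat_modulus t w + 2 * heat_modulus t (\<lambda>x. u x - w x)"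
proof -
  let ?k = "\<lambda>p::'a\<times>'a. heat_kernel t (fst p - snd p)"
  let ?v = "\<lambda>x. u x - w x"
  have "heat_modulus t u \<le> (\<integral>\<^sup>+p. 2 * ennreal ((w (fst p) - w (snd p))\<^sup>2 * ?k p) + 2 * ennreal ((?v (fst p) - ?v (snd p))\<^sup>2 * ?k p) \<partial>lborel)"
    unfolding heat_modulus_def
  proof (rule nn_integral_mono)
    fix p :: "'a \<times> 'a"
    have "(u (fst p) - u (snd p))\<^sup>2 * ?k p \<le> (2 * (w (fst p) - w (snd p))\<^sup>2 + 2 * (?v (fst p) - ?v (snd p))\<^sup>2) * ?k p"
    proof (intro mult_right_mono)
      have "u (fst p) - u (snd p) = (w (fst p) - w (snd p)) - (- (?v (fst p) - ?v (snd p)))" by simp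
      thus "(u (fst p) - u (snd p))\<^sup>2 \<le> 2 * (w (fst p) - w (snd p))\<^sup>2 + 2 * (?v (fst p) - ?v (snd p))\<^sup>2"
        using square_diff_le[of "w (fst p) - w (snd p)" "- (?v (fst p) - ?v (snd p))"] by (simp only: power2_minus)
    qed auto
    also have "\<dots> = 2 * ((w (fst p) - w (snd p))\<^sup>2 * ?k p) + 2 * ((?v (fst p) - ?v (snd p))\<^sup>2 * ?k p)"
      by (simp add: algebra_simps)
    finally have "ennreal ((u (fst p) - u (snd p))\<^sup>2 * ?k p) \<le> ennreal \<dots>"
      by (rule ennreal_leI)
    thus "ennreal ((u (fst p) - u (snd p))\<^sup>2 * ?k p) \<le> 2 * ennreal ((w (fst p) - w (snd p))\<^sup>2 * ?k p) + 2 * ennreal ((?v (fst p) - ?v (snd p))\<^sup>2 * ?k p)"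
      by (simp add: ennreal_mult)
  qed
  also have "\<dots> = 2 * heat_modulus t w + 2 * heat_modulus t ?v"
    unfolding heat_modulus_def by (simp add: nn_integral_add nn_integral_cmult)
  finally show ?thesis .
qed

text \<open>The exponent |z|^2 / (4 t) is split into two halves y. One half absorbs the factor |z|^2
  by y exp(-y) <= 1; the other is the exponent of the kernel at time 2 t. The power of 2 compares
  the two normalisations.\<close>

lemma heat_kernel_second_moment:
  fixes z :: "'a::euclidean_space"
  assumes t: "t > 0"
  shows "(norm z)\<^sup>2 * heat_kernel t z \<le> 8 * t * 2 powr (DIM('a) / 2) * heat_kernel (2 * t) z"
proof -
  define y where "y = (norm z)\<^sup>2 / (8 * t)"
  have y: "y * exp (- y) \<le> 1"
    using exp_ge_add_one_self[of y] by (simp add: exp_minus field_simps del: exp_ge_add_one_self)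
  have e: "exp (- (norm z)\<^sup>2 / (4 * t)) = exp (- y) * exp (- y)"
    unfolding mult_exp_exp by (simp add: y_def field_simps)
  have p: "(4 * pi * (2 * t)) powr (DIM('a) / 2) = 2 powr (DIM('a) / 2) * (4 * pi * t) powr (DIM('a) / 2)"
    using t by (subst powr_mult[symmetric]) (auto simp: mult_ac)
  have "(norm z)\<^sup>2 * heat_kernel t z = 8 * t * (y * exp (- y)) * exp (- y) / (4 * pi * t) powr (DIM('a) / 2)"
    unfolding heat_kernel_def e using t by (simp add: y_def)
  also have "\<dots> \<le> 8 * t * 1 * exp (- y) / (4 * pi * t) powr (DIM('a) / 2)"
    using t y by (intro divide_right_mono mult_right_mono mult_left_mono) auto
  also have "\<dots> = 8 * t * 2 powr (DIM('a) / 2) * heat_kernel (2 * t) z"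
    unfolding heat_kernel_def p using t by (simp add: y_def)
  finally show ?thesis .
qed

text \<open>
  Expanding the square shows that Plancherel's theorem for \<open>u\<close> amounts to \<open>heat_modulus t u \<rightarrow> 0\<close>.
  As \<open>heat_modulus t\<close> is a quadratic form bounded by the squared \<open>L\<^sup>2\<close> norm uniformly in \<open>t\<close>, this
  property passes from continuous functions with compact support to all of \<open>L\<^sup>2\<close>.
\<close>

definition heat_continuous :: "('a::euclidean_space \<Rightarrow> real) \<Rightarrow> bool" where
  "heat_continuous u \<longleftrightarrow> (\<forall>e>0. \<forall>\<^sub>F t in at_right 0. heat_modulus t u \<le> ennreal e)"

lemma heat_continuous_closed:
  assumes [measurable]: "u \<in> borel_measurable borel"
  assumes *: "\<And>e::real. e > 0 \<Longrightarrow> \<exists>w. w \<in> borel_measurable borel \<and> heat_continuous w \<and> (\<integral>\<^sup>+x. (u x - w x)\<^sup>2 \<partial>lborel) \<le> ennreal e"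
  shows "heat_continuous u"
  unfolding heat_continuous_def
proof (intro allI impI)
  fix e :: real assume "e > 0"
  \<comment> \<open>e = 2 * e/4 + 2 * (4 * e/16): the factors 2 come from
    \<open>heat_modulus_triangle\<close>, the factor 4 from \<open>heat_modulus_le\<close>.\<close>
  then obtain w where [measurable]: "w \<in> borel_measurable borel" and w: "heat_continuous w" "(\<integral>\<^sup>+x. (u x - w x)\<^sup>2 \<partial>lborel) \<le> ennreal (e / 16)"
    using *[of "e/16"] by auto
  have "\<forall>\<^sub>F t in at_right 0. heat_modulus t w \<le> ennreal (e / 4)"
    using w(1) \<open>e > 0\<close> unfolding heat_continuous_def by (auto elim!: allE[of _ "e/4"])
  moreover have "\<forall>\<^sub>F t in at_right (0::real). t > 0" by (simp add: eventually_at_right_less)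
  ultimately show "\<forall>\<^sub>F t in at_right 0. heat_modulus t u \<le> ennreal e"
  proof eventually_elim
    case (elim t)
    have "heat_modulus t u \<le> 2 * heat_modulus t w + 2 * heat_modulus t (\<lambda>x. u x - w x)"
      by (rule heat_modulus_triangle) auto
    also have "heat_modulus t (\<lambda>x. u x - w x) \<le> 4 * (\<integral>\<^sup>+x. (u x - w x)\<^sup>2 \<partial>lborel)"
      using elim by (intro heat_modulus_le) auto
    also have "2 * heat_modulus t w + 2 * (4 * (\<integral>\<^sup>+x. (u x - w x)\<^sup>2 \<partial>lborel)) \<le> 2 * ennreal (e/4) + 2 * (4 * ennreal (e / 16))"
      using elim w(2) by (intro add_mono mult_left_mono) auto
    also have "\<dots> = ennreal (2 * (e/4) + 2 * (4 * (e/16)))"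
    proof -
      have "2 * ennreal (e/4) = ennreal (2 * (e/4))" by (subst ennreal_mult') auto
      moreover have "2 * (4 * ennreal (e/16)) = ennreal (2 * (4 * (e/16)))" by (subst ennreal_mult', simp, subst ennreal_mult', auto)
      ultimately show ?thesis using \<open>e > 0\<close> by (simp only: ennreal_plus)
    qed
    finally show ?case by (simp add: add_left_mono mult_left_mono)
  qed
qed

text \<open>Nearby values differ little by uniform continuity. For distant points the bounded
  difference is paid for by a multiple of |x - y|^2, whose kernel average is of order t by
  \<open>heat_kernel_second_moment\<close>. Pairs with both points outside the ball contribute
  nothing, so only the finite volume of the ball enters.\<close>

lemma heat_continuous_compact_support:
  fixes w :: "'a::euclidean_space \<Rightarrow> real"
  assumes cont: "continuous_on UNIV w" and supp: "\<And>x. x \<notin> cball 0 R \<Longrightarrow> w x = 0"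
  shows "heat_continuous w"
  unfolding heat_continuous_def
proof (intro allI impI)
  fix e :: real assume e: "e > 0"
  let ?B = "cball 0 R :: 'a set"
  have [measurable]: "w \<in> borel_measurable borel" by (rule borel_measurable_continuous_onI[OF cont])
  \<comment> \<open>The volume plus 1, so that b may be divided by even if the ball is empty or a
    point.\<close>
  obtain b where b: "b > 0" "emeasure lborel ?B \<le> ennreal b"
  proof
    show "measure lborel ?B + 1 > 0" by (simp add: add_nonneg_pos)
    show "emeasure lborel ?B \<le> ennreal (measure lborel ?B + 1)"
      using emeasure_lborel_cball_finite[of "0::'a" R] by (subst emeasure_eq_ennreal_measure) auto
  qed
  have "bounded (w ` ?B)"
    by (intro compact_imp_bounded compact_continuous_image continuous_on_subset[OF cont]) auto
  then obtain M0 where M0: "\<forall>x\<in>?B. \<bar>w x\<bar> \<le> M0" by (auto simp: bounded_iff)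
  hence M: "\<bar>w x\<bar> \<le> max M0 0" for x using supp[of x] M0 by (cases "x \<in> ?B") (auto simp: le_max_iff_disj)
  define M where "M = max M0 0"
  \<comment> \<open>Makes the final bound 2 * b * (d + L * t) tend to e / 2 as t tends to 0.\<close>
  define d where "d = e / (4 * b)"
  have d: "d > 0" using e b by (simp add: d_def)
  \<comment> \<open>Radius R + 1, because only one point of a close pair is known to lie in the
    ball; the other is within h <= 1 of it.\<close>
  have "uniformly_continuous_on (cball 0 (R + 1)) w"
    by (intro compact_uniformly_continuous continuous_on_subset[OF cont]) auto
  then obtain h0 where h0: "h0 > 0" "\<And>x y. x \<in> cball 0 (R+1) \<Longrightarrow> y \<in> cball 0 (R+1) \<Longrightarrow> dist y x < h0 \<Longrightarrow> dist (w y) (w x) < sqrt d"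
    using d unfolding uniformly_continuous_on_def by (meson real_sqrt_gt_zero)
  define h where "h = min h0 1"
  have h: "h > 0" using h0 by (simp add: h_def)
  \<comment> \<open>K h^2 = (2 M)^2 bounds every squared difference of two values of w.\<close>
  define K where "K = 4 * M\<^sup>2 / h\<^sup>2"
  have K: "K \<ge> 0" by (simp add: K_def)
  have bd: "(w x - w y)\<^sup>2 \<le> d + K * (norm (x - y))\<^sup>2" if "x \<in> ?B \<or> y \<in> ?B" for x y
  proof (cases "norm (x - y) < h")
    case True
    hence "norm x \<le> R + 1" "norm y \<le> R + 1"
      using that norm_triangle_ineq2[of x y] norm_triangle_ineq2[of y x] unfolding h_def by (auto simp: norm_minus_commute)
    hence "\<bar>w x - w y\<bar> < sqrt d" using h0(2)[of y x] True by (auto simp: h_def dist_norm)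
    hence "(w x - w y)\<^sup>2 \<le> d"
      using d by (metis abs_ge_zero less_eq_real_def power2_abs power_mono real_sqrt_pow2)
    thus ?thesis using K by (smt (verit) mult_nonneg_nonneg zero_le_power2)
  next
    case False
    have "\<bar>w x - w y\<bar> \<le> 2 * M" using M[of x] M[of y] unfolding M_def by linarith
    hence "(w x - w y)\<^sup>2 \<le> (2 * M)\<^sup>2" by (metis abs_ge_zero power2_abs power_mono)
    also have "\<dots> = K * h\<^sup>2" using h by (simp add: K_def power_mult_distrib)
    also have "\<dots> \<le> K * (norm (x - y))\<^sup>2"
      using False h K by (intro mult_left_mono power_mono) auto
    finally show ?thesis using d by simp
  qed
  define L where "L = K * 8 * 2 powr (DIM('a) / 2)"
  have L: "L \<ge> 0" using K by (simp add: L_def)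
  define I :: "'a \<Rightarrow> ennreal" where "I = indicator ?B"
  have [measurable]: "I \<in> borel_measurable borel" unfolding I_def by (intro borel_measurable_indicator) auto
  have I: "(\<integral>\<^sup>+x. I x \<partial>lborel) = emeasure lborel ?B" by (simp add: I_def)
  have main: "heat_modulus t w \<le> ennreal (2 * b * (d + L * t))" if t: "t > 0" for t
  proof -
    let ?k = "\<lambda>t p. heat_kernel t (fst p - snd p)"
    let ?J = "\<lambda>c t p. ennreal c * (I (fst p) * ennreal (?k t p)) + ennreal c * (I (snd p) * ennreal (?k t p))"
    have "heat_modulus t w \<le> (\<integral>\<^sup>+p. ?J d t p + ?J (L * t) (2 * t) p \<partial>lborel)"
      unfolding heat_modulus_def
    proof (rule nn_integral_mono)
      fix p :: "'a \<times> 'a"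
      obtain x y where p: "p = (x, y)" by (cases p)
      show "ennreal ((w (fst p) - w (snd p))\<^sup>2 * ?k t p) \<le> ?J d t p + ?J (L * t) (2 * t) p"
      proof (cases "x \<in> ?B \<or> y \<in> ?B")
        case False
        thus ?thesis using supp[of x] supp[of y] by (simp add: p)
      next
        case True
        have "(w x - w y)\<^sup>2 * heat_kernel t (x - y) \<le> (d + K * (norm (x - y))\<^sup>2) * heat_kernel t (x - y)"
          by (intro mult_right_mono bd True) auto
        also have "\<dots> = d * heat_kernel t (x - y) + K * ((norm (x - y))\<^sup>2 * heat_kernel t (x - y))"
          by (simp add: algebra_simps)
        also have "\<dots> \<le> d * heat_kernel t (x - y) + K * (8 * t * 2 powr (DIM('a) / 2) * heat_kernel (2 * t) (x - y))"
          by (intro add_left_mono mult_left_mono heat_kernel_second_moment t K)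
        also have "\<dots> = d * heat_kernel t (x - y) + (L * t) * heat_kernel (2 * t) (x - y)"
          by (simp add: L_def)
        finally have "ennreal ((w x - w y)\<^sup>2 * heat_kernel t (x - y)) \<le> ennreal \<dots>"
          by (rule ennreal_leI)
        also have "\<dots> = ennreal d * ennreal (heat_kernel t (x - y)) + ennreal (L * t) * ennreal (heat_kernel (2 * t) (x - y))"
          using d L t by (simp add: ennreal_mult)
        also have "\<dots> \<le> ?J d t p + ?J (L * t) (2 * t) p"
          using True by (intro add_mono) (auto simp: p I_def indicator_def)
        finally show ?thesis by (simp add: p)
      qed
    qed
    also have "\<dots> = ennreal d * emeasure lborel ?B + ennreal d * emeasure lborel ?B + (ennreal (L * t) * emeasure lborel ?B + ennreal (L * t) * emeasure lborel ?B)"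
      using t by (simp add: nn_integral_add nn_integral_cmult nn_integral_heat_fst[where f=I] nn_integral_heat_snd[where f=I] I)
    also have "\<dots> \<le> ennreal d * ennreal b + ennreal d * ennreal b + (ennreal (L * t) * ennreal b + ennreal (L * t) * ennreal b)"
      by (intro add_mono mult_left_mono b) auto
    also have "\<dots> = ennreal (d * b + d * b + (L * t * b + L * t * b))"
    proof -
      have "0 \<le> d" "0 \<le> b" "0 \<le> L * t" using d b L t by auto
      thus ?thesis by (simp only: ennreal_mult ennreal_plus mult_nonneg_nonneg add_nonneg_nonneg)
    qed
    also have "d * b + d * b + (L * t * b + L * t * b) = 2 * b * (d + L * t)" by (simp add: algebra_simps)
    finally show ?thesis .
  qed
  have "((\<lambda>t. 2 * b * (d + L * t)) \<longlongrightarrow> 2 * b * (d + L * 0)) (at_right 0)"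
    by (intro tendsto_intros)
  moreover have "2 * b * (d + L * 0) < e" using e b by (simp add: d_def field_simps)
  ultimately have "\<forall>\<^sub>F t in at_right 0. 2 * b * (d + L * t) < e" by (rule order_tendstoD(2))
  moreover have "\<forall>\<^sub>F t in at_right (0::real). t > 0" by (simp add: eventually_at_right_less)
  ultimately show "\<forall>\<^sub>F t in at_right 0. heat_modulus t w \<le> ennreal e"
  proof eventually_elim
    case (elim t)
    thus ?case using main[of t] by (auto elim: order_trans intro!: ennreal_leI)
  qed
qed

subsection \<open>Plancherel's theorem\<close>

lemma heat_continuous_dominated:
  fixes u :: "'a::euclidean_space \<Rightarrow> real"
  assumes [measurable]: "u \<in> borel_measurable borel" "\<And>n. w n \<in> borel_measurable borel" "g \<in> borel_measurable borel"
    and hc: "\<And>n. heat_continuous (w n)"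
    and conv: "AE x in lborel. (\<lambda>n. w n x) \<longlonglongrightarrow> u x"
    and dom: "\<And>n x. (u x - w n x)\<^sup>2 \<le> g x"
    and g: "(\<integral>\<^sup>+x. ennreal (g x) \<partial>lborel) < \<infinity>"
  shows "heat_continuous u"
proof (rule heat_continuous_closed)
  fix e :: real assume e: "e > 0"
  have "(\<lambda>n. \<integral>\<^sup>+x. ennreal ((u x - w n x)\<^sup>2) \<partial>lborel) \<longlonglongrightarrow> (\<integral>\<^sup>+x. 0 \<partial>(lborel :: 'a measure))"
  proof (rule nn_integral_dominated_convergence[where w="\<lambda>x. ennreal (g x)"])
    show "AE x in lborel. (\<lambda>n. ennreal ((u x - w n x)\<^sup>2)) \<longlonglongrightarrow> 0"
      using conv
    proof eventually_elim
      case (elim x)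
      have "(\<lambda>n. ennreal ((u x - w n x)\<^sup>2)) \<longlonglongrightarrow> ennreal ((u x - u x)\<^sup>2)"
        by (intro tendsto_ennrealI tendsto_intros elim)
      thus ?case by simp
    qed
  qed (use g dom in \<open>auto intro!: ennreal_leI\<close>)
  hence "\<forall>\<^sub>F n in sequentially. (\<integral>\<^sup>+x. ennreal ((u x - w n x)\<^sup>2) \<partial>lborel) < ennreal e"
    using e by (intro order_tendstoD(2)) auto
  then obtain n where "(\<integral>\<^sup>+x. ennreal ((u x - w n x)\<^sup>2) \<partial>lborel) < ennreal e"
    by (auto simp: eventually_sequentially)
  thus "\<exists>w. w \<in> borel_measurable borel \<and> heat_continuous w \<and> (\<integral>\<^sup>+x. (u x - w x)\<^sup>2 \<partial>lborel) \<le> ennreal e"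
    using hc[of n] by (intro exI[of _ "w n"]) auto
qed auto

text \<open>A measurable function is almost everywhere a limit of continuous ones, but these need
  not share a bound or a bounded support. Clipping at M and multiplying by the cutoff c repair this
  and leave the limit unchanged, because f already obeys the bound and c is 1 on
  \<open>cball 0 R\<close>.\<close>

lemma heat_continuous_bounded:
  fixes f :: "'a::euclidean_space \<Rightarrow> real"
  assumes [measurable]: "f \<in> borel_measurable borel"
    and M: "\<And>x. \<bar>f x\<bar> \<le> M" and supp: "\<And>x. x \<notin> cball 0 R \<Longrightarrow> f x = 0"
  shows "heat_continuous f"
proof -
  have "f \<in> borel_measurable lebesgue" by (simp add: measurable_completion)
  hence "f measurable_on UNIV" by (intro lebesgue_measurable_imp_measurable_on_real) auto
  then obtain N g where N: "negligible N" and g: "\<And>n. continuous_on UNIV (g n)"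
    and lim: "\<And>x. x \<notin> N \<Longrightarrow> (\<lambda>n. g n x) \<longlonglongrightarrow> f x"
    unfolding measurable_on_def by auto
  define c where "c x = max 0 (min 1 (R + 1 - norm x))" for x :: 'a
  define h where "h n x = max (-M) (min M (g n x)) * c x" for n x
  have M0: "M \<ge> 0" using M[of 0] by linarith
  have c: "0 \<le> c x" "c x \<le> 1" for x by (auto simp: c_def)
  have c0: "c x = 0" if "x \<notin> cball 0 (R+1)" for x using that by (auto simp: c_def)
  have hM: "\<bar>h n x\<bar> \<le> M" for n x
  proof -
    have "\<bar>h n x\<bar> = \<bar>max (-M) (min M (g n x))\<bar> * c x" by (simp add: h_def abs_mult c)
    also have "\<dots> \<le> M * 1" using M0 by (intro mult_mono c) auto
    finally show ?thesis by simp
  qed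
  have cont: "continuous_on UNIV (h n)" for n
    unfolding h_def c_def by (intro continuous_intros g)
  show ?thesis
  proof (rule heat_continuous_dominated[where w=h and g="\<lambda>x. (2 * M)\<^sup>2 * indicat_real (cball 0 (R + 1)) x"])
    show "h n \<in> borel_measurable borel" for n
      by (rule borel_measurable_continuous_onI[OF cont])
    show "heat_continuous (h n)" for n
      by (rule heat_continuous_compact_support[OF cont, of "R + 1"]) (simp add: h_def c0)
    show "AE x in lborel. (\<lambda>n. h n x) \<longlonglongrightarrow> f x"
    proof -
      have "AE x in lebesgue. x \<notin> N"
        using N by (simp add: AE_not_in negligible_iff_null_sets)
      hence "AE x in lborel. x \<notin> N" by (simp add: AE_completion_iff)
      thus ?thesis
      proof eventually_elim
        case (elim x)
        have "(\<lambda>n. h n x) \<longlonglongrightarrow> max (-M) (min M (f x)) * c x"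
          unfolding h_def by (intro tendsto_intros lim elim)
        also have "max (-M) (min M (f x)) = f x" using M[of x] by auto
        also have "f x * c x = f x"
          using supp[of x] by (cases "x \<in> cball 0 R") (auto simp: c_def)
        finally show ?case .
      qed
    qed
    show "(f x - h n x)\<^sup>2 \<le> (2 * M)\<^sup>2 * indicat_real (cball 0 (R + 1)) x" for n x
    proof (cases "x \<in> cball 0 (R + 1)")
      case True
      have "\<bar>f x - h n x\<bar> \<le> 2 * M" using M[of x] hM[of n x] by linarith
      hence "(f x - h n x)\<^sup>2 \<le> (2 * M)\<^sup>2" by (metis abs_ge_zero power2_abs power_mono)
      thus ?thesis using True by simp
    next
      case False
      thus ?thesis using supp[of x] by (auto simp: h_def c0)
    qed
    have "(\<integral>\<^sup>+x. ennreal ((2 * M)\<^sup>2 * indicat_real (cball 0 (R + 1)) x) \<partial>(lborel :: 'a measure)) =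
       (\<integral>\<^sup>+x. ennreal ((2 * M)\<^sup>2) * indicator (cball 0 (R + 1) :: 'a set) x \<partial>lborel)"
      by (intro nn_integral_cong) (auto simp: indicator_def)
    also have "\<dots> < \<infinity>"
      using emeasure_lborel_cball_finite[of "0::'a" "R + 1"] by (simp add: nn_integral_cmult_indicator ennreal_mult_less_top)
    finally show "(\<integral>\<^sup>+x. ennreal ((2 * M)\<^sup>2 * indicat_real (cball 0 (R + 1)) x) \<partial>(lborel :: 'a measure)) < \<infinity>" .
  qed (auto intro!: borel_measurable_times borel_measurable_indicator)
qed

lemma heat_continuous_L2:
  fixes u :: "'a::euclidean_space \<Rightarrow> real"
  assumes [measurable]: "u \<in> borel_measurable borel" and u2: "integrable lborel (\<lambda>x. (u x)\<^sup>2)"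
  shows "heat_continuous u"
proof -
  define w where "w n x = (if norm x \<le> real n then max (- real n) (min (real n) (u x)) else 0)" for n x
  show ?thesis
  proof (rule heat_continuous_dominated[where w=w and g="\<lambda>x. (u x)\<^sup>2"])
    show m: "w n \<in> borel_measurable borel" for n
      unfolding w_def by measurable
    show "heat_continuous (w n)" for n
      by (rule heat_continuous_bounded[OF m, of _ "real n" "real n"]) (auto simp: w_def)
    have "(\<lambda>n. w n x) \<longlonglongrightarrow> u x" for x
    proof (rule tendsto_eventually)
      obtain k where k: "real k \<ge> max (norm x) \<bar>u x\<bar>" using real_arch_simple by blast
      show "\<forall>\<^sub>F n in sequentially. w n x = u x"
        unfolding eventually_sequentially
      proof (intro exI allI impI)
        fix n assume "k \<le> n"
        hence "real n \<ge> max (norm x) \<bar>u x\<bar>" using k by linarith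
        thus "w n x = u x" by (auto simp: w_def)
      qed
    qed
    thus "AE x in lborel. (\<lambda>n. w n x) \<longlonglongrightarrow> u x" by simp
    show "(u x - w n x)\<^sup>2 \<le> (u x)\<^sup>2" for n x
      unfolding abs_le_square_iff[symmetric] w_def by auto
    show "(\<integral>\<^sup>+x. ennreal ((u x)\<^sup>2) \<partial>lborel) < \<infinity>"
      using u2 by (simp add: integrable_iff_bounded)
  qed auto
qed

text \<open>Plancherel's theorem. Integrability of the spectrum is part of the conclusion, so it is
  obtained by monotone convergence: the damped spectra increase as t decreases, and their integrals
  converge because \<open>heat_continuous_L2\<close> makes the smoothed products \<open>A t\<close>
  tend to the squared norm.\<close>

lemma has_bochner_integral_power_spectrum:
  fixes u :: "'a::euclidean_space \<Rightarrow> real"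
  assumes u: "integrable lborel u" and u2: "integrable lborel (\<lambda>x. (u x)\<^sup>2)"
  shows "has_bochner_integral lborel (power_spectrum u) ((2 * pi) ^ DIM('a) * (LINT x|lborel. (u x)\<^sup>2))"
proof -
  have [measurable]: "u \<in> borel_measurable borel" using u by (auto dest: borel_measurable_integrable)
  define N where "N = (LINT x|lborel. (u x)\<^sup>2)"
  define A where "A t = (LINT p|lborel. u (fst p) * u (snd p) * heat_kernel t (fst p - snd p))" for t
  define t where "t n = inverse (real (Suc n))" for n
  have t: "t n > 0" for n by (simp add: t_def)
  have "t \<longlonglongrightarrow> 0" unfolding t_def by (rule LIMSEQ_inverse_real_of_nat)
  hence lim_t: "filterlim t (at_right 0) sequentially"
    using t by (auto simp: filterlim_at less_imp_neq[OF t, symmetric])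
  have lim: "(\<lambda>n. A (t n)) \<longlonglongrightarrow> N"
  proof (rule metric_LIMSEQ_I)
    fix e :: real assume e: "e > 0"
    have "\<forall>\<^sub>F s in at_right 0. heat_modulus s u \<le> ennreal e"
      using heat_continuous_L2[of u] u2 e by (auto simp: heat_continuous_def)
    from eventually_compose_filterlim[OF this lim_t]
    obtain n0 where n0: "\<And>n. n \<ge> n0 \<Longrightarrow> heat_modulus (t n) u \<le> ennreal e"
      by (auto simp: eventually_sequentially)
    have "dist (A (t n)) N < e" if "n \<ge> n0" for n
    proof -
      have "ennreal (2 * N - 2 * A (t n)) \<le> ennreal e"
        using n0[OF that] unfolding heat_modulus_eq[OF t u u2] A_def N_def .
      hence "2 * N - 2 * A (t n) \<le> e" using e by (simp add: ennreal_le_iff)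
      moreover have "A (t n) \<le> N" unfolding A_def N_def by (rule heat_modulus_bound[OF t u u2])
      ultimately show ?thesis using e by (simp add: dist_real_def)
    qed
    thus "\<exists>n0. \<forall>n\<ge>n0. dist (A (t n)) N < e" by blast
  qed
  have "has_bochner_integral lborel (power_spectrum u) ((2 * pi) ^ DIM('a) * N)"
  proof (rule has_bochner_integral_monotone_convergence)
    show "integrable lborel (\<lambda>\<xi>. exp (- t n * (norm \<xi>)\<^sup>2) * power_spectrum u \<xi>)" for n
      by (rule integrable_gaussian_power_spectrum[OF t u])
    show "AE \<xi> in lborel. mono (\<lambda>n. exp (- t n * (norm \<xi>)\<^sup>2) * power_spectrum u \<xi>)"
    proof (intro AE_I2 monoI mult_right_mono)
      fix \<xi> :: 'a and m n :: nat assume "m \<le> n"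
      hence "t n \<le> t m" by (simp add: t_def)
      thus "exp (- t m * (norm \<xi>)\<^sup>2) \<le> exp (- t n * (norm \<xi>)\<^sup>2)"
        by (simp add: mult_right_mono)
    qed auto
    show "AE \<xi> in lborel. (\<lambda>n. exp (- t n * (norm \<xi>)\<^sup>2) * power_spectrum u \<xi>) \<longlonglongrightarrow> power_spectrum u \<xi>"
    proof (intro AE_I2)
      fix \<xi> :: 'a
      have "(\<lambda>n. exp (- t n * (norm \<xi>)\<^sup>2) * power_spectrum u \<xi>) \<longlonglongrightarrow> exp (- 0 * (norm \<xi>)\<^sup>2) * power_spectrum u \<xi>"
        by (intro tendsto_intros \<open>t \<longlonglongrightarrow> 0\<close>)
      thus "(\<lambda>n. exp (- t n * (norm \<xi>)\<^sup>2) * power_spectrum u \<xi>) \<longlonglongrightarrow> power_spectrum u \<xi>" by simp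
    qed
    have "(\<lambda>n. (2 * pi) ^ DIM('a) * A (t n)) \<longlonglongrightarrow> (2 * pi) ^ DIM('a) * N"
      by (intro tendsto_intros lim)
    thus "(\<lambda>n. LINT \<xi>|lborel. exp (- t n * (norm \<xi>)\<^sup>2) * power_spectrum u \<xi>) \<longlonglongrightarrow> (2 * pi) ^ DIM('a) * N"
      unfolding integral_gaussian_power_spectrum[OF t u] A_def .
  qed auto
  thus ?thesis by (simp add: N_def)
qed

subsection \<open>The fractional energy\<close>

lemma nn_integral_powr_exp:
  assumes p: "p > 0" and r: "r > 0"
  shows "(\<integral>\<^sup>+\<tau>. ennreal (indicator {0<..} \<tau> * (\<tau> powr (p - 1) * exp (- \<tau> * r))) \<partial>lborel) = ennreal (Gamma p / r powr p)"
proof -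
  let ?I = "\<integral>\<^sup>+\<tau>. ennreal (indicator {0<..} \<tau> * (\<tau> powr (p - 1) * exp (- \<tau> * r))) \<partial>lborel"
  have "ennreal (Gamma p) = (\<integral>\<^sup>+t. ennreal (indicator {0..} t * t powr (p - 1) / exp t) \<partial>lborel)"
    by (rule Gamma_conv_nn_integral_real[OF p])
  also have "\<dots> = ennreal r * (\<integral>\<^sup>+t. ennreal (indicator {0..} (0 + r * t) * (0 + r * t) powr (p - 1) / exp (0 + r * t)) \<partial>lborel)"
    using r by (subst nn_integral_real_affine[of _ r 0]) auto
  also have "(\<integral>\<^sup>+t. ennreal (indicator {0..} (0 + r * t) * (0 + r * t) powr (p - 1) / exp (0 + r * t)) \<partial>lborel)
     = (\<integral>\<^sup>+t. ennreal (r powr (p - 1)) * ennreal (indicator {0<..} t * (t powr (p - 1) * exp (- t * r))) \<partial>lborel)"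
  proof (rule nn_integral_cong)
    fix t :: real
    \<comment> \<open>The closed and the open half-line agree here because
      \<open>0 powr x = 0\<close>.\<close>
    have "indicator {0..} (0 + r * t) * (0 + r * t) powr (p - 1) / exp (0 + r * t) = r powr (p - 1) * (indicator {0<..} t * (t powr (p - 1) * exp (- t * r)))"
      using r by (cases "t > 0"; cases "t = 0")
         (auto simp: indicator_def powr_mult exp_minus zero_le_mult_iff mult.commute field_simps)
    thus "ennreal (indicator {0..} (0 + r * t) * (0 + r * t) powr (p - 1) / exp (0 + r * t)) =
       ennreal (r powr (p - 1)) * ennreal (indicator {0<..} t * (t powr (p - 1) * exp (- t * r)))"
      by (simp add: ennreal_mult' del: ennreal_mult'')
  qed
  also have "\<dots> = ennreal (r powr (p - 1)) * ?I"
    by (rule nn_integral_cmult) measurable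
  also have "ennreal r * (ennreal (r powr (p - 1)) * ?I) = ennreal (r powr p) * ?I"
    using r powr_add[of r 1 "p - 1"] by (simp add: mult.assoc[symmetric] ennreal_mult'[symmetric])
  finally have "ennreal (Gamma p) = ennreal (r powr p) * ?I" .
  hence "ennreal (1 / r powr p) * ennreal (Gamma p) = ennreal (1 / r powr p) * ennreal (r powr p) * ?I"
    by (simp add: mult.assoc)
  also have "ennreal (1 / r powr p) * ennreal (r powr p) = 1"
    using r by (simp flip: ennreal_mult)
  also have "ennreal (1 / r powr p) * ennreal (Gamma p) = ennreal (Gamma p / r powr p)"
    by (subst ennreal_mult'[symmetric]) auto
  finally show ?thesis by simp
qed

text \<open>With p = (d + 2 s) / 2 > 0 and r > 0, Euler's integral says that 1 / r powr p is the
  integral over \<tau> > 0 of exp(-\<tau> r) against this density. It will be used with r =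
  |z|^2.\<close>

definition frac_weight :: "real \<Rightarrow> real \<Rightarrow> real \<Rightarrow> real" where
  "frac_weight d s \<tau> = indicator {0<..} \<tau> * (\<tau> powr ((d + 2 * s) / 2 - 1) / Gamma ((d + 2 * s) / 2))"

lemma borel_measurable_frac_weight [measurable]: "frac_weight d s \<in> borel_measurable borel"
  unfolding frac_weight_def[abs_def] by measurable

lemma frac_weight_nonneg [simp]: "d + 2 * s > 0 \<Longrightarrow> frac_weight d s \<tau> \<ge> 0"
  by (auto simp: frac_weight_def intro!: mult_nonneg_nonneg divide_nonneg_pos)

text \<open>
  The singular kernel is a superposition of Gaussians; hence the fractional energy and the
  normalising constant reduce to the same Gaussian integrals, and no rotation invariance is
  needed. The case \<open>z = 0\<close> is covered because \<open>0 / 0 = 0\<close>.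
\<close>

lemma subordination:
  fixes z :: "'a::euclidean_space"
  assumes ds: "d + 2 * s > 0" and c: "c \<ge> 0" "z = 0 \<Longrightarrow> c = 0"
  shows "ennreal (c / norm z powr (d + 2 * s)) = (\<integral>\<^sup>+\<tau>. ennreal (frac_weight d s \<tau>) * ennreal (c * exp (- \<tau> * (norm z)\<^sup>2)) \<partial>lborel)"
proof (cases "z = 0")
  case False
  let ?p = "(d + 2 * s) / 2"
  have G: "Gamma ?p > 0" using ds by (intro Gamma_real_pos) auto
  have "(norm z)\<^sup>2 powr ?p = (norm z powr 2) powr ?p"
    using False by (simp add: powr_realpow)
  also have "\<dots> = norm z powr (2 * ?p)" by (rule powr_powr)
  also have "2 * ?p = d + 2 * s" by simp
  finally have "(norm z)\<^sup>2 powr ?p = norm z powr (d + 2 * s)" .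
  hence "ennreal (c / norm z powr (d + 2 * s)) = ennreal (c / Gamma ?p) * ennreal (Gamma ?p / (norm z)\<^sup>2 powr ?p)"
    using G c by (subst ennreal_mult[symmetric]) auto
  also have "ennreal (Gamma ?p / (norm z)\<^sup>2 powr ?p) = (\<integral>\<^sup>+\<tau>. ennreal (indicator {0<..} \<tau> * (\<tau> powr (?p - 1) * exp (- \<tau> * (norm z)\<^sup>2))) \<partial>lborel)"
    by (rule nn_integral_powr_exp[symmetric]) (use ds False in auto)
  also have "ennreal (c / Gamma ?p) * \<dots> = (\<integral>\<^sup>+\<tau>. ennreal (c / Gamma ?p) * ennreal (indicator {0<..} \<tau> * (\<tau> powr (?p - 1) * exp (- \<tau> * (norm z)\<^sup>2))) \<partial>lborel)"
    by (rule nn_integral_cmult[symmetric]) measurable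
  also have "\<dots> = (\<integral>\<^sup>+\<tau>. ennreal (frac_weight d s \<tau>) * ennreal (c * exp (- \<tau> * (norm z)\<^sup>2)) \<partial>lborel)"
    using c G ds by (intro nn_integral_cong, subst (1 2) ennreal_mult[symmetric]) (auto simp: frac_weight_def)
  finally show ?thesis .
qed (use c in auto)

text \<open>The Fourier symbol of the singular integral before normalisation: in dimension d and for
  s > 0 it is the integral of (1 - cos (\<xi> \<bullet> z)) / |z|^(d + 2 s) over z, where \<rho> =
  |\<xi>| (\<open>nn_integral_one_minus_cos\<close>). The second factor is the integral of 1 - cos
  against a Gaussian.\<close>

definition frac_symbol :: "real \<Rightarrow> real \<Rightarrow> real \<Rightarrow> ennreal" where
  "frac_symbol d s \<rho> = (\<integral>\<^sup>+\<tau>. ennreal (frac_weight d s \<tau>) * ennreal ((pi / \<tau>) powr (d / 2) * (1 - exp (- \<rho>\<^sup>2 / (4 * \<tau>)))) \<partial>lborel)"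

text \<open>For a coordinate vector \<xi> this evaluates the integral in \<open>frac_const\<close>,
  whichever coordinate is chosen. The integrals may be exchanged because 1 - cos is
  nonnegative.\<close>

lemma nn_integral_one_minus_cos:
  fixes \<xi> :: "'a::euclidean_space" and s :: real
  assumes s: "0 < s"
  shows "(\<integral>\<^sup>+z. ennreal ((1 - cos (\<xi> \<bullet> z)) / norm z powr (DIM('a) + 2 * s)) \<partial>lborel) = frac_symbol DIM('a) s (norm \<xi>)"
proof -
  let ?w = "frac_weight DIM('a) s"
  have ds: "real DIM('a) + 2 * s > 0" using s by (simp add: add_nonneg_pos)
  have "(\<integral>\<^sup>+z. ennreal ((1 - cos (\<xi> \<bullet> z)) / norm z powr (DIM('a) + 2 * s)) \<partial>lborel)
    = (\<integral>\<^sup>+z. \<integral>\<^sup>+\<tau>. ennreal (?w \<tau>) * ennreal ((1 - cos (\<xi> \<bullet> z)) * exp (- \<tau> * (norm z)\<^sup>2)) \<partial>lborel \<partial>lborel)"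
    by (intro nn_integral_cong subordination ds) auto
  also have "\<dots> = (\<integral>\<^sup>+\<tau>. \<integral>\<^sup>+z. ennreal (?w \<tau>) * ennreal ((1 - cos (\<xi> \<bullet> z)) * exp (- \<tau> * (norm z)\<^sup>2)) \<partial>lborel \<partial>lborel)"
    by (rule lborel_pair.Fubini') measurable
  also have "\<dots> = frac_symbol DIM('a) s (norm \<xi>)"
    unfolding frac_symbol_def
  proof (rule nn_integral_cong)
    fix \<tau> :: real
    show "(\<integral>\<^sup>+z. ennreal (?w \<tau>) * ennreal ((1 - cos (\<xi> \<bullet> z)) * exp (- \<tau> * (norm z)\<^sup>2)) \<partial>lborel) =
       ennreal (?w \<tau>) * ennreal ((pi / \<tau>) powr (DIM('a) / 2) * (1 - exp (- (norm \<xi>)\<^sup>2 / (4 * \<tau>))))"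
    proof (cases "\<tau> > 0")
      case True
      have "has_bochner_integral lborel (\<lambda>z::'a. exp (- \<tau> * (norm z)\<^sup>2) - exp (- \<tau> * (norm z)\<^sup>2) * cos (\<xi> \<bullet> z))
          ((pi / \<tau>) powr (DIM('a) / 2) - (pi / \<tau>) powr (DIM('a) / 2) * exp (- (norm \<xi>)\<^sup>2 / (4 * \<tau>)))"
        by (intro has_bochner_integral_diff)
           (simp_all only: has_bochner_integral_iff gaussian_integrable[OF True] gaussian_integral[OF True] gaussian_cos_integrable[OF True] gaussian_cos_integral[OF True])
      also have "(\<lambda>z::'a. exp (- \<tau> * (norm z)\<^sup>2) - exp (- \<tau> * (norm z)\<^sup>2) * cos (\<xi> \<bullet> z)) = (\<lambda>z. (1 - cos (\<xi> \<bullet> z)) * exp (- \<tau> * (norm z)\<^sup>2))"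
        by (auto simp: algebra_simps)
      finally have "(\<integral>\<^sup>+z. ennreal ((1 - cos (\<xi> \<bullet> z)) * exp (- \<tau> * (norm z)\<^sup>2)) \<partial>lborel) = 
          ennreal ((pi / \<tau>) powr (DIM('a) / 2) - (pi / \<tau>) powr (DIM('a) / 2) * exp (- (norm \<xi>)\<^sup>2 / (4 * \<tau>)))"
        by (subst nn_integral_eq_integral) (auto simp: has_bochner_integral_iff)
      thus ?thesis by (subst nn_integral_cmult) (auto simp: right_diff_distrib)
    qed (simp add: frac_weight_def)
  qed
  finally show ?thesis .
qed

text \<open>For each \<tau> the Gaussian energy is a multiple of \<open>heat_modulus\<close>, which
  Plancherel and its damped form express through the spectrum with the factor 1 - exp(-|\<xi>|^2 /
  (4 \<tau>)). Integration over \<tau> assembles these factors into \<open>frac_symbol\<close>. In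
  \<open>ennreal\<close> both sides may be infinite, so no finiteness of the energy is
  presupposed.\<close>

lemma nn_integral_difference_quotient:
  fixes u :: "'a::euclidean_space \<Rightarrow> real" and s :: real
  assumes s: "0 < s" and u: "integrable lborel u" and u2: "integrable lborel (\<lambda>x. (u x)\<^sup>2)"
  shows "(\<integral>\<^sup>+p. ennreal ((u (fst p) - u (snd p))\<^sup>2 / norm (fst p - snd p) powr (DIM('a) + 2 * s)) \<partial>lborel)
    = (\<integral>\<^sup>+\<xi>. frac_symbol DIM('a) s (norm \<xi>) * ennreal (2 * power_spectrum u \<xi> / (2 * pi) ^ DIM('a)) \<partial>lborel)"
proof -
  let ?w = "frac_weight DIM('a) s"
  let ?c = "(2 * pi) ^ DIM('a)"
  let ?P = "\<lambda>\<xi>. 2 * power_spectrum u \<xi> / ?c"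
  have [measurable]: "u \<in> borel_measurable borel" using u by (auto dest: borel_measurable_integrable)
  have ds: "real DIM('a) + 2 * s > 0" using s by (simp add: add_nonneg_pos)
  have "(\<integral>\<^sup>+p. ennreal ((u (fst p) - u (snd p))\<^sup>2 / norm (fst p - snd p) powr (DIM('a) + 2 * s)) \<partial>lborel)
    = (\<integral>\<^sup>+p. \<integral>\<^sup>+\<tau>. ennreal (?w \<tau>) * ennreal ((u (fst p) - u (snd p))\<^sup>2 * exp (- \<tau> * (norm (fst p - snd p))\<^sup>2)) \<partial>lborel \<partial>lborel)"
    by (intro nn_integral_cong subordination ds) auto
  also have "\<dots> = (\<integral>\<^sup>+\<tau>. \<integral>\<^sup>+p. ennreal (?w \<tau>) * ennreal ((u (fst p) - u (snd p))\<^sup>2 * exp (- \<tau> * (norm (fst p - snd p))\<^sup>2)) \<partial>lborel \<partial>lborel)"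
    by (rule lborel_pair.Fubini') measurable
  also have "\<dots> = (\<integral>\<^sup>+\<tau>. \<integral>\<^sup>+\<xi>. (ennreal (?w \<tau>) * ennreal ((pi / \<tau>) powr (DIM('a) / 2) * (1 - exp (- (norm \<xi>)\<^sup>2 / (4 * \<tau>))))) * ennreal (?P \<xi>) \<partial>lborel \<partial>lborel)"
  proof (rule nn_integral_cong)
    fix \<tau> :: real
    show "(\<integral>\<^sup>+p. ennreal (?w \<tau>) * ennreal ((u (fst p) - u (snd p))\<^sup>2 * exp (- \<tau> * (norm (fst p - snd p))\<^sup>2)) \<partial>lborel)
     = (\<integral>\<^sup>+\<xi>. (ennreal (?w \<tau>) * ennreal ((pi / \<tau>) powr (DIM('a) / 2) * (1 - exp (- (norm \<xi>)\<^sup>2 / (4 * \<tau>))))) * ennreal (?P \<xi>) \<partial>lborel)"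
    proof (cases "\<tau> > 0")
      case True
      \<comment> \<open>Chosen so that exp(-|z|^2 / (4 t)) = exp(-\<tau> |z|^2); then q is the
        normalisation (4 pi t)^(d/2) of the kernel.\<close>
      define t where "t = 1 / (4 * \<tau>)"
      define q where "q = (pi / \<tau>) powr (DIM('a) / 2)"
      have t: "t > 0" using True by (simp add: t_def)
      have q: "q > 0" using True by (simp add: q_def)
      have k: "exp (- \<tau> * (norm z)\<^sup>2) = q * heat_kernel t z" for z :: 'a
        using True by (simp add: heat_kernel_def q_def t_def mult.commute)
      let ?N = "LINT x|lborel. (u x)\<^sup>2"
      let ?H = "LINT p|lborel. u (fst p) * u (snd p) * heat_kernel t (fst p - snd p)"
      have "(\<integral>\<^sup>+p. ennreal ((u (fst p) - u (snd p))\<^sup>2 * exp (- \<tau> * (norm (fst p - snd p))\<^sup>2)) \<partial>lborel)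
         = (\<integral>\<^sup>+p. ennreal q * ennreal ((u (fst p) - u (snd p))\<^sup>2 * heat_kernel t (fst p - snd p)) \<partial>lborel)"
        unfolding k using q by (intro nn_integral_cong, subst ennreal_mult[symmetric]) (auto simp: mult_ac)
      also have "\<dots> = ennreal q * heat_modulus t u"
        unfolding heat_modulus_def by (rule nn_integral_cmult) measurable
      also have "heat_modulus t u = ennreal (2 * ?N - 2 * ?H)"
        by (rule heat_modulus_eq[OF t u u2])
      also have "\<dots> = (\<integral>\<^sup>+\<xi>. ennreal ((1 - exp (- (norm \<xi>)\<^sup>2 / (4 * \<tau>))) * ?P \<xi>) \<partial>lborel)"
      proof -
        \<comment> \<open>Plancherel gives the term with ?N, its damped form the term with ?H; the
          common factor (2 pi)^d is divided out.\<close>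
        have "has_bochner_integral lborel (\<lambda>\<xi>. 2 / ?c * power_spectrum u \<xi> - 2 / ?c * (exp (- t * (norm \<xi>)\<^sup>2) * power_spectrum u \<xi>))
           (2 / ?c * (?c * ?N) - 2 / ?c * (?c * ?H))"
          by (intro has_bochner_integral_diff has_bochner_integral_mult_right has_bochner_integral_power_spectrum u u2)
             (simp only: has_bochner_integral_iff integrable_gaussian_power_spectrum[OF t u] integral_gaussian_power_spectrum[OF t u] simp_thms)
        also have "(\<lambda>\<xi>. 2 / ?c * power_spectrum u \<xi> - 2 / ?c * (exp (- t * (norm \<xi>)\<^sup>2) * power_spectrum u \<xi>)) =
           (\<lambda>\<xi>. (1 - exp (- (norm \<xi>)\<^sup>2 / (4 * \<tau>))) * ?P \<xi>)"
          by (auto simp: t_def field_simps)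
        finally show ?thesis
          using True by (subst nn_integral_eq_integral) (auto simp: has_bochner_integral_iff divide_nonpos_pos)
      qed
      finally have "(\<integral>\<^sup>+p. ennreal ((u (fst p) - u (snd p))\<^sup>2 * exp (- \<tau> * (norm (fst p - snd p))\<^sup>2)) \<partial>lborel)
        = ennreal q * (\<integral>\<^sup>+\<xi>. ennreal ((1 - exp (- (norm \<xi>)\<^sup>2 / (4 * \<tau>))) * ?P \<xi>) \<partial>lborel)" .
      hence "(\<integral>\<^sup>+p. ennreal (?w \<tau>) * ennreal ((u (fst p) - u (snd p))\<^sup>2 * exp (- \<tau> * (norm (fst p - snd p))\<^sup>2)) \<partial>lborel)
        = (\<integral>\<^sup>+\<xi>. ennreal (?w \<tau>) * (ennreal q * ennreal ((1 - exp (- (norm \<xi>)\<^sup>2 / (4 * \<tau>))) * ?P \<xi>)) \<partial>lborel)"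
        by (simp add: nn_integral_cmult)
      also have "\<dots> = (\<integral>\<^sup>+\<xi>. (ennreal (?w \<tau>) * ennreal ((pi / \<tau>) powr (DIM('a) / 2) * (1 - exp (- (norm \<xi>)\<^sup>2 / (4 * \<tau>))))) * ennreal (?P \<xi>) \<partial>lborel)"
        unfolding q_def[symmetric]
      proof (rule nn_integral_cong)
        fix \<xi> :: 'a
        let ?E = "1 - exp (- (norm \<xi>)\<^sup>2 / (4 * \<tau>))"
        have E: "?E \<ge> 0" using True by (simp add: divide_nonpos_pos)
        have "ennreal (?E * ?P \<xi>) = ennreal ?E * ennreal (?P \<xi>)" "ennreal (q * ?E) = ennreal q * ennreal ?E"
          by (rule ennreal_mult; use E q in simp)+
        thus "ennreal (?w \<tau>) * (ennreal q * ennreal (?E * ?P \<xi>)) = ennreal (?w \<tau>) * ennreal (q * ?E) * ennreal (?P \<xi>)"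
          by (simp only: mult.assoc)
      qed
      finally show ?thesis .
    qed (simp add: frac_weight_def)
  qed
  also have "\<dots> = (\<integral>\<^sup>+\<xi>. \<integral>\<^sup>+\<tau>. (ennreal (?w \<tau>) * ennreal ((pi / \<tau>) powr (DIM('a) / 2) * (1 - exp (- (norm \<xi>)\<^sup>2 / (4 * \<tau>))))) * ennreal (?P \<xi>) \<partial>lborel \<partial>lborel)"
    by (rule lborel_pair.Fubini') measurable
  also have "\<dots> = (\<integral>\<^sup>+\<xi>. frac_symbol DIM('a) s (norm \<xi>) * ennreal (?P \<xi>) \<partial>lborel)"
    unfolding frac_symbol_def by (intro nn_integral_cong nn_integral_multc) measurable
  finally show ?thesis .
qed

text \<open>The powers of \<tau> that depend on d cancel, so scaling and convergence of
  \<open>frac_symbol\<close> are governed by \<tau> powr (s - 1) in every dimension.\<close>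

lemma frac_weight_mult_gaussian_mass:
  assumes "\<tau> > 0"
  shows "frac_weight d s \<tau> * (pi / \<tau>) powr (d / 2) = pi powr (d / 2) / Gamma ((d + 2 * s) / 2) * \<tau> powr (s - 1)"
proof -
  have "\<tau> powr ((d + 2 * s) / 2 - 1) = \<tau> powr (d / 2 + (s - 1))"
    by (rule arg_cong[where f="\<lambda>x. \<tau> powr x"]) (simp add: field_simps)
  also have "\<dots> = \<tau> powr (d / 2) * \<tau> powr (s - 1)" by (rule powr_add)
  finally show ?thesis
    using assms by (simp add: frac_weight_def powr_divide)
qed

text \<open>Substitute \<tau> -> r \<tau> with r = \<rho>^2. The exponential loses its dependence on
  \<rho>, and the measure together with the remaining power contributes r * r powr (s - 1) = r powr
  s.\<close>

lemma frac_symbol_scale: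
  assumes ds: "d + 2 * s > 0" and \<rho>: "\<rho> > 0"
  shows "frac_symbol d s \<rho> = ennreal (\<rho> powr (2 * s)) * frac_symbol d s 1"
proof -
  define r where "r = \<rho>\<^sup>2"
  have r: "r > 0" using \<rho> by (simp add: r_def)
  let ?F = "\<lambda>q \<tau>. ennreal (frac_weight d s \<tau>) * ennreal ((pi / \<tau>) powr (d / 2) * (1 - exp (- q / (4 * \<tau>))))"
  have "frac_symbol d s \<rho> = ennreal r * (\<integral>\<^sup>+\<tau>. ?F r (0 + r * \<tau>) \<partial>lborel)"
    unfolding frac_symbol_def r_def[symmetric] using r by (subst nn_integral_real_affine[of _ r 0]) auto
  also have "\<dots> = (\<integral>\<^sup>+\<tau>. ennreal r * ?F r (0 + r * \<tau>) \<partial>lborel)"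
    by (rule nn_integral_cmult[symmetric]) measurable
  also have "\<dots> = (\<integral>\<^sup>+\<tau>. ennreal (r powr s) * ?F 1 \<tau> \<partial>lborel)"
  proof (rule nn_integral_cong)
    fix \<tau> :: real
    show "ennreal r * ?F r (0 + r * \<tau>) = ennreal (r powr s) * ?F 1 \<tau>"
    proof (cases "\<tau> > 0")
      case True
      let ?E = "1 - exp (- 1 / (4 * \<tau>))" and ?C = "pi powr (d / 2) / Gamma ((d + 2 * s) / 2)"
      have E: "?E \<ge> 0" using True by (simp add: divide_nonpos_pos)
      have e: "1 - exp (- r / (4 * (0 + r * \<tau>))) = ?E" using r by simp
      have "ennreal r * ?F r (0 + r * \<tau>) = ennreal (r * (frac_weight d s (r * \<tau>) * (pi / (r * \<tau>)) powr (d / 2)) * ?E)"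
        unfolding e using r ds E by (simp add: ennreal_mult[symmetric] mult.assoc del: ennreal_mult')
      also have "r * (frac_weight d s (r * \<tau>) * (pi / (r * \<tau>)) powr (d / 2)) * ?E
          = r * (?C * (r powr (s - 1) * \<tau> powr (s - 1))) * ?E"
        using True r by (subst frac_weight_mult_gaussian_mass) (auto simp: powr_mult)
      also have "\<dots> = (r * r powr (s - 1)) * (?C * \<tau> powr (s - 1)) * ?E" by (simp add: mult_ac)
      also have "r * r powr (s - 1) = r powr s" using r powr_add[of r 1 "s - 1"] by simp
      also have "?C * \<tau> powr (s - 1) = frac_weight d s \<tau> * (pi / \<tau>) powr (d / 2)"
        by (rule frac_weight_mult_gaussian_mass[OF True, symmetric])
      also have "ennreal (r powr s * (frac_weight d s \<tau> * (pi / \<tau>) powr (d / 2)) * ?E) = ennreal (r powr s) * ?F 1 \<tau>"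
        using ds E by (simp add: ennreal_mult[symmetric] mult.assoc del: ennreal_mult')
      finally show ?thesis .
    next
      case False
      hence "\<not> r * \<tau> > 0" using r by (simp add: zero_less_mult_iff)
      thus ?thesis using False by (simp add: frac_weight_def)
    qed
  qed
  also have "\<dots> = ennreal (r powr s) * frac_symbol d s 1"
    unfolding frac_symbol_def power_one by (rule nn_integral_cmult) measurable
  also have "r powr s = \<rho> powr (2 * s)"
    using \<rho> powr_powr[of \<rho> 2 s] by (simp add: r_def powr_realpow)
  finally show ?thesis .
qed

lemma frac_symbol_0: "frac_symbol d s 0 = 0"
  by (simp add: frac_symbol_def)

text \<open>Near 0 the factor 1 - exp is at most 1, and \<tau> powr (s - 1) is integrable because s
  > 0. Near infinity 1 - exp(-x) <= x gains a power of \<tau>, and \<tau> powr (s - 2) is integrable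
  because s < 1.\<close>

lemma frac_symbol_1_finite:
  assumes d: "d \<ge> 0" and s: "0 < s" "s < 1"
  shows "frac_symbol d s 1 < \<infinity>"
proof -
  let ?C = "pi powr (d / 2) / Gamma ((d + 2 * s) / 2)"
  have C: "?C \<ge> 0" using d s by (intro divide_nonneg_pos Gamma_real_pos) auto
  let ?f = "\<lambda>\<tau>. indicator {0..1} \<tau> * \<tau> powr (s - 1)" and ?g = "\<lambda>\<tau>. indicator {1..} \<tau> * \<tau> powr (s - 2)"
  have "((\<lambda>\<tau>. \<tau> powr (s - 1)) has_integral (1 powr (s - 1 + 1) / (s - 1 + 1))) {0..1}"
    by (rule has_integral_powr_from_0) (use s in auto)
  from nn_integral_has_integral_lebesgue[OF _ this] have f: "(\<integral>\<^sup>+\<tau>. ennreal (?f \<tau>) \<partial>lborel) < \<infinity>"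
    by simp
  have "((\<lambda>\<tau>. \<tau> powr (s - 2)) has_integral - (1 powr (s - 2 + 1)) / (s - 2 + 1)) {1..}"
    by (rule has_integral_powr_to_inf) (use s in auto)
  from nn_integral_has_integral_lebesgue[OF _ this] have g: "(\<integral>\<^sup>+\<tau>. ennreal (?g \<tau>) \<partial>lborel) < \<infinity>"
    by simp
  have "frac_symbol d s 1 \<le> (\<integral>\<^sup>+\<tau>. ennreal ?C * (ennreal (?f \<tau>) + ennreal (?g \<tau>)) \<partial>lborel)"
    unfolding frac_symbol_def
  proof (rule nn_integral_mono)
    fix \<tau> :: real
    show "ennreal (frac_weight d s \<tau>) * ennreal ((pi / \<tau>) powr (d / 2) * (1 - exp (- 1\<^sup>2 / (4 * \<tau>)))) \<le> ennreal ?C * (ennreal (?f \<tau>) + ennreal (?g \<tau>))"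
    proof (cases "\<tau> > 0")
      case True
      let ?E = "1 - exp (- 1\<^sup>2 / (4 * \<tau>))"
      have E: "0 \<le> ?E" "?E \<le> 1" using True by (auto simp: divide_nonpos_pos)
      have "?E \<le> 1 / (4 * \<tau>)" using exp_ge_add_one_self[of "- 1 / (4 * \<tau>)"] by simp
      also have "\<dots> \<le> 1 / \<tau>" using True by (simp add: field_simps)
      finally have E2: "?E \<le> 1 / \<tau>" .
      have "\<tau> powr (s - 1) * ?E \<le> ?f \<tau> + ?g \<tau>"
      proof (cases "\<tau> \<le> 1")
        case True
        have "\<tau> powr (s - 1) * ?E \<le> \<tau> powr (s - 1) * 1" by (intro mult_left_mono E) auto
        also have "\<dots> \<le> ?f \<tau> + ?g \<tau>" using True \<open>\<tau> > 0\<close> by simp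
        finally show ?thesis .
      next
        case False
        have "\<tau> powr (s - 1) * ?E \<le> \<tau> powr (s - 1) * (1 / \<tau>)" by (intro mult_left_mono E2) auto
        also have "\<dots> = \<tau> powr (s - 2)" using True powr_add[of \<tau> "s - 2" 1] by simp
        finally show ?thesis using False by simp
      qed
      hence "?C * (\<tau> powr (s - 1) * ?E) \<le> ?C * (?f \<tau> + ?g \<tau>)" using C by (rule mult_left_mono)
      moreover have "frac_weight d s \<tau> * ((pi / \<tau>) powr (d / 2) * ?E) = ?C * (\<tau> powr (s - 1) * ?E)"
        using frac_weight_mult_gaussian_mass[OF True, of d s] by (simp add: mult.assoc[symmetric])
      ultimately have "ennreal (frac_weight d s \<tau> * ((pi / \<tau>) powr (d / 2) * ?E)) \<le> ennreal (?C * (?f \<tau> + ?g \<tau>))"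
        by (simp add: ennreal_leI)
      moreover have "ennreal (frac_weight d s \<tau> * ((pi / \<tau>) powr (d / 2) * ?E)) = ennreal (frac_weight d s \<tau>) * ennreal ((pi / \<tau>) powr (d / 2) * ?E)"
        by (rule ennreal_mult) (use d s E in auto)
      moreover have "ennreal (?C * (?f \<tau> + ?g \<tau>)) = ennreal ?C * ennreal (?f \<tau> + ?g \<tau>)"
        by (rule ennreal_mult) (use C in auto)
      moreover have "ennreal (?f \<tau> + ?g \<tau>) = ennreal (?f \<tau>) + ennreal (?g \<tau>)"
        by (rule ennreal_plus) auto
      ultimately show ?thesis by (simp only:)
    qed (simp add: frac_weight_def)
  qed
  also have "\<dots> = ennreal ?C * ((\<integral>\<^sup>+\<tau>. ennreal (?f \<tau>) \<partial>lborel) + (\<integral>\<^sup>+\<tau>. ennreal (?g \<tau>) \<partial>lborel))"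
    by (subst nn_integral_cmult, measurable, subst nn_integral_add, auto)
  also have "\<dots> < \<infinity>" using f g by (simp add: ennreal_mult_less_top)
  finally show ?thesis .
qed

text \<open>Permits division by this value when \<open>frac_const\<close> is evaluated. The
  integrand is positive for every \<tau> > 0, so any interval such as {1..2} detects it.\<close>

lemma frac_symbol_1_pos:
  assumes d: "d \<ge> 0" and s: "0 < s"
  shows "frac_symbol d s 1 > 0"
proof (rule ccontr)
  let ?F = "\<lambda>\<tau>. ennreal (frac_weight d s \<tau>) * ennreal ((pi / \<tau>) powr (d / 2) * (1 - exp (- 1\<^sup>2 / (4 * \<tau>))))"
  assume "\<not> ?thesis"
  hence "(\<integral>\<^sup>+\<tau>. ?F \<tau> \<partial>lborel) = 0" by (simp add: frac_symbol_def)
  hence "emeasure lborel {\<tau>\<in>space lborel. ?F \<tau> \<noteq> 0} = 0"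
    by (subst (asm) nn_integral_0_iff) auto
  moreover have "{1..2} \<subseteq> {\<tau>\<in>space lborel. ?F \<tau> \<noteq> 0}"
  proof
    fix \<tau> :: real assume \<tau>: "\<tau> \<in> {1..2}"
    have "frac_weight d s \<tau> > 0" "(pi / \<tau>) powr (d / 2) * (1 - exp (- 1\<^sup>2 / (4 * \<tau>))) > 0"
      using \<tau> d s by (auto simp: frac_weight_def intro!: divide_pos_pos mult_pos_pos Gamma_real_pos)
    thus "\<tau> \<in> {\<tau>\<in>space lborel. ?F \<tau> \<noteq> 0}" by (simp add: ennreal_eq_0_iff)
  qed
  hence "emeasure lborel {1..2::real} \<le> emeasure lborel {\<tau>\<in>space lborel. ?F \<tau> \<noteq> 0}"
    by (rule emeasure_mono) measurable
  ultimately show False by simp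
qed

text \<open>The double integral is 2 k times the moment over (2 pi)^n, while
  \<open>frac_const\<close> is 1 / k, so the prefactor of \<open>frac_form\<close> cancels exactly.
  Assumption \<open>fin\<close> makes the double integral finite; a Bochner integral that does not
  exist would have the default value 0.\<close>

lemma frac_form_eq_power_spectrum:
  fixes u :: "real^'n \<Rightarrow> real"
  assumes s: "0 < s" "s < 1" and u: "integrable lborel u" and u2: "integrable lborel (\<lambda>x. (u x)\<^sup>2)"
    and fin: "integrable lborel (\<lambda>\<xi>. norm \<xi> powr (2 * s) * power_spectrum u \<xi>)"
  shows "frac_form s u u = (LINT \<xi>|lborel. norm \<xi> powr (2 * s) * power_spectrum u \<xi>) / (2 * pi) ^ CARD('n)"
proof -
  let ?d = "real CARD('n)" and ?c = "(2 * pi) ^ CARD('n)"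
  define k where "k = enn2real (frac_symbol ?d s 1)"
  have k: "frac_symbol ?d s 1 = ennreal k" "k > 0"
    using frac_symbol_1_finite[of ?d s] frac_symbol_1_pos[of ?d s] s
    by (auto simp: k_def enn2real_positive_iff)
  have fs: "frac_symbol ?d s \<rho> = ennreal (\<rho> powr (2 * s) * k)" if "\<rho> \<ge> 0" for \<rho>
  proof (cases "\<rho> = 0")
    case False
    thus ?thesis using that s k by (subst frac_symbol_scale) (auto simp: ennreal_mult add_nonneg_pos)
  qed (simp add: frac_symbol_0)
  have [measurable]: "u \<in> borel_measurable borel" using u by (auto dest: borel_measurable_integrable)
  \<comment> \<open>The coordinate fixed in \<open>frac_const\<close>; what matters is that
    \<open>axis i 1\<close> has norm 1.\<close>
  define i :: 'n where "i = (SOME i. True)"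
  have "(LINT \<zeta>::real^'n|lborel. (1 - cos (\<zeta> $ i)) / norm \<zeta> powr (?d + 2 * s)) = k"
  proof -
    have "(\<integral>\<^sup>+\<zeta>. ennreal ((1 - cos (\<zeta> $ i)) / norm \<zeta> powr (?d + 2 * s)) \<partial>(lborel :: (real^'n) measure)) = ennreal k"
      using nn_integral_one_minus_cos[OF s(1), of "axis i 1 :: real^'n"] fs[of 1] by (simp add: inner_axis')
    thus ?thesis using k
      by (subst integral_eq_nn_integral) auto
  qed
  hence const: "frac_const TYPE('n) s = 1 / k"
    by (simp add: frac_const_def i_def inverse_eq_divide)
  let ?D = "\<lambda>x y. (u x - u y) * (u x - u y) / norm (x - y) powr (?d + 2 * s)"
  let ?L = "LINT \<xi>|lborel. norm \<xi> powr (2 * s) * power_spectrum u \<xi>"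
  have "(\<integral>\<^sup>+p. ennreal ((u (fst p) - u (snd p))\<^sup>2 / norm (fst p - snd p) powr (?d + 2 * s)) \<partial>lborel)
     = (\<integral>\<^sup>+\<xi>. ennreal ((2 * k / ?c) * (norm \<xi> powr (2 * s) * power_spectrum u \<xi>)) \<partial>lborel)"
    using nn_integral_difference_quotient[OF s(1) u u2] k
    by (simp add: fs ennreal_mult[symmetric] mult_ac del: ennreal_mult')
  also have "\<dots> = ennreal ((2 * k / ?c) * ?L)"
    using k by (subst nn_integral_eq_integral) (auto intro!: integrable_mult_right fin simp del: times_divide_eq_left)
  finally have "has_bochner_integral (lborel \<Otimes>\<^sub>M lborel) (\<lambda>p. (u (fst p) - u (snd p))\<^sup>2 / norm (fst p - snd p) powr (?d + 2 * s)) ((2 * k / ?c) * ?L)"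
    using k by (intro has_bochner_integral_nn_integral) (auto simp: lborel_prod intro!: mult_nonneg_nonneg integral_nonneg_AE divide_nonneg_pos)
  hence int: "has_bochner_integral (lborel \<Otimes>\<^sub>M lborel) (\<lambda>(x, y). ?D x y) ((2 * k / ?c) * ?L)"
    by (simp add: case_prod_beta' power2_eq_square)
  have "(LINT x|lborel. LINT y|lborel. ?D x y) = (2 * k / ?c) * ?L"
    using int lborel_pair.integral_fst[of ?D] by (auto simp: has_bochner_integral_iff)
  thus ?thesis using k by (simp add: frac_form_def const)
qed

subsection \<open>Test functions and null boundaries\<close>

text \<open>Waves become test functions once multiplied by a radial cutoff. The cutoff is a function
  of the squared distance, which is differentiable at the centre as well. It will be used with a
  bump on a ball and with a plateau over \<Omega>.\<close>

lemma C1_test_function_radial_times_wave: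
  fixes c \<xi> :: "real^'n" and f g :: "real \<Rightarrow> real"
  assumes f: "\<And>t. (f has_real_derivative f' t) (at t)" "continuous_on UNIV f'"
    and g: "\<And>t. (g has_real_derivative g' t) (at t)" "continuous_on UNIV g'"
    and supp: "\<And>t. t \<ge> r \<Longrightarrow> f t = 0"
  shows "C1_test_function (\<lambda>x. f ((norm (x - c))\<^sup>2) * g (\<xi> \<bullet> x))
           (\<lambda>x. (2 * f' ((norm (x - c))\<^sup>2) * g (\<xi> \<bullet> x)) *\<^sub>R (x - c) + (f ((norm (x - c))\<^sup>2) * g' (\<xi> \<bullet> x)) *\<^sub>R \<xi>)"
  unfolding C1_test_function_def
proof (intro conjI allI)
  fix x
  have 1: "((\<lambda>x. f ((x - c) \<bullet> (x - c))) has_derivative (\<lambda>h. (2 * ((x - c) \<bullet> h)) * f' ((x - c) \<bullet> (x - c)))) (at x)"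
  proof -
    have a: "((\<lambda>x. (x - c) \<bullet> (x - c)) has_derivative (\<lambda>h. 2 * ((x - c) \<bullet> h))) (at x)"
      by (auto intro!: derivative_eq_intros simp: inner_commute)
    have b: "(f has_derivative (\<lambda>y. y * f' ((x - c) \<bullet> (x - c)))) (at ((x - c) \<bullet> (x - c)))"
      using f(1)[of "(x - c) \<bullet> (x - c)"] by (simp add: has_field_derivative_def mult.commute[of _ "f' _"])
    show ?thesis by (rule has_derivative_compose[OF a b])
  qed
  have 2: "((\<lambda>x. g (\<xi> \<bullet> x)) has_derivative (\<lambda>h. (\<xi> \<bullet> h) * g' (\<xi> \<bullet> x))) (at x)"
  proof -
    have a: "((\<lambda>x. \<xi> \<bullet> x) has_derivative (\<lambda>h. \<xi> \<bullet> h)) (at x)"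
      by (auto intro!: derivative_eq_intros)
    have b: "(g has_derivative (\<lambda>y. y * g' (\<xi> \<bullet> x))) (at (\<xi> \<bullet> x))"
      using g(1)[of "\<xi> \<bullet> x"] by (simp add: has_field_derivative_def mult.commute[of _ "g' _"])
    show ?thesis by (rule has_derivative_compose[OF a b])
  qed
  show "GDERIV (\<lambda>x. f ((norm (x - c))\<^sup>2) * g (\<xi> \<bullet> x)) x :> (2 * f' ((norm (x - c))\<^sup>2) * g (\<xi> \<bullet> x)) *\<^sub>R (x - c) + (f ((norm (x - c))\<^sup>2) * g' (\<xi> \<bullet> x)) *\<^sub>R \<xi>"
    unfolding gderiv_def power2_norm_eq_inner
    by (rule has_derivative_eq_rhs[OF has_derivative_mult[OF 1 2]])
       (auto simp: fun_eq_iff inner_add_right inner_commute algebra_simps)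
next
  have cf: "continuous_on UNIV f" "continuous_on UNIV g"
    using f(1) g(1) by (meson DERIV_continuous_on DERIV_subset subset_UNIV)+
  have "continuous_on UNIV (\<lambda>x. F ((norm (x - c))\<^sup>2))" if "continuous_on UNIV F" for F :: "real \<Rightarrow> real"
    by (rule continuous_on_compose2[OF that]) (auto intro!: continuous_intros)
  moreover have "continuous_on UNIV (\<lambda>x. F (\<xi> \<bullet> x))" if "continuous_on UNIV F" for F :: "real \<Rightarrow> real"
    by (rule continuous_on_compose2[OF that]) (auto intro!: continuous_intros)
  ultimately show "continuous_on UNIV (\<lambda>x. (2 * f' ((norm (x - c))\<^sup>2) * g (\<xi> \<bullet> x)) *\<^sub>R (x - c) + (f ((norm (x - c))\<^sup>2) * g' (\<xi> \<bullet> x)) *\<^sub>R \<xi>)"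
    using f(2) g(2) cf by (auto intro!: continuous_intros)
next
  have "{x. f ((norm (x - c))\<^sup>2) * g (\<xi> \<bullet> x) \<noteq> 0} \<subseteq> cball c (sqrt \<bar>r\<bar>)"
  proof
    fix x assume "x \<in> {x. f ((norm (x - c))\<^sup>2) * g (\<xi> \<bullet> x) \<noteq> 0}"
    hence "(norm (x - c))\<^sup>2 < r" using supp by (auto simp: not_le[symmetric])
    hence "norm (x - c) \<le> sqrt \<bar>r\<bar>" by (intro real_le_rsqrt) auto
    thus "x \<in> cball c (sqrt \<bar>r\<bar>)" by (simp add: dist_norm norm_minus_commute)
  qed
  thus "bounded {x. f ((norm (x - c))\<^sup>2) * g (\<xi> \<bullet> x) \<noteq> 0}"
    by (rule bounded_subset[rotated]) auto
qed

text \<open>The building block of all cutoffs below: it vanishes on a half-line and is C1, which is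
  the regularity that \<open>C1_test_function\<close> asks for, whereas the positive part itself has
  a corner at 0.\<close>

lemma DERIV_pos_part_square: "((\<lambda>t::real. (max 0 t)\<^sup>2) has_real_derivative 2 * max 0 t) (at t)"
proof (cases "t = 0")
  case False
  show ?thesis
  proof (cases "t > 0")
    case True
    have "((\<lambda>t::real. t\<^sup>2) has_real_derivative 2 * t) (at t)" by (auto intro!: derivative_eq_intros)
    hence "((\<lambda>t::real. (max 0 t)\<^sup>2) has_real_derivative 2 * t) (at t)"
      by (rule has_field_derivative_transform_within_open[of _ _ _ "{0<..}"]) (use True in auto)
    thus ?thesis using True by simp
  next
    case False
    have "((\<lambda>t::real. 0) has_real_derivative 0) (at t)" by simp
    hence "((\<lambda>t::real. (max 0 t)\<^sup>2) has_real_derivative 0) (at t)"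
      by (rule has_field_derivative_transform_within_open[of _ _ _ "{..<0}"]) (use False \<open>t \<noteq> 0\<close> in auto)
    thus ?thesis using False by simp
  qed
next
  case True
  have "((\<lambda>h::real. (max 0 h)\<^sup>2 / h) \<longlongrightarrow> 0) (at 0)"
  proof (rule Lim_null_comparison)
    show "\<forall>\<^sub>F h::real in at 0. norm ((max 0 h)\<^sup>2 / h) \<le> \<bar>h\<bar>"
      by (rule always_eventually) (auto simp: max_def power2_eq_square)
    show "((\<lambda>h::real. \<bar>h\<bar>) \<longlongrightarrow> 0) (at 0)" by (rule tendsto_eq_intros refl)+ simp
  qed
  thus ?thesis using True by (simp add: DERIV_def)
qed

lemma C1_plateau_exists:
  obtains f f' :: "real \<Rightarrow> real"
  where "\<And>t. (f has_real_derivative f' t) (at t)" "continuous_on UNIV f'"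
    "\<And>t. t \<ge> r + 1 \<Longrightarrow> f t = 0" "\<And>t. t \<le> r \<Longrightarrow> f t = 1" "\<And>t. t \<le> r \<Longrightarrow> f' t = 0"
proof -
  \<comment> \<open>Two nested squared positive parts: for t <= r one has m t >= 1 and hence k t = 0
    below; for t >= r + 1 one has m t = 0 and hence k t = 1. The plateau is 1 - k^2.\<close>
  define m where "m t = max 0 (r + 1 - t)" for t
  have m1: "((\<lambda>t. (m t)\<^sup>2) has_real_derivative 2 * m t * -1) (at t)" for t
    unfolding m_def
    by (rule DERIV_chain2[OF DERIV_pos_part_square]) (auto intro!: derivative_eq_intros)
  define k where "k t = max 0 (1 - (m t)\<^sup>2)" for t
  have "((\<lambda>t. (k t)\<^sup>2) has_real_derivative 2 * k t * (0 - (2 * m t * -1))) (at t)" for t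
    unfolding k_def
    by (rule DERIV_chain2[OF DERIV_pos_part_square]) (intro derivative_intros m1)
  hence D: "((\<lambda>t. 1 - (k t)\<^sup>2) has_real_derivative 0 - 2 * k t * (0 - (2 * m t * -1))) (at t)" for t
    by (intro derivative_intros) 
  show ?thesis
  proof
    show "((\<lambda>t. 1 - (k t)\<^sup>2) has_real_derivative 0 - 2 * k t * (0 - (2 * m t * -1))) (at t)" for t by (rule D)
    show "continuous_on UNIV (\<lambda>t. 0 - 2 * k t * (0 - (2 * m t * -1)))"
      unfolding k_def m_def by (intro continuous_intros)
    show "1 - (k t)\<^sup>2 = 0" if "t \<ge> r + 1" for t using that by (simp add: k_def m_def)
    have k0: "k t = 0" if "t \<le> r" for t
    proof -
      have "m t \<ge> 1" using that by (simp add: m_def)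
      hence "(m t)\<^sup>2 \<ge> 1" by simp
      thus ?thesis by (simp add: k_def)
    qed
    thus "1 - (k t)\<^sup>2 = 1" "0 - 2 * k t * (0 - (2 * m t * -1)) = 0" if "t \<le> r" for t
      using that by simp_all
  qed
qed

text \<open>On the bounded support |f| <= f^2 + 1, and constants are integrable over a ball.\<close>

lemma integrable_of_square_integrable_bounded_support:
  fixes f :: "'a::euclidean_space \<Rightarrow> real"
  assumes [measurable]: "f \<in> borel_measurable borel" and f2: "integrable lborel (\<lambda>x. (f x)\<^sup>2)"
    and S: "bounded S" and supp: "AE x in lborel. x \<notin> S \<longrightarrow> f x = 0"
  shows "integrable lborel f"
proof -
  obtain R where "\<forall>x\<in>S. norm x \<le> R" using S by (auto simp: bounded_iff)
  hence R: "S \<subseteq> cball 0 R" by auto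
  have "integrable lborel (\<lambda>x. (f x)\<^sup>2 + indicat_real (cball 0 R) x)"
    using emeasure_lborel_cball_finite[of "0::'a" R] by (intro Bochner_Integration.integrable_add f2) auto
  thus ?thesis
  proof (rule Bochner_Integration.integrable_bound)
    show "AE x in lborel. norm (f x) \<le> norm ((f x)\<^sup>2 + indicat_real (cball 0 R) x)"
      using supp
    proof eventually_elim
      case (elim x)
      show ?case
      proof (cases "x \<in> S")
        case True
        hence "x \<in> cball 0 R" using R by auto
        moreover have "\<bar>f x\<bar> \<le> (f x)\<^sup>2 + 1"
        proof -
          have "2 * \<bar>f x\<bar> \<le> (f x)\<^sup>2 + 1" using sum_squares_bound[of "\<bar>f x\<bar>" 1] by simp
          thus ?thesis using abs_ge_zero[of "f x"] by linarith
        qed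
        ultimately show ?thesis by simp
      qed (use elim in simp)
    qed
  qed auto
qed

text \<open>Infinitely many disjoint translates of \<open>S\<close> fit into a bounded set.\<close>

lemma null_sets_of_disjoint_translates:
  fixes S :: "'a::euclidean_space set"
  assumes S: "S \<in> sets borel" "bounded S"
    and disj: "\<And>x t. x \<in> S \<Longrightarrow> t \<noteq> 0 \<Longrightarrow> x + t *\<^sub>R e \<notin> S"
  shows "S \<in> null_sets lborel"
proof -
  define T where "T n = (+) ((1 / real (Suc n)) *\<^sub>R e) ` S" for n
  have T_alt: "T n = (+) (- ((1 / real (Suc n)) *\<^sub>R e)) -` S" for n
    unfolding T_def by (auto simp: image_iff intro!: bexI[of _ "- ((1 / real (Suc n)) *\<^sub>R e) + _"])
  have Tm: "T n \<in> sets lborel" for n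
    unfolding T_alt using measurable_sets[of "(+) (- ((1 / real (Suc n)) *\<^sub>R e))" borel borel S] S by simp
  have Te: "emeasure lborel (T n) = emeasure lborel S" for n
  proof -
    have "emeasure lborel (T n) = emeasure (distr lborel borel ((+) (- ((1 / real (Suc n)) *\<^sub>R e)))) S"
      unfolding T_alt using S by (subst emeasure_distr) auto
    thus ?thesis by (simp only: lborel_distr_plus)
  qed
  have "disjoint_family T"
    unfolding disjoint_family_on_def
  proof (intro ballI impI)
    fix m n :: nat assume "m \<noteq> n"
    show "T m \<inter> T n = {}"
    proof (rule ccontr)
      assume "T m \<inter> T n \<noteq> {}"
      then obtain x y where xy: "x \<in> S" "y \<in> S" "(1 / real (Suc m)) *\<^sub>R e + x = (1 / real (Suc n)) *\<^sub>R e + y"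
        by (auto simp: T_def)
      have "y = x + (1 / real (Suc m) - 1 / real (Suc n)) *\<^sub>R e"
        using xy(3) by (simp add: algebra_simps)
      moreover have "1 / real (Suc m) - 1 / real (Suc n) \<noteq> 0" using \<open>m \<noteq> n\<close> by simp
      ultimately show False using disj[OF xy(1)] xy(2) by metis
    qed
  qed
  hence "(\<Sum>n. emeasure lborel (T n)) = emeasure lborel (\<Union>n. T n)"
    using Tm by (intro suminf_emeasure) auto
  also have "\<dots> < \<infinity>"
  proof -
    obtain R where R: "\<And>x. x \<in> S \<Longrightarrow> norm x \<le> R" using S(2) by (auto simp: bounded_iff)
    have "(\<Union>n. T n) \<subseteq> cball 0 (norm e + R)"
    proof
      fix y assume "y \<in> (\<Union>n. T n)"
      then obtain n x where y: "x \<in> S" "y = (1 / real (Suc n)) *\<^sub>R e + x" by (auto simp: T_def)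
      have "norm y \<le> norm ((1 / real (Suc n)) *\<^sub>R e) + norm x" unfolding y by (rule norm_triangle_ineq)
      also have "norm ((1 / real (Suc n)) *\<^sub>R e) \<le> 1 * norm e"
        unfolding norm_scaleR by (intro mult_right_mono) auto
      finally show "y \<in> cball 0 (norm e + R)" using R[OF y(1)] by simp
    qed
    hence "emeasure lborel (\<Union>n. T n) \<le> emeasure lborel (cball (0::'a) (norm e + R))"
      by (rule emeasure_mono) auto
    thus ?thesis using emeasure_lborel_cball_finite[of "0::'a" "norm e + R"] by (rule le_less_trans)
  qed
  finally have fin: "(\<Sum>n::nat. emeasure lborel S) < \<infinity>" by (simp only: Te)
  hence "emeasure lborel S < \<infinity>" by (rule ennreal_suminf_lessD)
  then obtain c where c: "c \<ge> 0" "emeasure lborel S = ennreal c"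
    by (cases "emeasure lborel S") auto
  have "summable (\<lambda>n::nat. c)"
    by (rule summable_suminf_not_top) (use c fin in auto)
  hence "c = 0" by (simp add: summable_const_iff)
  thus ?thesis using S c by auto
qed

text \<open>Near a boundary point the frontier lies on the graph of \<gamma>. A line in direction e
  meets the graph at most once, so the translates of a bounded piece along e are disjoint and the
  piece is null. Lindelof's theorem leaves countably many pieces.\<close>

lemma frontier_null_C1_boundary:
  fixes \<Omega> :: "(real^'n) set"
  assumes op: "open \<Omega>" and C1: "C1_boundary \<Omega>"
  shows "frontier \<Omega> \<in> null_sets lborel"
proof -
  have ex: "\<exists>r>0. frontier \<Omega> \<inter> ball p r \<in> null_sets lborel" if p: "p \<in> frontier \<Omega>" for p
  proof -
    from bspec[OF C1[unfolded C1_boundary_def] p] obtain r e \<gamma> D\<gamma> where r: "r > 0" and e: "norm e = 1" and \<gamma>: "\<forall>x. GDERIV \<gamma> x :> D\<gamma> x"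
      and \<Omega>: "\<Omega> \<inter> ball p r = {x \<in> ball p r. \<gamma> (x - (x \<bullet> e) *\<^sub>R e) < x \<bullet> e}"
      by (elim exE conjE) (rule that)
    have "continuous_on UNIV \<gamma>"
    proof (intro continuous_at_imp_continuous_on ballI)
      fix x
      show "isCont \<gamma> x"
        using \<gamma> unfolding gderiv_def by (intro has_derivative_continuous) (rule spec)
    qed
    hence "continuous_on UNIV (\<lambda>x. \<gamma> (x - (x \<bullet> e) *\<^sub>R e))"
      by (rule continuous_on_compose2) (auto intro!: continuous_intros)
    hence ch: "continuous_on UNIV (\<lambda>x. x \<bullet> e - \<gamma> (x - (x \<bullet> e) *\<^sub>R e))"
      by (intro continuous_on_diff) (auto intro!: continuous_intros)
    let ?h = "\<lambda>x. x \<bullet> e - \<gamma> (x - (x \<bullet> e) *\<^sub>R e)"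
    define S where "S = {x. ?h x = 0} \<inter> cball p r"
    have "closed {x. ?h x = 0}"
      by (rule closed_Collect_eq[OF ch continuous_on_const])
    hence cS: "S \<in> sets borel" unfolding S_def by auto
    have "S \<in> null_sets lborel"
    proof (rule null_sets_of_disjoint_translates[OF cS, where e=e])
      show "bounded S" unfolding S_def by (rule bounded_Int) simp
      fix x t assume x: "x \<in> S" and t: "(t::real) \<noteq> 0"
      have ee: "e \<bullet> e = 1" using e by (simp add: dot_square_norm)
      have xe: "(x + t *\<^sub>R e) \<bullet> e = x \<bullet> e + t" using ee by (simp add: inner_add_left)
      have proj: "x + t *\<^sub>R e - ((x + t *\<^sub>R e) \<bullet> e) *\<^sub>R e = x - (x \<bullet> e) *\<^sub>R e"
        unfolding xe by (simp add: algebra_simps)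
      have "?h (x + t *\<^sub>R e) = ?h x + t" unfolding proj unfolding xe by simp
      thus "x + t *\<^sub>R e \<notin> S" using x t by (simp add: S_def)
    qed
    moreover have "frontier \<Omega> \<inter> ball p r \<subseteq> S"
    proof
      fix x assume x: "x \<in> frontier \<Omega> \<inter> ball p r"
      have "x \<notin> \<Omega>" using x op by (auto simp: frontier_def interior_open)
      hence "x \<notin> {x \<in> ball p r. \<gamma> (x - (x \<bullet> e) *\<^sub>R e) < x \<bullet> e}" unfolding \<Omega>[symmetric] by simp
      hence le: "?h x \<le> 0" using x by simp
      \<comment> \<open>A point strictly below the graph has a neighbourhood that misses \<Omega>,
        so it is not in the closure.\<close>
      have "\<not> ?h x < 0"
      proof
        assume neg: "?h x < 0"
        have "open {x. ?h x < 0}" by (rule open_Collect_less[OF ch continuous_on_const])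
        hence A: "open ({x. ?h x < 0} \<inter> ball p r)" (is "open ?A") by (rule open_Int) simp
        have xA: "x \<in> ?A \<inter> closure \<Omega>" using neg x by (simp add: frontier_def)
        have "?A \<inter> closure \<Omega> \<noteq> {}"
        proof
          assume "?A \<inter> closure \<Omega> = {}"
          with xA show False by (simp only: empty_iff)
        qed
        hence "?A \<inter> \<Omega> \<noteq> {}" by (simp only: open_Int_closure_eq_empty[OF A] not_False_eq_True)
        then obtain y where "y \<in> ?A \<inter> \<Omega>" using ex_in_conv[of "?A \<inter> \<Omega>"] by iprover
        hence y: "?h y < 0" "y \<in> ball p r" "y \<in> \<Omega>" by simp_all
        have "y \<in> \<Omega> \<inter> ball p r" using y by simp
        hence "\<gamma> (y - (y \<bullet> e) *\<^sub>R e) < y \<bullet> e" unfolding \<Omega> by simp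
        thus False using y(1) by simp
      qed
      thus "x \<in> S" using le x by (auto simp: S_def)
    qed
    moreover have "frontier \<Omega> \<inter> ball p r \<in> sets lborel" by simp
    ultimately have "frontier \<Omega> \<inter> ball p r \<in> null_sets lborel" by (metis null_sets_subset)
    with r show ?thesis by (intro exI[of _ r] conjI)
  qed
  then obtain \<rho> where \<rho>: "\<And>p. p \<in> frontier \<Omega> \<Longrightarrow> \<rho> p > 0 \<and> frontier \<Omega> \<inter> ball p (\<rho> p) \<in> null_sets lborel"
    by metis
  let ?F = "(\<lambda>p. ball p (\<rho> p)) ` frontier \<Omega>"
  have op': "open B" if "B \<in> ?F" for B using that by auto
  obtain F' where F': "F' \<subseteq> ?F" "countable F'" "\<Union>F' = \<Union>?F"
    by (rule Lindelof[of ?F, OF op'])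
  have "(\<Union>B\<in>F'. frontier \<Omega> \<inter> B) \<in> null_sets lborel"
  proof (rule null_sets_UN'[OF F'(2)])
    fix B assume "B \<in> F'"
    then obtain p where "p \<in> frontier \<Omega>" "B = ball p (\<rho> p)" using F'(1) by auto
    thus "frontier \<Omega> \<inter> B \<in> null_sets lborel" using \<rho>[of p] by simp
  qed
  moreover have "frontier \<Omega> \<subseteq> (\<Union>B\<in>F'. frontier \<Omega> \<inter> B)"
  proof
    fix p assume p: "p \<in> frontier \<Omega>"
    hence "p \<in> \<Union>?F" using \<rho>[OF p] by (intro UnionI[of "ball p (\<rho> p)"]) auto
    hence "p \<in> \<Union>F'" using F'(3) by simp
    thus "p \<in> (\<Union>B\<in>F'. frontier \<Omega> \<inter> B)" using p by auto
  qed
  ultimately show ?thesis by (metis null_sets_subset borel_closed frontier_closed sets_lborel)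
qed

subsection \<open>Weak gradients\<close>

lemma C1_test_function_bounds:
  fixes \<phi> :: "real^'n \<Rightarrow> real"
  assumes "C1_test_function \<phi> D"
  obtains R B where "\<And>x. x \<notin> cball 0 R \<Longrightarrow> \<phi> x = 0" "\<And>x. x \<notin> cball 0 R \<Longrightarrow> D x = 0"
    "\<And>x. \<bar>\<phi> x\<bar> \<le> B" "\<And>x. norm (D x) \<le> B" "continuous_on UNIV \<phi>" "continuous_on UNIV D"
proof -
  have D: "\<And>x. (\<phi> has_derivative (\<lambda>h. h \<bullet> D x)) (at x)" and cD: "continuous_on UNIV D" and "bounded {x. \<phi> x \<noteq> 0}"
    using assms unfolding C1_test_function_def gderiv_def by auto
  then obtain R where "\<forall>x\<in>{x. \<phi> x \<noteq> 0}. norm x \<le> R" by (auto simp: bounded_iff)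
  hence R: "\<phi> x = 0" if "x \<notin> cball 0 R" for x using that by auto
  have c\<phi>: "continuous_on UNIV \<phi>"
    by (intro continuous_at_imp_continuous_on ballI has_derivative_continuous[OF D])
  have D0: "D x = 0" if x: "x \<notin> cball 0 R" for x
  proof -
    have "((\<lambda>_. 0) has_derivative (\<lambda>h. h \<bullet> D x)) (at x)"
      by (rule has_derivative_transform_within_open[OF D, of "- cball 0 R"]) (use x R in auto)
    hence "(\<lambda>h. h \<bullet> D x) = (\<lambda>_. 0)"
      by (rule has_derivative_unique) simp
    hence "D x \<bullet> D x = 0" by metis
    thus ?thesis by simp
  qed
  have "bounded (\<phi> ` cball 0 R)" "bounded (D ` cball 0 R)"
    by (intro compact_imp_bounded compact_continuous_image continuous_on_subset[OF c\<phi>] continuous_on_subset[OF cD]; simp)+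
  then obtain B1 B2 where B: "\<forall>x\<in>cball 0 R. \<bar>\<phi> x\<bar> \<le> B1" "\<forall>x\<in>cball 0 R. norm (D x) \<le> B2"
    by (auto simp: bounded_iff)
  show ?thesis
  proof
    show "\<bar>\<phi> x\<bar> \<le> max 0 (max B1 B2)" for x using B(1) R[of x] by (cases "x \<in> cball 0 R") (auto simp: le_max_iff_disj)
    show "norm (D x) \<le> max 0 (max B1 B2)" for x using B(2) D0[of x] by (cases "x \<in> cball 0 R") (auto simp: le_max_iff_disj)
  qed (use R D0 c\<phi> cD in auto)
qed

lemma L2_weak_gradient_component:
  fixes G :: "real^'n \<Rightarrow> real^'n"
  assumes "L2_weak_gradient u G"
  shows "(\<lambda>x. G x \<bullet> b) \<in> borel_measurable borel" "integrable lborel (\<lambda>x. (G x \<bullet> b)\<^sup>2)"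
proof -
  have [measurable]: "G \<in> borel_measurable borel" and G2: "integrable lborel (\<lambda>x. (norm (G x))\<^sup>2)"
    using assms by (auto simp: L2_weak_gradient_def)
  show "(\<lambda>x. G x \<bullet> b) \<in> borel_measurable borel" by measurable
  have "integrable lborel (\<lambda>x. (norm b)\<^sup>2 * (norm (G x))\<^sup>2)" using G2 by simp
  thus "integrable lborel (\<lambda>x. (G x \<bullet> b)\<^sup>2)"
  proof (rule Bochner_Integration.integrable_bound)
    have "(G x \<bullet> b)\<^sup>2 \<le> (norm b * norm (G x))\<^sup>2" for x
      using Cauchy_Schwarz_ineq2[of "G x" b] by (metis abs_ge_zero mult.commute power2_abs power_mono)
    thus "AE x in lborel. norm ((G x \<bullet> b)\<^sup>2) \<le> norm ((norm b)\<^sup>2 * (norm (G x))\<^sup>2)"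
      by (simp add: power_mult_distrib)
  qed measurable
qed

lemma integrable_cutoff_mult:
  fixes \<phi> g :: "real^'n \<Rightarrow> real"
  assumes \<phi>: "\<phi> \<in> borel_measurable borel" "\<And>x. \<bar>\<phi> x\<bar> \<le> B" "\<And>x. x \<notin> cball 0 R \<Longrightarrow> \<phi> x = 0"
    and g: "g \<in> borel_measurable borel" "integrable lborel (\<lambda>x. (g x)\<^sup>2)"
  shows "integrable lborel (\<lambda>x. (\<phi> x * g x)\<^sup>2)" "integrable lborel (\<lambda>x. \<phi> x * g x)"
proof -
  note [measurable] = \<phi>(1) g(1)
  show sq: "integrable lborel (\<lambda>x. (\<phi> x * g x)\<^sup>2)"
  proof (rule Bochner_Integration.integrable_bound)
    show "integrable lborel (\<lambda>x. B\<^sup>2 * (g x)\<^sup>2)" using g by simp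
    have "(\<phi> x)\<^sup>2 \<le> B\<^sup>2" for x using \<phi>(2)[of x] by (metis abs_ge_zero power2_abs power_mono)
    thus "AE x in lborel. norm ((\<phi> x * g x)\<^sup>2) \<le> norm (B\<^sup>2 * (g x)\<^sup>2)"
      by (simp add: power_mult_distrib mult_right_mono)
  qed measurable
  show "integrable lborel (\<lambda>x. \<phi> x * g x)"
    by (rule integrable_of_square_integrable_bounded_support[OF _ sq, of "cball 0 R"]) (use \<phi>(3) in auto)
qed

text \<open>\<open>is_weak_gradient\<close> equates vector-valued integrals. The inner product with
  b may be moved under them because both integrands are integrable: D is bounded, and \<phi> is
  bounded with bounded support.\<close>

lemma weak_gradient_test:
  fixes u :: "real^'n \<Rightarrow> real"
  assumes u: "integrable lborel u" and G: "L2_weak_gradient u G" and \<phi>: "C1_test_function \<phi> D"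
  shows "(LINT x|lborel. u x * (D x \<bullet> b)) = - (LINT x|lborel. \<phi> x * (G x \<bullet> b))"
proof -
  obtain R B where RB: "\<And>x. x \<notin> cball 0 R \<Longrightarrow> \<phi> x = 0" "\<And>x. x \<notin> cball 0 R \<Longrightarrow> D x = 0"
    "\<And>x. \<bar>\<phi> x\<bar> \<le> B" "\<And>x. norm (D x) \<le> B" "continuous_on UNIV \<phi>" "continuous_on UNIV D"
    using C1_test_function_bounds[OF \<phi>] by blast
  have [measurable]: "\<phi> \<in> borel_measurable borel" "D \<in> borel_measurable borel"
    using RB(5,6) by (auto intro: borel_measurable_continuous_onI)
  have [measurable]: "G \<in> borel_measurable borel" "u \<in> borel_measurable borel"
    using G u by (auto simp: L2_weak_gradient_def dest: borel_measurable_integrable)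
  have 1: "integrable lborel (\<lambda>x. u x *\<^sub>R D x)"
  proof (rule Bochner_Integration.integrable_bound)
    show "integrable lborel (\<lambda>x. B * u x)" using u by simp
    have "norm (u x *\<^sub>R D x) \<le> norm (B * u x)" for x
    proof -
      have "norm (u x *\<^sub>R D x) \<le> \<bar>u x\<bar> * B" by (simp add: mult_left_mono RB(4))
      also have "\<dots> \<le> norm (B * u x)" by (simp add: abs_mult mult.commute mult_right_mono)
      finally show ?thesis .
    qed
    thus "AE x in lborel. norm (u x *\<^sub>R D x) \<le> norm (B * u x)" by simp
  qed measurable
  have "integrable lborel (\<lambda>x. norm (G x) * \<phi> x)"
    using integrable_cutoff_mult(2)[of \<phi> B R "\<lambda>x. norm (G x)"] RB G by (simp add: L2_weak_gradient_def mult.commute)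
  hence "integrable lborel (\<lambda>x. norm (norm (G x) * \<phi> x))" by (rule integrable_norm)
  hence 2: "integrable lborel (\<lambda>x. \<phi> x *\<^sub>R G x)"
    by (rule Bochner_Integration.integrable_bound) (auto simp: abs_mult)
  have "(LINT x|lborel. u x *\<^sub>R D x) \<bullet> b = - (LINT x|lborel. \<phi> x *\<^sub>R G x) \<bullet> b"
    using G \<phi> by (simp add: L2_weak_gradient_def is_weak_gradient_def)
  moreover have "(LINT x|lborel. u x * (D x \<bullet> b)) = (LINT x|lborel. u x *\<^sub>R D x) \<bullet> b"
    using integral_inner_left[of b lborel "\<lambda>x. u x *\<^sub>R D x"] 1 by simp
  moreover have "(LINT x|lborel. \<phi> x * (G x \<bullet> b)) = (LINT x|lborel. \<phi> x *\<^sub>R G x) \<bullet> b"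
    using integral_inner_left[of b lborel "\<lambda>x. \<phi> x *\<^sub>R G x"] 2 by simp
  ultimately show ?thesis by simp
qed

text \<open>
  Testing with a bump \<open>\<eta>\<close> times plane waves shows that the Fourier transform of \<open>\<eta> G\<close>
  vanishes, and then \<open>\<eta> G = 0\<close> by Plancherel.
\<close>

lemma weak_gradient_zero_on_ball:
  fixes u :: "real^'n \<Rightarrow> real"
  assumes u: "integrable lborel u" and G: "L2_weak_gradient u G" and r: "r > 0"
    and zero: "AE x in lborel. x \<in> ball c r \<longrightarrow> u x = 0"
  shows "AE x in lborel. x \<in> ball c r \<longrightarrow> G x = 0"
proof -
  \<comment> \<open>With t = |x - c|^2 this gives a C1 bump that is positive exactly on the open
    ball.\<close>
  define f where "f t = (max 0 (r\<^sup>2 - t))\<^sup>2" for t :: real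
  define f' where "f' t = 2 * max 0 (r\<^sup>2 - t) * -1" for t :: real
  define \<eta> where "\<eta> x = f ((norm (x - c))\<^sup>2)" for x :: "real^'n"
  have f: "(f has_real_derivative f' t) (at t)" for t
    unfolding f_def f'_def
    by (rule DERIV_chain2[OF DERIV_pos_part_square]) (auto intro!: derivative_eq_intros)
  have f': "continuous_on UNIV f'" unfolding f'_def by (intro continuous_intros)
  have f0: "f t = 0" "f' t = 0" if "t \<ge> r\<^sup>2" for t using that by (auto simp: f_def f'_def)
  have test: "(LINT x|lborel. \<eta> x * g (\<xi> \<bullet> x) * (G x \<bullet> b)) = 0"
    if g: "\<And>t. (g has_real_derivative g' t) (at t)" "continuous_on UNIV g'" for g g' \<xi> b
  proof -
    let ?D = "\<lambda>x. (2 * f' ((norm (x - c))\<^sup>2) * g (\<xi> \<bullet> x)) *\<^sub>R (x - c) + (f ((norm (x - c))\<^sup>2) * g' (\<xi> \<bullet> x)) *\<^sub>R \<xi>"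
    have "C1_test_function (\<lambda>x. f ((norm (x - c))\<^sup>2) * g (\<xi> \<bullet> x)) ?D"
      by (rule C1_test_function_radial_times_wave[where r="r\<^sup>2"]) (use f f' f0 g in auto)
    from weak_gradient_test[OF u G this, where b=b]
    have "(LINT x|lborel. \<eta> x * g (\<xi> \<bullet> x) * (G x \<bullet> b)) = - (LINT x|lborel. u x * (?D x \<bullet> b))"
      by (simp add: \<eta>_def)
    \<comment> \<open>On the ball u is 0 almost everywhere; outside it both f and f' are 0.\<close>
    also have "(LINT x|lborel. u x * (?D x \<bullet> b)) = 0"
    proof (rule integral_eq_zero_AE)
      show "AE x in lborel. u x * (?D x \<bullet> b) = 0"
        using zero
      proof eventually_elim
        case (elim x)
        show ?case
        proof (cases "x \<in> ball c r")
          case False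
          hence "(norm (x - c))\<^sup>2 \<ge> r\<^sup>2"
            using r by (intro power_mono) (auto simp: dist_norm norm_minus_commute)
          thus ?thesis by (simp add: f0)
        qed (use elim in simp)
      qed
    qed
    finally show ?thesis by simp
  qed
  have \<eta>0: "\<eta> x = 0" if "x \<notin> ball c r" for x
  proof -
    have "(norm (x - c))\<^sup>2 \<ge> r\<^sup>2" using r that by (intro power_mono) (auto simp: dist_norm norm_minus_commute)
    thus ?thesis by (simp add: \<eta>_def f0)
  qed
  have \<eta>R: "\<eta> x = 0" if "x \<notin> cball 0 (norm c + r)" for x
  proof (rule \<eta>0)
    show "x \<notin> ball c r"
      using that norm_triangle_ineq2[of x c] by (auto simp: dist_norm norm_minus_commute)
  qed
  have \<eta>B: "\<bar>\<eta> x\<bar> \<le> (r\<^sup>2)\<^sup>2" for x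
    unfolding \<eta>_def f_def abs_power2 by (intro power_mono) auto
  have [measurable]: "\<eta> \<in> borel_measurable borel"
    unfolding \<eta>_def[abs_def] f_def by measurable
  have comp: "AE x in lborel. \<eta> x * (G x \<bullet> b) = 0" for b
  proof -
    let ?v = "\<lambda>x. \<eta> x * (G x \<bullet> b)"
    have v: "integrable lborel (\<lambda>x. (?v x)\<^sup>2)" "integrable lborel ?v"
      by (rule integrable_cutoff_mult[where B="(r\<^sup>2)\<^sup>2" and R="norm c + r"],
          measurable, rule \<eta>B, erule \<eta>R, (rule L2_weak_gradient_component[OF G])+)+
    have "(LINT x|lborel. \<eta> x * cos (\<xi> \<bullet> x) * (G x \<bullet> b)) = 0" "(LINT x|lborel. \<eta> x * sin (\<xi> \<bullet> x) * (G x \<bullet> b)) = 0" for \<xi>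
      by (rule test[where g'="\<lambda>t. - sin t"], auto intro!: derivative_eq_intros continuous_intros)
         (rule test[where g'=cos], auto intro!: derivative_eq_intros continuous_intros)
    hence "power_spectrum ?v = (\<lambda>_. 0)"
      by (auto simp: power_spectrum_def fun_eq_iff mult_ac)
    hence "(2 * pi) ^ DIM(real^'n) * (LINT x|lborel. (?v x)\<^sup>2) = 0"
      using has_bochner_integral_power_spectrum[OF v(2,1)] by (auto simp: has_bochner_integral_iff)
    hence "(LINT x|lborel. (?v x)\<^sup>2) = 0" by simp
    hence "AE x in lborel. (?v x)\<^sup>2 = 0"
      by (subst (asm) integral_nonneg_eq_0_iff_AE[OF v(1)]) auto
    thus ?thesis by simp
  qed
  have "AE x in lborel. \<forall>b\<in>Basis. \<eta> x * (G x \<bullet> b) = 0"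
    by (rule AE_finite_allI) (use comp in auto)
  thus ?thesis
  proof eventually_elim
    case (elim x)
    show ?case
    proof
      assume "x \<in> ball c r"
      hence "(norm (x - c))\<^sup>2 < r\<^sup>2" by (intro power_strict_mono) (auto simp: dist_norm norm_minus_commute)
      hence "\<eta> x \<noteq> 0" by (simp add: \<eta>_def f_def)
      thus "G x = 0" using elim by (intro euclidean_eqI[of _ 0]) auto
    qed
  qed
qed

text \<open>The exterior of \<Omega> is a union of balls that miss \<Omega>. Each ball brings its
  own exceptional null set, so Lindelof's theorem is used to keep only countably many. What remains
  is the frontier, a null set.\<close>

lemma weak_gradient_zero_outside:
  fixes u :: "real^'n \<Rightarrow> real"
  assumes \<Omega>: "bounded_C1_domain \<Omega>" and u: "integrable lborel u" and G: "L2_weak_gradient u G"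
    and supp: "AE x in lborel. x \<notin> \<Omega> \<longrightarrow> u x = 0"
  shows "AE x in lborel. x \<notin> \<Omega> \<longrightarrow> G x = 0"
proof -
  define F where "F = {ball c r | c r. r > 0 \<and> ball c r \<inter> \<Omega> = {}}"
  have op: "open B" if "B \<in> F" for B using that by (auto simp: F_def)
  obtain F' where F': "F' \<subseteq> F" "countable F'" "\<Union>F' = \<Union>F"
    by (rule Lindelof[of F, OF op])
  have "AE x in lborel. \<forall>B\<in>F'. x \<in> B \<longrightarrow> G x = 0"
    unfolding AE_ball_countable[OF F'(2)]
  proof
    fix B assume "B \<in> F'"
    then obtain c r where B: "B = ball c r" "r > 0" "ball c r \<inter> \<Omega> = {}" using F'(1) by (auto simp: F_def)
    have "AE x in lborel. x \<in> ball c r \<longrightarrow> u x = 0" using supp B(3) by (auto elim!: eventually_mono)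
    from weak_gradient_zero_on_ball[OF u G B(2) this] show "AE x in lborel. x \<in> B \<longrightarrow> G x = 0" by (simp add: B)
  qed
  moreover have "AE x in lborel. x \<notin> frontier \<Omega>"
    using frontier_null_C1_boundary[of \<Omega>] \<Omega> by (intro AE_not_in) (auto simp: bounded_C1_domain_def)
  ultimately show ?thesis
  proof eventually_elim
    case (elim x)
    show ?case
    proof
      assume "x \<notin> \<Omega>"
      hence "x \<notin> closure \<Omega>" using elim(2) \<Omega> by (auto simp: frontier_def bounded_C1_domain_def interior_open)
      then obtain r where r: "r > 0" "ball x r \<subseteq> - closure \<Omega>"
        by (meson ComplI open_Compl closed_closure open_contains_ball)
      hence "ball x r \<inter> \<Omega> = {}" using closure_subset[of \<Omega>] by blast
      hence "ball x r \<in> F" using r by (auto simp: F_def)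
      hence "x \<in> \<Union>F'" using F'(3) r by (auto intro!: bexI[of _ "ball x r"])
      thus "G x = 0" using elim(1) by auto
    qed
  qed
qed

text \<open>A plane wave has no compact support, so it is multiplied by a plateau equal to 1 on
  \<Omega>. As u and G vanish almost everywhere outside \<Omega>, the plateau disappears from both
  integrals, and differentiating the wave brings out \<xi> \<bullet> b. The sign and the exchange of
  cosine and sine are lost in the sum of squares.\<close>

lemma
  fixes u :: "real^'n \<Rightarrow> real"
  assumes \<Omega>: "bounded_C1_domain \<Omega>" and u: "integrable lborel u" and G: "L2_weak_gradient u G"
    and supp: "AE x in lborel. x \<notin> \<Omega> \<longrightarrow> u x = 0"
  shows integrable_weak_gradient_component: "integrable lborel (\<lambda>x. G x \<bullet> b)"
    and power_spectrum_weak_gradient: "power_spectrum (\<lambda>x. G x \<bullet> b) \<xi> = (\<xi> \<bullet> b)\<^sup>2 * power_spectrum u \<xi>"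
proof -
  note G0 = weak_gradient_zero_outside[OF \<Omega> u G supp]
  have b\<Omega>: "bounded \<Omega>" using \<Omega> by (simp add: bounded_C1_domain_def)
  show "integrable lborel (\<lambda>x. G x \<bullet> b)"
    by (rule integrable_of_square_integrable_bounded_support[OF L2_weak_gradient_component[OF G] b\<Omega>])
       (use G0 in \<open>auto elim!: eventually_mono\<close>)
  obtain R where R: "\<forall>x\<in>\<Omega>. norm x \<le> R" using b\<Omega> by (auto simp: bounded_iff)
  obtain f f' where f: "\<And>t. (f has_real_derivative f' t) (at t)" "continuous_on UNIV f'"
    "\<And>t. t \<ge> R\<^sup>2 + 1 \<Longrightarrow> f t = 0" "\<And>t. t \<le> R\<^sup>2 \<Longrightarrow> f t = 1" "\<And>t. t \<le> R\<^sup>2 \<Longrightarrow> f' t = 0"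
    using C1_plateau_exists[of "R\<^sup>2"] by blast
  have on: "(norm x)\<^sup>2 \<le> R\<^sup>2" if "x \<in> \<Omega>" for x using R that by (intro power_mono) auto
  have test: "(LINT x|lborel. (G x \<bullet> b) * g (\<xi> \<bullet> x)) = - ((\<xi> \<bullet> b) * (LINT x|lborel. u x * g' (\<xi> \<bullet> x)))"
    if g: "\<And>t. (g has_real_derivative g' t) (at t)" "continuous_on UNIV g'" "continuous_on UNIV g" for g g'
  proof -
    let ?D = "\<lambda>x. (2 * f' ((norm (x - 0))\<^sup>2) * g (\<xi> \<bullet> x)) *\<^sub>R (x - 0) + (f ((norm (x - 0))\<^sup>2) * g' (\<xi> \<bullet> x)) *\<^sub>R \<xi>"
    let ?\<phi> = "\<lambda>x. f ((norm (x - 0))\<^sup>2) * g (\<xi> \<bullet> x)"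
    have \<phi>: "C1_test_function ?\<phi> ?D"
      by (rule C1_test_function_radial_times_wave[OF f(1,2) g(1,2) f(3)])
    have RB: "continuous_on UNIV ?\<phi>" "continuous_on UNIV ?D"
      by (rule C1_test_function_bounds[OF \<phi>], assumption)+
    have [measurable]: "g \<in> borel_measurable borel" "g' \<in> borel_measurable borel" "?\<phi> \<in> borel_measurable borel" "?D \<in> borel_measurable borel"
      by (rule borel_measurable_continuous_onI; fact)+
    have [measurable]: "G \<in> borel_measurable borel" "u \<in> borel_measurable borel"
      using G u by (auto simp: L2_weak_gradient_def dest: borel_measurable_integrable)
    have "(LINT x|lborel. (G x \<bullet> b) * g (\<xi> \<bullet> x)) = (LINT x|lborel. ?\<phi> x * (G x \<bullet> b))"
    proof (rule integral_cong_AE)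
      show "AE x in lborel. (G x \<bullet> b) * g (\<xi> \<bullet> x) = ?\<phi> x * (G x \<bullet> b)"
        using G0
      proof eventually_elim
        case (elim x)
        show ?case
        proof (cases "x \<in> \<Omega>")
          case True
          thus ?thesis using f(4)[OF on[OF True]] by simp
        qed (use elim in simp)
      qed
    qed measurable
    also have "\<dots> = - (LINT x|lborel. u x * (?D x \<bullet> b))"
      using weak_gradient_test[OF u G \<phi>, where b=b] by linarith
    also have "(LINT x|lborel. u x * (?D x \<bullet> b)) = (LINT x|lborel. (\<xi> \<bullet> b) * (u x * g' (\<xi> \<bullet> x)))"
    proof (rule integral_cong_AE)
      show "AE x in lborel. u x * (?D x \<bullet> b) = (\<xi> \<bullet> b) * (u x * g' (\<xi> \<bullet> x))"
        using supp
      proof eventually_elim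
        case (elim x)
        show ?case
        proof (cases "x \<in> \<Omega>")
          case True
          thus ?thesis using f(4,5)[OF on[OF True]] by simp
        qed (use elim in simp)
      qed
    qed measurable
    finally show ?thesis by simp
  qed
  have 1: "(LINT x|lborel. (G x \<bullet> b) * cos (\<xi> \<bullet> x)) = - ((\<xi> \<bullet> b) * (LINT x|lborel. u x * - sin (\<xi> \<bullet> x)))"
    by (rule test[where g=cos and g'="\<lambda>t. - sin t"]) (auto intro!: derivative_eq_intros continuous_intros)
  have 2: "(LINT x|lborel. (G x \<bullet> b) * sin (\<xi> \<bullet> x)) = - ((\<xi> \<bullet> b) * (LINT x|lborel. u x * cos (\<xi> \<bullet> x)))"
    by (rule test[where g=sin and g'=cos]) (auto intro!: derivative_eq_intros continuous_intros)
  show "power_spectrum (\<lambda>x. G x \<bullet> b) \<xi> = (\<xi> \<bullet> b)\<^sup>2 * power_spectrum u \<xi>"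
    unfolding power_spectrum_def 1 2 by (simp add: power_mult_distrib algebra_simps)
qed

text \<open>Plancherel for each component of G; the factors (\<xi> \<bullet> b)^2 add up to
  |\<xi>|^2. The energy may be restricted to \<Omega> because G vanishes almost everywhere outside
  it.\<close>

lemma has_bochner_integral_gradient_spectrum:
  fixes u :: "real^'n \<Rightarrow> real"
  assumes \<Omega>: "bounded_C1_domain \<Omega>" and u: "integrable lborel u" and G: "L2_weak_gradient u G"
    and supp: "AE x in lborel. x \<notin> \<Omega> \<longrightarrow> u x = 0"
  shows "has_bochner_integral lborel (\<lambda>\<xi>. (norm \<xi>)\<^sup>2 * power_spectrum u \<xi>)
     ((2 * pi) ^ CARD('n) * (LINT x:\<Omega>|lborel. (norm (G x))\<^sup>2))"
proof -
  have norm_sum: "(norm z)\<^sup>2 = (\<Sum>b\<in>Basis. (z \<bullet> b)\<^sup>2)" for z :: "real^'n"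
    unfolding power2_norm_eq_inner by (subst euclidean_inner) (simp add: power2_eq_square)
  note c = L2_weak_gradient_component[OF G] integrable_weak_gradient_component[OF \<Omega> u G supp]
  have [measurable]: "G \<in> borel_measurable borel" using G by (simp add: L2_weak_gradient_def)
  have [measurable]: "\<Omega> \<in> sets borel" using \<Omega> by (simp add: bounded_C1_domain_def)
  have "has_bochner_integral lborel (\<lambda>\<xi>. \<Sum>b\<in>(Basis :: (real^'n) set). power_spectrum (\<lambda>x. G x \<bullet> b) \<xi>)
     (\<Sum>b\<in>(Basis :: (real^'n) set). (2 * pi) ^ DIM(real^'n) * (LINT x|lborel. (G x \<bullet> b)\<^sup>2))"
    by (intro has_bochner_integral_sum has_bochner_integral_power_spectrum c)
  also have "(\<lambda>\<xi>. \<Sum>b\<in>(Basis :: (real^'n) set). power_spectrum (\<lambda>x. G x \<bullet> b) \<xi>) = (\<lambda>\<xi>. (norm \<xi>)\<^sup>2 * power_spectrum u \<xi>)"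
    by (simp add: power_spectrum_weak_gradient[OF \<Omega> u G supp] norm_sum sum_distrib_right)
  also have "(\<Sum>b\<in>(Basis :: (real^'n) set). (2 * pi) ^ DIM(real^'n) * (LINT x|lborel. (G x \<bullet> b)\<^sup>2))
     = (2 * pi) ^ CARD('n) * (LINT x|lborel. (norm (G x))\<^sup>2)"
    unfolding norm_sum by (subst Bochner_Integration.integral_sum) (auto simp: c sum_distrib_left)
  also have "(LINT x|lborel. (norm (G x))\<^sup>2) = (LINT x:\<Omega>|lborel. (norm (G x))\<^sup>2)"
    unfolding set_lebesgue_integral_def
  proof (rule integral_cong_AE)
    show "AE x in lborel. (norm (G x))\<^sup>2 = indicat_real \<Omega> x *\<^sub>R (norm (G x))\<^sup>2"
      using weak_gradient_zero_outside[OF \<Omega> u G supp]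
      by eventually_elim (auto simp: indicator_def)
  qed measurable
  finally show ?thesis .
qed

subsection \<open>Bathtub principle and Bessel's inequality\<close>

text \<open>Layer-cake integration: the positive part is the length of the interval of levels \<tau>
  between |\<xi>|^\<alpha> and A, and for a fixed level the points with |\<xi>|^\<alpha> < \<tau>
  form a ball of radius \<tau> powr (1 / \<alpha>).\<close>

lemma nn_integral_powr_hat:
  fixes A \<alpha> :: real
  assumes \<alpha>: "\<alpha> > 0" and A: "A \<ge> 0"
  shows "(\<integral>\<^sup>+\<xi>. ennreal (max 0 (A - norm (\<xi>::'a::euclidean_space) powr \<alpha>)) \<partial>lborel)
    = ennreal (unit_ball_vol DIM('a) * (A powr (DIM('a) / \<alpha> + 1) / (DIM('a) / \<alpha> + 1)))"
proof -
  let ?w = "unit_ball_vol (real DIM('a))"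
  let ?I = "\<lambda>\<xi>::'a. \<lambda>\<tau>::real. if norm \<xi> powr \<alpha> < \<tau> \<and> \<tau> < A then 1 else 0 :: ennreal"
  have "(\<integral>\<^sup>+\<xi>. ennreal (max 0 (A - norm (\<xi>::'a) powr \<alpha>)) \<partial>lborel) = (\<integral>\<^sup>+\<xi>. \<integral>\<^sup>+\<tau>. ?I \<xi> \<tau> \<partial>lborel \<partial>lborel)"
  proof (rule nn_integral_cong)
    fix \<xi> :: 'a
    have "(\<integral>\<^sup>+\<tau>. ?I \<xi> \<tau> \<partial>lborel) = (\<integral>\<^sup>+\<tau>. indicator {norm \<xi> powr \<alpha><..<A} \<tau> \<partial>lborel)"
      by (intro nn_integral_cong) (auto simp: indicator_def)
    also have "\<dots> = emeasure lborel {norm \<xi> powr \<alpha><..<A}" by simp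
    also have "\<dots> = ennreal (max 0 (A - norm \<xi> powr \<alpha>))"
      by (cases "norm \<xi> powr \<alpha> \<le> A") auto
    finally show "ennreal (max 0 (A - norm \<xi> powr \<alpha>)) = (\<integral>\<^sup>+\<tau>. ?I \<xi> \<tau> \<partial>lborel)" ..
  qed
  also have "\<dots> = (\<integral>\<^sup>+\<tau>. \<integral>\<^sup>+\<xi>. ?I \<xi> \<tau> \<partial>lborel \<partial>lborel)"
    by (rule lborel_pair.Fubini'[symmetric]) measurable
  also have "\<dots> = (\<integral>\<^sup>+\<tau>. ennreal ?w * ennreal (indicator {0..A} \<tau> * \<tau> powr (DIM('a) / \<alpha>)) \<partial>lborel)"
  proof (rule nn_integral_cong_AE)
    \<comment> \<open>At \<tau> = A the strict condition on the left and the closed interval on the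
      right may disagree.\<close>
    have "AE \<tau> in lborel. \<tau> \<noteq> A" by (rule AE_lborel_singleton)
    thus "AE \<tau> in lborel. (\<integral>\<^sup>+\<xi>. ?I \<xi> \<tau> \<partial>lborel) = ennreal ?w * ennreal (indicator {0..A} \<tau> * \<tau> powr (DIM('a) / \<alpha>))"
    proof eventually_elim
      case (elim \<tau>)
      show ?case
      proof (cases "0 < \<tau> \<and> \<tau> < A")
        case True
        have iff: "norm \<xi> powr \<alpha> < \<tau> \<longleftrightarrow> \<xi> \<in> ball 0 (\<tau> powr (1 / \<alpha>))" for \<xi> :: 'a
        proof -
          have "\<tau> = (\<tau> powr (1 / \<alpha>)) powr \<alpha>" using True \<alpha> by (simp add: powr_powr)
          hence "norm \<xi> powr \<alpha> < \<tau> \<longleftrightarrow> norm \<xi> powr \<alpha> < (\<tau> powr (1 / \<alpha>)) powr \<alpha>" by simp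
          also have "\<dots> \<longleftrightarrow> norm \<xi> < \<tau> powr (1 / \<alpha>)"
            using \<alpha> powr_less_mono2[of \<alpha> "norm \<xi>" "\<tau> powr (1 / \<alpha>)"] powr_mono2[of \<alpha> "\<tau> powr (1 / \<alpha>)" "norm \<xi>"]
            by (auto simp: not_less[symmetric])
          finally show ?thesis by simp
        qed
        have "(\<integral>\<^sup>+\<xi>. ?I \<xi> \<tau> \<partial>lborel) = (\<integral>\<^sup>+\<xi>. indicator (ball (0::'a) (\<tau> powr (1 / \<alpha>))) \<xi> \<partial>lborel)"
          using True unfolding iff by (intro nn_integral_cong) (auto simp: indicator_def)
        also have "\<dots> = emeasure lborel (ball (0::'a) (\<tau> powr (1 / \<alpha>)))" by simp
        also have "\<dots> = ennreal (?w * (\<tau> powr (1 / \<alpha>)) ^ DIM('a))"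
          by (rule emeasure_ball) simp
        also have "(\<tau> powr (1 / \<alpha>)) ^ DIM('a) = \<tau> powr (DIM('a) / \<alpha>)"
          using True by (simp add: powr_powr flip: powr_realpow)
        finally show ?thesis using True by (simp add: ennreal_mult')
      next
        case False
        have "?I \<xi> \<tau> = 0" for \<xi> :: 'a
          using False by (auto simp: not_less intro: order_trans[OF _ powr_ge_zero] dest: le_less_trans[OF powr_ge_zero])
        hence "(\<integral>\<^sup>+\<xi>. ?I \<xi> \<tau> \<partial>lborel) = 0" by simp
        moreover have "indicator {0..A} \<tau> * \<tau> powr (DIM('a) / \<alpha>) = 0"
          using False elim by (cases "\<tau> = 0") (auto simp: indicator_def)
        ultimately show ?thesis by simp
      qed
    qed
  qed
  also have "\<dots> = ennreal ?w * (\<integral>\<^sup>+\<tau>. ennreal (indicator {0..A} \<tau> * \<tau> powr (DIM('a) / \<alpha>)) \<partial>lborel)"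
    by (rule nn_integral_cmult) measurable
  also have "(\<integral>\<^sup>+\<tau>. ennreal (indicator {0..A} \<tau> * \<tau> powr (DIM('a) / \<alpha>)) \<partial>lborel) = ennreal (A powr (DIM('a) / \<alpha> + 1) / (DIM('a) / \<alpha> + 1))"
  proof (rule nn_integral_has_integral_lebesgue)
    have "real DIM('a) / \<alpha> > 0" using \<alpha> by simp
    thus "((\<lambda>\<tau>. \<tau> powr (DIM('a) / \<alpha>)) has_integral A powr (DIM('a) / \<alpha> + 1) / (DIM('a) / \<alpha> + 1)) {0..A}"
      by (intro has_integral_powr_from_0 A) linarith
  qed auto
  also have "ennreal ?w * ennreal (A powr (DIM('a) / \<alpha> + 1) / (DIM('a) / \<alpha> + 1))
    = ennreal (?w * (A powr (DIM('a) / \<alpha> + 1) / (DIM('a) / \<alpha> + 1)))"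
    by (rule ennreal_mult'[symmetric]) simp
  finally show ?thesis .
qed

text \<open>A duality argument: with h the positive part of A - |\<xi>|^\<alpha>, the constraint F
  <= M gives A F - M h <= |\<xi>|^\<alpha> F pointwise, and both sides are integrated. Equality
  holds for F equal to M where h > 0 and to 0 elsewhere.\<close>

lemma bathtub:
  fixes F :: "'a::euclidean_space \<Rightarrow> real" and \<alpha> M m :: real
  assumes \<alpha>: "\<alpha> > 0" and M: "M > 0" and F: "\<And>\<xi>. 0 \<le> F \<xi>" "\<And>\<xi>. F \<xi> \<le> M"
    and int: "integrable lborel F" "integrable lborel (\<lambda>\<xi>. norm \<xi> powr \<alpha> * F \<xi>)"
    and m: "integral\<^sup>L lborel F = m" "m > 0"
  shows "(LINT \<xi>|lborel. norm \<xi> powr \<alpha> * F \<xi>)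
     \<ge> DIM('a) / (DIM('a) + \<alpha>) * m * (m / (M * unit_ball_vol DIM('a))) powr (\<alpha> / DIM('a))"
proof -
  let ?d = "real DIM('a)"
  define w where "w = unit_ball_vol ?d"
  have w: "w > 0" by (simp add: w_def)
  \<comment> \<open>The multiplier is the value of |\<xi>|^\<alpha> on the boundary of the optimal
    ball: M * w * A powr (d / \<alpha>) = m says that this ball, filled to height M, has mass
    m.\<close>
  define A where "A = (m / (M * w)) powr (\<alpha> / ?d)"
  have A: "A > 0" using m M w by (simp add: A_def)
  define h where "h \<xi> = max 0 (A - norm \<xi> powr \<alpha>)" for \<xi> :: 'a
  define I where "I = w * (A powr (?d / \<alpha> + 1) / (?d / \<alpha> + 1))"
  have "has_bochner_integral lborel h I"
    using nn_integral_powr_hat[OF \<alpha> less_imp_le[OF A], where 'a='a] w \<alpha>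
    by (intro has_bochner_integral_nn_integral) (auto simp: h_def[abs_def] I_def w_def intro!: mult_nonneg_nonneg divide_nonneg_pos add_nonneg_pos)
  hence h: "integrable lborel h" "integral\<^sup>L lborel h = I" by (auto simp: has_bochner_integral_iff)
  have "(LINT \<xi>|lborel. A * F \<xi> - M * h \<xi>) \<le> (LINT \<xi>|lborel. norm \<xi> powr \<alpha> * F \<xi>)"
  proof (intro integral_mono int Bochner_Integration.integrable_diff integrable_mult_right h)
    fix \<xi> :: 'a
    have "(A - norm \<xi> powr \<alpha>) * F \<xi> \<le> h \<xi> * F \<xi>" by (intro mult_right_mono F) (simp add: h_def)
    also have "\<dots> \<le> h \<xi> * M" by (intro mult_left_mono F) (simp add: h_def)
    finally show "A * F \<xi> - M * h \<xi> \<le> norm \<xi> powr \<alpha> * F \<xi>" by (simp add: algebra_simps)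
  qed
  also have "(LINT \<xi>|lborel. A * F \<xi> - M * h \<xi>) = A * m - M * I"
    using int h m by (subst Bochner_Integration.integral_diff) auto
  also have "M * I = A * m * (\<alpha> / (?d + \<alpha>))"
  proof -
    have "A powr (?d / \<alpha>) = m / (M * w)"
      using m M w \<alpha> by (simp add: A_def powr_powr)
    hence "A powr (?d / \<alpha> + 1) = m / (M * w) * A" using A by (simp add: powr_add)
    moreover have "?d / \<alpha> + 1 = (?d + \<alpha>) / \<alpha>" using \<alpha> by (simp add: field_simps)
    ultimately show ?thesis using M w by (simp add: I_def)
  qed
  also have "A * m - A * m * (\<alpha> / (?d + \<alpha>)) = ?d / (?d + \<alpha>) * m * A"
  proof -
    have "?d + \<alpha> > 0" using \<alpha> by (simp add: add_nonneg_pos)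
    thus ?thesis by (simp add: field_simps)
  qed
  finally show ?thesis by (simp add: A_def w_def)
qed

text \<open>The squared L2 distance from h to its projection onto the span of the \<open>u j\<close>
  is nonnegative.\<close>

lemma bessel_inequality:
  fixes u :: "'i \<Rightarrow> 'a \<Rightarrow> real"
  assumes J: "finite J" and h: "integrable M (\<lambda>x. (h x)\<^sup>2)"
    and hu: "\<And>j. j \<in> J \<Longrightarrow> integrable M (\<lambda>x. u j x * h x)"
    and uu: "\<And>i j. i \<in> J \<Longrightarrow> j \<in> J \<Longrightarrow> integrable M (\<lambda>x. u i x * u j x)"
    and orth: "\<And>i j. i \<in> J \<Longrightarrow> j \<in> J \<Longrightarrow> (LINT x|M. u i x * u j x) = (if i = j then 1 else 0)"
  shows "(\<Sum>j\<in>J. (LINT x|M. u j x * h x)\<^sup>2) \<le> (LINT x|M. (h x)\<^sup>2)"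
proof -
  define c where "c j = (LINT x|M. u j x * h x)" for j
  have eq: "(h x - (\<Sum>j\<in>J. c j * u j x))\<^sup>2 =
     (h x)\<^sup>2 - 2 * (\<Sum>j\<in>J. c j * (u j x * h x)) + (\<Sum>i\<in>J. \<Sum>j\<in>J. c i * c j * (u i x * u j x))" for x
  proof -
    have "(\<Sum>j\<in>J. c j * u j x) * (\<Sum>j\<in>J. c j * u j x) = (\<Sum>i\<in>J. \<Sum>j\<in>J. c i * c j * (u i x * u j x))"
      unfolding sum_product by (intro sum.cong) (auto simp: mult_ac)
    moreover have "(\<Sum>j\<in>J. c j * (u j x * h x)) = (\<Sum>j\<in>J. c j * u j x) * h x"
      by (simp add: sum_distrib_right mult.assoc)
    ultimately show ?thesis by (simp add: power2_eq_square algebra_simps)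
  qed
  have "0 \<le> (LINT x|M. (h x - (\<Sum>j\<in>J. c j * u j x))\<^sup>2)"
    by (rule integral_nonneg_AE) auto
  also have "\<dots> = (LINT x|M. (h x)\<^sup>2) - 2 * (\<Sum>j\<in>J. c j * c j) + (\<Sum>i\<in>J. \<Sum>j\<in>J. c i * c j * (if i = j then 1 else 0))"
  proof -
    have "has_bochner_integral M (\<lambda>x. (h x)\<^sup>2 - 2 * (\<Sum>j\<in>J. c j * (u j x * h x)) + (\<Sum>i\<in>J. \<Sum>j\<in>J. c i * c j * (u i x * u j x)))
      ((LINT x|M. (h x)\<^sup>2) - 2 * (\<Sum>j\<in>J. c j * c j) + (\<Sum>i\<in>J. \<Sum>j\<in>J. c i * c j * (if i = j then 1 else 0)))"
      by (intro has_bochner_integral_add has_bochner_integral_diff has_bochner_integral_mult_right has_bochner_integral_sum)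
         (auto simp: has_bochner_integral_iff h hu uu orth c_def)
    thus ?thesis unfolding eq by (rule has_bochner_integral_integral_eq)
  qed
  also have "(\<Sum>i\<in>J. \<Sum>j\<in>J. c i * c j * (if i = j then 1 else 0)) = (\<Sum>j\<in>J. c j * c j)"
  proof (rule sum.cong[OF refl])
    fix i assume "i \<in> J"
    have "(\<Sum>j\<in>J. c i * c j * (if i = j then 1 else 0)) = (\<Sum>j\<in>J. if i = j then c i * c j else 0)"
      by (intro sum.cong) auto
    thus "(\<Sum>j\<in>J. c i * c j * (if i = j then 1 else 0)) = c i * c i"
      using J \<open>i \<in> J\<close> by simp
  qed
  finally show ?thesis by (simp add: c_def power2_eq_square)
qed

text \<open>Bessel's inequality is applied to cosine and sine cut off outside \<Omega>. The cut
  makes them square integrable and leaves the coefficients unchanged, since each \<open>u j\<close>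
  vanishes there; the two squares add up to the indicator of \<Omega>.\<close>

lemma sum_power_spectrum_le:
  fixes u :: "'i \<Rightarrow> 'a::euclidean_space \<Rightarrow> real"
  assumes J: "finite J" and \<Omega>: "\<Omega> \<in> sets borel" "emeasure lborel \<Omega> < \<infinity>"
    and u: "\<And>j. j \<in> J \<Longrightarrow> integrable lborel (u j)" and u2: "\<And>j. j \<in> J \<Longrightarrow> integrable lborel (\<lambda>x. (u j x)\<^sup>2)"
    and supp: "\<And>j. j \<in> J \<Longrightarrow> AE x in lborel. x \<notin> \<Omega> \<longrightarrow> u j x = 0"
    and orth: "\<And>i j. i \<in> J \<Longrightarrow> j \<in> J \<Longrightarrow> (LINT x:\<Omega>|lborel. u i x * u j x) = (if i = j then 1 else 0)"
  shows "(\<Sum>j\<in>J. power_spectrum (u j) \<xi>) \<le> measure lborel \<Omega>"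
proof -
  note [measurable] = \<Omega>(1)
  have um: "u j \<in> borel_measurable borel" if "j \<in> J" for j
    using u[OF that] by (auto dest: borel_measurable_integrable)
  have uu: "integrable lborel (\<lambda>x. u i x * u j x)" if "i \<in> J" "j \<in> J" for i j
  proof (rule Bochner_Integration.integrable_bound)
    show "integrable lborel (\<lambda>x. (u i x)\<^sup>2 + (u j x)\<^sup>2)" using u2 that by auto
    show "(\<lambda>x. u i x * u j x) \<in> borel_measurable lborel" using um[OF that(1)] um[OF that(2)] by measurable
    have "\<bar>a * b\<bar> \<le> a\<^sup>2 + b\<^sup>2" for a b :: real
    proof -
      have "2 * (\<bar>a\<bar> * \<bar>b\<bar>) \<le> a\<^sup>2 + b\<^sup>2" using sum_squares_bound[of "\<bar>a\<bar>" "\<bar>b\<bar>"] by (simp add: mult.assoc)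
      moreover have "0 \<le> \<bar>a\<bar> * \<bar>b\<bar>" by simp
      ultimately show ?thesis unfolding abs_mult by linarith
    qed
    thus "AE x in lborel. norm (u i x * u j x) \<le> norm ((u i x)\<^sup>2 + (u j x)\<^sup>2)" by simp
  qed
  have orth': "(LINT x|lborel. u i x * u j x) = (if i = j then 1 else 0)" if "i \<in> J" "j \<in> J" for i j
  proof -
    note [measurable] = um[OF that(1)] um[OF that(2)]
    have "(LINT x|lborel. u i x * u j x) = (LINT x:\<Omega>|lborel. u i x * u j x)"
      unfolding set_lebesgue_integral_def
    proof (rule integral_cong_AE)
      show "AE x in lborel. u i x * u j x = indicat_real \<Omega> x *\<^sub>R (u i x * u j x)"
        using supp[OF that(1)] by eventually_elim (auto simp: indicator_def)
    qed measurable
    thus ?thesis using orth[OF that] by simp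
  qed
  have B: "(\<Sum>j\<in>J. (LINT x|lborel. u j x * g (\<xi> \<bullet> x))\<^sup>2) \<le> (LINT x|lborel. (indicator \<Omega> x * g (\<xi> \<bullet> x))\<^sup>2)"
    "integrable lborel (\<lambda>x. (indicator \<Omega> x * g (\<xi> \<bullet> x))\<^sup>2)"
    if [measurable]: "g \<in> borel_measurable borel" and g1: "\<And>t. \<bar>g t\<bar> \<le> 1" for g :: "real \<Rightarrow> real"
  proof -
    let ?h = "\<lambda>x. indicat_real \<Omega> x * g (\<xi> \<bullet> x)"
    have hb: "\<bar>?h x\<bar> \<le> 1" for x using g1[of "\<xi> \<bullet> x"] by (auto simp: indicator_def)
    have "integrable lborel (\<lambda>x. indicat_real \<Omega> x * (g (\<xi> \<bullet> x))\<^sup>2)"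
      using \<Omega> g1 by (intro integrable_mult_bounded[where B=1]) (auto simp: abs_square_le_1)
    also have "(\<lambda>x. indicat_real \<Omega> x * (g (\<xi> \<bullet> x))\<^sup>2) = (\<lambda>x. (?h x)\<^sup>2)"
      by (auto simp: indicator_def)
    finally show h2: "integrable lborel (\<lambda>x. (?h x)\<^sup>2)" .
    have "(\<Sum>j\<in>J. (LINT x|lborel. u j x * g (\<xi> \<bullet> x))\<^sup>2) = (\<Sum>j\<in>J. (LINT x|lborel. u j x * ?h x)\<^sup>2)"
    proof (intro sum.cong refl arg_cong[where f="\<lambda>x. x\<^sup>2"] integral_cong_AE)
      fix j assume j: "j \<in> J"
      note [measurable] = um[OF j]
      show "(\<lambda>x. u j x * g (\<xi> \<bullet> x)) \<in> borel_measurable lborel" "(\<lambda>x. u j x * ?h x) \<in> borel_measurable lborel"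
        by measurable
      show "AE x in lborel. u j x * g (\<xi> \<bullet> x) = u j x * ?h x"
        using supp[OF j] by eventually_elim (auto simp: indicator_def)
    qed
    also have "\<dots> \<le> (LINT x|lborel. (?h x)\<^sup>2)"
      by (intro bessel_inequality J h2 uu orth' integrable_mult_bounded[where B=1] u hb) (auto intro!: borel_measurable_times)
    finally show "(\<Sum>j\<in>J. (LINT x|lborel. u j x * g (\<xi> \<bullet> x))\<^sup>2) \<le> (LINT x|lborel. (?h x)\<^sup>2)" .
  qed
  have c: "\<And>t::real. \<bar>cos t\<bar> \<le> 1" "\<And>t::real. \<bar>sin t\<bar> \<le> 1" by (auto simp: abs_le_iff)
  have "(\<Sum>j\<in>J. power_spectrum (u j) \<xi>) \<le> (LINT x|lborel. (indicator \<Omega> x * cos (\<xi> \<bullet> x))\<^sup>2) + (LINT x|lborel. (indicator \<Omega> x * sin (\<xi> \<bullet> x))\<^sup>2)"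
    unfolding power_spectrum_def sum.distrib by (intro add_mono B c) auto
  also have "\<dots> = (LINT x|lborel. (indicator \<Omega> x * cos (\<xi> \<bullet> x))\<^sup>2 + (indicator \<Omega> x * sin (\<xi> \<bullet> x))\<^sup>2)"
    by (rule Bochner_Integration.integral_add[symmetric]; rule B(2); use c in simp)
  also have "\<dots> = (LINT x|lborel. indicat_real \<Omega> x)"
    by (intro Bochner_Integration.integral_cong) (auto simp: indicator_def)
  also have "\<dots> = measure lborel \<Omega>" by simp
  finally show ?thesis .
qed

subsection \<open>Lower bounds for eigenvalues\<close>

lemma X_spaceD:
  fixes u :: "real^'n \<Rightarrow> real"
  assumes \<Omega>: "bounded \<Omega>" and u: "u \<in> X_space \<Omega>"
  shows "integrable lborel u" "integrable lborel (\<lambda>x. (u x)\<^sup>2)" "L2_weak_gradient u (weak_grad u)"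
    "AE x in lborel. x \<notin> \<Omega> \<longrightarrow> u x = 0"
proof -
  have m: "u \<in> borel_measurable borel" and ex: "\<exists>G. L2_weak_gradient u G"
    and u2: "integrable lborel (\<lambda>x. (u x)\<^sup>2)" and supp: "AE x in lborel. x \<notin> \<Omega> \<longrightarrow> u x = 0"
    using u by (auto simp: X_space_def H1_def)
  show "integrable lborel u"
    by (rule integrable_of_square_integrable_bounded_support[OF m u2 \<Omega> supp])
  show "L2_weak_gradient u (weak_grad u)" unfolding weak_grad_def using ex by (rule someI_ex)
  show "integrable lborel (\<lambda>x. (u x)\<^sup>2)" "AE x in lborel. x \<notin> \<Omega> \<longrightarrow> u x = 0" by fact+
qed

lemma integral_gradient_spectrum:
  fixes u :: "real^'n \<Rightarrow> real"
  assumes \<Omega>: "bounded_C1_domain \<Omega>" and u: "u \<in> X_space \<Omega>"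
  shows "(LINT \<xi>|lborel. norm \<xi> powr 2 * power_spectrum u \<xi>) =
       (2 * pi) ^ CARD('n) * (LINT x:\<Omega>|lborel. (norm (weak_grad u x))\<^sup>2)"
proof -
  have "bounded \<Omega>" using \<Omega> by (simp add: bounded_C1_domain_def)
  note D = X_spaceD[OF this u]
  show ?thesis
    using has_bochner_integral_gradient_spectrum[OF \<Omega> D(1,3,4)] by (simp add: has_bochner_integral_iff)
qed

text \<open>For exponents between 0 and 2 one has |\<xi>|^\<alpha> <= 1 + |\<xi>|^2, so the moments
  of order 0 and 2 control this one.\<close>

lemma integrable_powr_spectrum:
  fixes u :: "real^'n \<Rightarrow> real"
  assumes \<Omega>: "bounded_C1_domain \<Omega>" and u: "u \<in> X_space \<Omega>" and \<alpha>: "0 \<le> \<alpha>" "\<alpha> \<le> 2"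
  shows "integrable lborel (\<lambda>\<xi>. norm \<xi> powr \<alpha> * power_spectrum u \<xi>)"
proof -
  have "bounded \<Omega>" using \<Omega> by (simp add: bounded_C1_domain_def)
  note D = X_spaceD[OF this u]
  have [measurable]: "u \<in> borel_measurable borel" using D(1) by (auto dest: borel_measurable_integrable)
  note 2 = has_bochner_integral_gradient_spectrum[OF \<Omega> D(1,3,4)]
  note 0 = has_bochner_integral_power_spectrum[OF D(1,2)]
  have "integrable lborel (\<lambda>\<xi>. power_spectrum u \<xi> + (norm \<xi>)\<^sup>2 * power_spectrum u \<xi>)"
    using 0 2 by (auto simp: has_bochner_integral_iff)
  thus "integrable lborel (\<lambda>\<xi>. norm \<xi> powr \<alpha> * power_spectrum u \<xi>)"
  proof (rule Bochner_Integration.integrable_bound)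
    have "norm \<xi> powr \<alpha> * power_spectrum u \<xi> \<le> power_spectrum u \<xi> + (norm \<xi>)\<^sup>2 * power_spectrum u \<xi>" for \<xi>
    proof -
      have "norm \<xi> powr \<alpha> \<le> 1 + (norm \<xi>)\<^sup>2"
      proof (cases "norm \<xi> \<le> 1")
        case True
        have "norm \<xi> powr \<alpha> \<le> 1" using True \<alpha> by (intro powr_le1) auto
        thus ?thesis by (simp add: add_increasing2)
      next
        case False
        have "norm \<xi> powr \<alpha> \<le> norm \<xi> powr 2" using False \<alpha> by (intro powr_mono) auto
        thus ?thesis by simp
      qed
      hence "norm \<xi> powr \<alpha> * power_spectrum u \<xi> \<le> (1 + (norm \<xi>)\<^sup>2) * power_spectrum u \<xi>"
        by (rule mult_right_mono) simp
      thus ?thesis by (simp add: algebra_simps)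
    qed
    thus "AE \<xi> in lborel. norm (norm \<xi> powr \<alpha> * power_spectrum u \<xi>) \<le> norm (power_spectrum u \<xi> + (norm \<xi>)\<^sup>2 * power_spectrum u \<xi>)"
      by (intro AE_I2) (simp add: abs_mult)
  qed measurable
qed

text \<open>The mean of |\<xi>|^\<alpha> over the ball which, filled to height V, has mass (2 pi)^n
  k. The values \<alpha> = 2 and \<alpha> = 2 s, with factors a and b, give the two lower bounds of
  part (i).\<close>

definition li_yau_bound :: "real \<Rightarrow> real \<Rightarrow> real \<Rightarrow> real \<Rightarrow> real" where
  "li_yau_bound n V \<alpha> k = n / (n + \<alpha>) * (4 * pi) powr (\<alpha> / 2) * (Gamma (1 + n / 2) / V) powr (\<alpha> / n) * k powr (\<alpha> / n)"

text \<open>The unit ball has volume pi^(n/2) / Gamma (1 + n/2), and (2 pi)^n = (4 pi)^(n/2)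
  pi^(n/2); so pi^(n/2) cancels and Gamma moves to the numerator.\<close>

lemma li_yau_bound_eq:
  assumes n: "n > 0" and V: "V > 0"
  shows "n / (n + \<alpha>) * (((2 * pi) powr n * k) / (V * unit_ball_vol n)) powr (\<alpha> / n) = li_yau_bound n V \<alpha> k"
proof -
  have "(2 * pi) powr n = (4 * pi * pi) powr (n / 2)"
    using powr_powr[of "2 * pi" 2 "n / 2"] by (simp add: powr_realpow power2_eq_square mult_ac)
  also have "\<dots> = (4 * pi) powr (n / 2) * pi powr (n / 2)" by (rule powr_mult)
  finally have p: "(2 * pi) powr n = (4 * pi) powr (n / 2) * pi powr (n / 2)" .
  have "((2 * pi) powr n * k) / (V * unit_ball_vol n) = (4 * pi) powr (n / 2) * (Gamma (1 + n / 2) / V) * k"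
    unfolding p unit_ball_vol_def using V by (simp add: add.commute field_simps)
  also have "\<dots> powr (\<alpha> / n) = ((4 * pi) powr (n / 2)) powr (\<alpha> / n) * (Gamma (1 + n / 2) / V) powr (\<alpha> / n) * k powr (\<alpha> / n)"
    by (simp only: powr_mult)
  also have "((4 * pi) powr (n / 2)) powr (\<alpha> / n) = (4 * pi) powr (\<alpha> / 2)"
    using n by (simp add: powr_powr)
  finally show ?thesis by (simp add: li_yau_bound_def)
qed

text \<open>The sum is essential: a single spectrum also lies below |\<Omega>|, but its mass is only
  (2 pi)^n, whereas k of them together, still below |\<Omega>|, must spread over k times the
  volume.\<close>

lemma sum_spectral_moment_ge:
  fixes u :: "nat \<Rightarrow> real^'n \<Rightarrow> real"
  assumes \<Omega>: "bounded_C1_domain \<Omega>" and u: "\<And>j. j \<in> {1..k} \<Longrightarrow> u j \<in> X_space \<Omega>"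
    and orth: "\<And>i j. i \<in> {1..k} \<Longrightarrow> j \<in> {1..k} \<Longrightarrow> (LINT x:\<Omega>|lborel. u i x * u j x) = (if i = j then 1 else 0)"
    and k: "k \<ge> 1" and \<alpha>: "0 < \<alpha>" "\<alpha> \<le> 2"
  shows "k * li_yau_bound CARD('n) (measure lborel \<Omega>) \<alpha> k
    \<le> (\<Sum>j=1..k. (LINT \<xi>|lborel. norm \<xi> powr \<alpha> * power_spectrum (u j) \<xi>) / (2 * pi) ^ CARD('n))"
proof -
  let ?c = "(2 * pi) ^ CARD('n)" and ?V = "measure lborel \<Omega>"
  have op: "open \<Omega>" "\<Omega> \<noteq> {}" "bounded \<Omega>" using \<Omega> by (auto simp: bounded_C1_domain_def)
  note D = X_spaceD[OF op(3) u]
  have [measurable]: "\<Omega> \<in> sets borel" using op by simp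
  have fin: "emeasure lborel \<Omega> < \<infinity>" by (rule emeasure_bounded_finite[OF op(3)])
  \<comment> \<open>|\<Omega>| is the height in \<open>bathtub\<close> and a divisor in
    \<open>li_yau_bound\<close>; it is positive because \<Omega> contains a ball.\<close>
  have V: "?V > 0"
  proof -
    obtain x r where "r > 0" "ball x r \<subseteq> \<Omega>" using op by (meson ex_in_conv open_contains_ball)
    hence "emeasure lborel (ball x r) \<le> emeasure lborel \<Omega>" by (intro emeasure_mono) auto
    moreover have "emeasure lborel (ball x r) > 0"
      using \<open>r > 0\<close> by (subst emeasure_ball) auto
    ultimately show ?thesis using fin by (metis Sigma_Algebra.measure_def enn2real_positive_iff infinity_ennreal_def less_le_trans)
  qed
  have norm1: "(LINT x|lborel. (u j x)\<^sup>2) = 1" if j: "j \<in> {1..k}" for j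
  proof -
    have [measurable]: "u j \<in> borel_measurable borel" using D(1)[OF j] by (auto dest: borel_measurable_integrable)
    have "(LINT x|lborel. (u j x)\<^sup>2) = (LINT x:\<Omega>|lborel. u j x * u j x)"
      unfolding set_lebesgue_integral_def
    proof (rule integral_cong_AE)
      show "AE x in lborel. (u j x)\<^sup>2 = indicat_real \<Omega> x *\<^sub>R (u j x * u j x)"
        using D(4)[OF j] by eventually_elim (auto simp: indicator_def power2_eq_square)
    qed measurable
    thus ?thesis using orth[OF j j] by simp
  qed
  let ?F = "\<lambda>\<xi>. \<Sum>j=1..k. power_spectrum (u j) \<xi>"
  have F: "has_bochner_integral lborel ?F (\<Sum>j=1..k. ?c * 1)"
  proof (rule has_bochner_integral_sum)
    fix j assume j: "j \<in> {1..k}"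
    show "has_bochner_integral lborel (power_spectrum (u j)) (?c * 1)"
      using has_bochner_integral_power_spectrum[OF D(1,2)[OF j]] by (simp add: norm1[OF j])
  qed
  have mom: "has_bochner_integral lborel (\<lambda>\<xi>. \<Sum>j=1..k. norm \<xi> powr \<alpha> * power_spectrum (u j) \<xi>)
      (\<Sum>j=1..k. LINT \<xi>|lborel. norm \<xi> powr \<alpha> * power_spectrum (u j) \<xi>)"
    using integrable_powr_spectrum[OF \<Omega> u] \<alpha>
    by (intro has_bochner_integral_sum) (auto simp: has_bochner_integral_iff)
  have ineq: "real DIM(real^'n) / (real DIM(real^'n) + \<alpha>) * (?c * k) * ((?c * k) / (?V * unit_ball_vol DIM(real^'n))) powr (\<alpha> / DIM(real^'n))
     \<le> (LINT \<xi>|lborel. norm \<xi> powr \<alpha> * ?F \<xi>)"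
  proof (rule bathtub[OF \<alpha>(1) V])
    show "?F \<xi> \<le> ?V" for \<xi>
      by (intro sum_power_spectrum_le D fin orth) auto
    show "integrable lborel ?F" "integral\<^sup>L lborel ?F = ?c * k"
      using F by (auto simp: has_bochner_integral_iff mult.commute)
    show "integrable lborel (\<lambda>\<xi>. norm \<xi> powr \<alpha> * ?F \<xi>)"
      using mom by (simp add: sum_distrib_left has_bochner_integral_iff)
    show "0 < ?c * k" using k by simp
  qed (auto intro: sum_nonneg)
  have "k * li_yau_bound CARD('n) ?V \<alpha> k = (real CARD('n) / (real CARD('n) + \<alpha>) * (?c * k) * ((?c * k) / (?V * unit_ball_vol CARD('n))) powr (\<alpha> / CARD('n))) / ?c"
  proof -
    have "?c = (2 * pi) powr real CARD('n)" by (simp add: powr_realpow)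
    hence "li_yau_bound CARD('n) ?V \<alpha> k = real CARD('n) / (real CARD('n) + \<alpha>) * ((?c * k) / (?V * unit_ball_vol CARD('n))) powr (\<alpha> / CARD('n))"
      using li_yau_bound_eq[where n="real CARD('n)" and V="?V" and k="real k" and \<alpha>=\<alpha>] V k by simp
    thus ?thesis by simp
  qed
  also have "\<dots> \<le> (LINT \<xi>|lborel. norm \<xi> powr \<alpha> * ?F \<xi>) / ?c"
    using ineq by (intro divide_right_mono) auto
  also have "(LINT \<xi>|lborel. norm \<xi> powr \<alpha> * ?F \<xi>) = (\<Sum>j=1..k. LINT \<xi>|lborel. norm \<xi> powr \<alpha> * power_spectrum (u j) \<xi>)"
    using mom by (simp add: sum_distrib_left has_bochner_integral_iff)
  finally show ?thesis by (simp add: sum_divide_distrib)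
qed

lemma sum_le_card_mult_last:
  fixes lam :: "nat \<Rightarrow> real"
  assumes "k \<ge> 1" "\<And>j. 1 \<le> j \<Longrightarrow> j \<le> k \<Longrightarrow> lam j \<le> lam k"
  shows "(\<Sum>j=1..k. lam j) \<le> k * lam k"
  using sum_bounded_above[of "{1..k}" lam "lam k"] assms by auto

theorem corollary1p2:
  fixes \<Omega> :: "(real^'n) set" and lam :: "nat \<Rightarrow> real" and u :: "nat \<Rightarrow> real^'n \<Rightarrow> real"
    and a b s n :: real
  assumes "n = real CARD('n)"
    and "0 < s" and "s < 1"
    and "bounded_C1_domain \<Omega>"
    and "eigen_listing a b s \<Omega> lam u"
  shows "(a > 0 \<and> b > 0 \<longrightarrow>
            (\<forall>k\<ge>1. lam k \<ge> n * max
               (4 * a * pi / (n + 2) *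
                  (Gamma (1 + n / 2) / measure lborel \<Omega>) powr (2 / n) * real k powr (2 / n))
               ((4 * pi) powr s * b / (n + 2 * s) *
                  (Gamma (1 + n / 2) / measure lborel \<Omega>) powr (2 * s / n)
                  * real k powr (2 * s / n)))) \<and>
         (\<forall>C\<^sub>E. embedding_const s \<Omega> C\<^sub>E \<and> a > 0 \<and> - (a / C\<^sub>E) < b \<and> b < 0 \<longrightarrow>
            (\<forall>k\<ge>1. lam k \<ge> (a + C\<^sub>E * b) * n * max
               (4 * pi / (n + 2) *
                  (Gamma (1 + n / 2) / measure lborel \<Omega>) powr (2 / n) * real k powr (2 / n))
               ((4 * pi) powr s / ((n + 2 * s) * C\<^sub>E) *
                  (Gamma (1 + n / 2) / measure lborel \<Omega>) powr (2 * s / n)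
                  * real k powr (2 * s / n))))"
proof -
  note s = assms(2,3) and \<Omega> = assms(4)
  have n: "n > 0" using assms(1) by simp
  have b\<Omega>: "bounded \<Omega>" using \<Omega> by (simp add: bounded_C1_domain_def)
  have u: "u j \<in> X_space \<Omega>" and eig: "weak_solution a b s \<Omega> (lam j) (u j)" if "j \<ge> 1" for j
    using assms(5) that by (auto simp: eigen_listing_def eigenfunction_def weak_solution_def)
  have mono: "lam j \<le> lam k" if "j \<ge> 1" "k \<ge> j" for j k
    using assms(5) that by (auto simp: eigen_listing_def)
  have orth: "(LINT x:\<Omega>|lborel. u i x * u j x) = (if i = j then 1 else 0)" if "i \<ge> 1" "j \<ge> 1" for i j
    using assms(5) that unfolding eigen_listing_def by metis
  define T where "T j = (LINT x:\<Omega>|lborel. (norm (weak_grad (u j) x))\<^sup>2)" for j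
  define E where "E j = frac_form s (u j) (u j)" for j
  let ?c = "(2 * pi) ^ CARD('n)"
  \<comment> \<open>The eigenfunction serves as its own test function, and its L2 norm on \<Omega>
    is 1.\<close>
  have lam: "lam j = a * T j + b * E j" if "j \<ge> 1" for j
  proof -
    have "a * (LINT x:\<Omega>|lborel. weak_grad (u j) x \<bullet> weak_grad (u j) x) + b * frac_form s (u j) (u j) = lam j * (LINT x:\<Omega>|lborel. u j x * u j x)"
      using eig[OF that] u[OF that] by (simp add: weak_solution_def)
    thus ?thesis using orth[OF that that] by (simp add: T_def E_def power2_norm_eq_inner)
  qed
  have T_eq: "T j = (LINT \<xi>|lborel. norm \<xi> powr 2 * power_spectrum (u j) \<xi>) / ?c" if "j \<ge> 1" for j
    using integral_gradient_spectrum[OF \<Omega> u[OF that]] by (simp add: T_def)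
  have E_eq: "E j = (LINT \<xi>|lborel. norm \<xi> powr (2 * s) * power_spectrum (u j) \<xi>) / ?c" if "j \<ge> 1" for j
    unfolding E_def using s
    by (intro frac_form_eq_power_spectrum X_spaceD[OF b\<Omega> u[OF that]] integrable_powr_spectrum[OF \<Omega> u[OF that]]) auto
  have T0: "T j \<ge> 0" if "j \<ge> 1" for j
    unfolding T_eq[OF that] by (intro divide_nonneg_pos integral_nonneg_AE) auto
  have E0: "E j \<ge> 0" if "j \<ge> 1" for j
    unfolding E_eq[OF that] by (intro divide_nonneg_pos integral_nonneg_AE) auto
  let ?B = "\<lambda>\<alpha> k. li_yau_bound n (measure lborel \<Omega>) \<alpha> (real k)"
  have T_sum: "k * ?B 2 k \<le> (\<Sum>j=1..k. T j)" if k: "k \<ge> 1" for k :: nat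
  proof -
    have "k * ?B 2 k \<le> (\<Sum>j=1..k. (LINT \<xi>|lborel. norm \<xi> powr 2 * power_spectrum (u j) \<xi>) / ?c)"
      unfolding assms(1) by (rule sum_spectral_moment_ge[OF \<Omega> u orth k]) auto
    thus ?thesis by (simp add: T_eq)
  qed
  have E_sum: "k * ?B (2 * s) k \<le> (\<Sum>j=1..k. E j)" if k: "k \<ge> 1" for k :: nat
  proof -
    have "k * ?B (2 * s) k \<le> (\<Sum>j=1..k. (LINT \<xi>|lborel. norm \<xi> powr (2 * s) * power_spectrum (u j) \<xi>) / ?c)"
      unfolding assms(1) by (rule sum_spectral_moment_ge[OF \<Omega> u orth k]) (use s in auto)
    thus ?thesis by (simp add: E_eq)
  qed
  have sum_lam: "(\<Sum>j=1..k. lam j) \<le> k * lam k" if "k \<ge> 1" for k :: nat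
    using that mono by (intro sum_le_card_mult_last) auto
  show ?thesis
  proof (intro conjI impI allI)
    fix k :: nat assume ab: "a > 0 \<and> b > 0" and k: "1 \<le> k"
    \<comment> \<open>With a and b positive, either energy may be dropped from \<open>lam j\<close>;
      each choice yields one entry of the maximum.\<close>
    have "real k * (a * ?B 2 k) \<le> (\<Sum>j=1..k. lam j)"
    proof -
      have "real k * (a * ?B 2 k) = a * (k * ?B 2 k)" by simp
      also have "\<dots> \<le> a * (\<Sum>j=1..k. T j)" using ab by (intro mult_left_mono T_sum k) auto
      also have "\<dots> \<le> (\<Sum>j=1..k. lam j)"
        unfolding sum_distrib_left using ab E0 by (intro sum_mono) (simp add: lam)
      finally show ?thesis .
    qed
    hence "real k * (a * ?B 2 k) \<le> real k * lam k" using sum_lam[OF k] by linarith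
    hence 1: "a * ?B 2 k \<le> lam k" using k by simp
    have "real k * (b * ?B (2 * s) k) \<le> (\<Sum>j=1..k. lam j)"
    proof -
      have "real k * (b * ?B (2 * s) k) = b * (k * ?B (2 * s) k)" by simp
      also have "\<dots> \<le> b * (\<Sum>j=1..k. E j)" using ab by (intro mult_left_mono E_sum k) auto
      also have "\<dots> \<le> (\<Sum>j=1..k. lam j)"
        unfolding sum_distrib_left using ab T0 by (intro sum_mono) (simp add: lam)
      finally show ?thesis .
    qed
    hence "real k * (b * ?B (2 * s) k) \<le> real k * lam k" using sum_lam[OF k] by linarith
    hence 2: "b * ?B (2 * s) k \<le> lam k" using k by simp
    show "n * max (4 * a * pi / (n + 2) * (Gamma (1 + n / 2) / measure lborel \<Omega>) powr (2 / n) * real k powr (2 / n))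
         ((4 * pi) powr s * b / (n + 2 * s) * (Gamma (1 + n / 2) / measure lborel \<Omega>) powr (2 * s / n) * real k powr (2 * s / n)) \<le> lam k"
      using 1 2 by (simp add: max_def li_yau_bound_def mult_ac)
  next
    fix C :: real and k :: nat assume A: "embedding_const s \<Omega> C \<and> a > 0 \<and> - (a / C) < b \<and> b < 0" and k: "1 \<le> k"
    have C: "C \<ge> 1" and emb: "\<And>j. j \<ge> 1 \<Longrightarrow> E j \<le> C * T j"
      using A u by (auto simp: embedding_const_def E_def T_def)
    define g where "g = a + C * b"
    have g: "g > 0" using A C by (simp add: g_def field_simps)
    \<comment> \<open>Since b is negative, E j <= C * T j bounds b * E j from below by b * C * T j,
      which leaves the gradient energy with the coefficient g.\<close>
    have gT: "g * T j \<le> lam j" if "j \<ge> 1" for j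
    proof -
      have "b * (C * T j) \<le> b * E j" using A emb[OF that] by (intro mult_left_mono_neg) auto
      thus ?thesis by (simp add: lam[OF that] g_def algebra_simps)
    qed
    have gT_sum: "g * (\<Sum>j=1..k. T j) \<le> (\<Sum>j=1..k. lam j)"
      unfolding sum_distrib_left by (intro sum_mono gT) auto
    have "real k * (g * ?B 2 k) \<le> (\<Sum>j=1..k. lam j)"
    proof -
      have "real k * (g * ?B 2 k) = g * (k * ?B 2 k)" by simp
      also have "\<dots> \<le> g * (\<Sum>j=1..k. T j)" using g by (intro mult_left_mono T_sum k) auto
      finally show ?thesis using gT_sum by linarith
    qed
    hence "real k * (g * ?B 2 k) \<le> real k * lam k" using sum_lam[OF k] by linarith
    hence 1: "g * ?B 2 k \<le> lam k" using k by simp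
    have "real k * (g * (?B (2 * s) k / C)) \<le> (\<Sum>j=1..k. lam j)"
    proof -
      have "real k * (g * (?B (2 * s) k / C)) = g * ((k * ?B (2 * s) k) / C)" by simp
      also have "\<dots> \<le> g * ((\<Sum>j=1..k. E j) / C)"
        using g C by (intro mult_left_mono divide_right_mono E_sum k) auto
      \<comment> \<open>The embedding in its other role: T j >= E j / C, so the gradient sum
        inherits the fractional bound. This is the origin of the constant in the denominator of the
        second entry.\<close>
      also have "(\<Sum>j=1..k. E j) / C \<le> (\<Sum>j=1..k. T j)"
        unfolding sum_divide_distrib using C emb by (intro sum_mono) (simp add: field_simps)
      hence "g * ((\<Sum>j=1..k. E j) / C) \<le> g * (\<Sum>j=1..k. T j)"
        using g by (intro mult_left_mono) auto
      finally show ?thesis using gT_sum by linarith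
    qed
    hence "real k * (g * (?B (2 * s) k / C)) \<le> real k * lam k" using sum_lam[OF k] by linarith
    hence 2: "g * (?B (2 * s) k / C) \<le> lam k"
      by (rule mult_left_le_imp_le) (use k in simp)
    show "(a + C * b) * n * max (4 * pi / (n + 2) * (Gamma (1 + n / 2) / measure lborel \<Omega>) powr (2 / n) * real k powr (2 / n))
         ((4 * pi) powr s / ((n + 2 * s) * C) * (Gamma (1 + n / 2) / measure lborel \<Omega>) powr (2 * s / n) * real k powr (2 * s / n)) \<le> lam k"
      using 1 2 unfolding g_def[symmetric] by (simp add: max_def li_yau_bound_def mult_ac)
  qed
qed

end
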